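(* Let $d\in\mathbb N^*$, $H\in\,]1/2,1[$, $A\in\mathcal M_d(\mathbb R)$, $S(t):=\exp(At)$ for $t\in\mathbb R$, and let $b:\mathbb R\times\mathbb R^d\to\mathbb R^d$ and $\sigma:\mathbb R\to\mathcal M_d(\mathbb R)$ be continuous. Let $B$ be a $d$-dimensional two-sided fractional Brownian motion of Hurst index $H$ on its canonical space $(\Omega,\mathcal A,\mathbb P)$, with Wiener shift $\theta$. Assume: (1) there exist $\mathfrak c_S,\mathfrak m_S>0$ such that $\|S(t)\|_{\mathrm{op}}\leqslant \mathfrak c_S e^{-\mathfrak m_S t}$ for every $t\in\mathbb R$; (2) there exist $\mathfrak c_b,\mathfrak m_b>0$ such that, for every $t\in\mathbb R$ and $x,y\in\mathbb R^d$, $\|b(t,x)-b(t,y)\|\leqslant\mathfrak c_b\|x-y\|$ and $\|b(t,x)\|\leqslant\mathfrak m_b(1+\|x\|)$; (3) for every $t\in\mathbb R$, $S(t-\cdot)\sigma(\cdot)\mathbf 1_{]-\infty,t]}(\cdot)\in|\mathcal H|_d$; (4) there is $\tau>0$ such that $\sigma$ is $\tau$-periodic and $b(\cdot,x)$ is $\tau$-periodic for every $x\in\mathbb R^d$. If $\mathfrak c_S\mathfrak c_b/\mathfrak m_S<1$, then the equation $$dX(t)=(AX(t)+b(t,X(t)))\,dt+\sigma(t)\,dB(t),\quad t\in\mathbb R,$$ has a unique continuous, uniformly bounded and $\theta$-$\tau$-periodic solution.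
   Context: Canonical space: $\Omega$ is the space of continuous functions $\omega:\mathbb R\to\mathbb R^d$ with $\omega(0)=0$, $\mathcal A$ its Borel $\sigma$-algebra (topology of locally uniform convergence), $\mathbb P$ the law of the $d$-dimensional two-sided fractional Brownian motion (independent components $B_1,\dots,B_d$) of Hurst index $H$, and $B(t,\omega)=\omega(t)$. The Wiener shift is $\theta=(\theta_t)_{t\in\mathbb R}$, $\theta_t\omega:=\omega(t+\cdot)-\omega(t)$; it is a group of $\mathbb P$-preserving transformations. For a continuous process $Y=(Y(t))_{t\in\mathbb R}$, $\mathfrak T_\tau Y(t,\omega):=Y(t+\tau,\theta_{-\tau}\omega)$; $Y$ is $\theta$-$\tau$-periodic if $\mathfrak T_\tau Y=Y$ (for every $t$, almost surely). Uniformly bounded means $\sup_{t\in\mathbb R}\mathbb E(\|Y(t)\|^2)<\infty$. Processes are identified up to modification. Wiener integrals: $|\mathcal H|$ is the set of measurable $h:\mathbb R\to\mathbb R$ with $H(2H-1)\int_{\mathbb R}\int_{\mathbb R}|t-s|^{2H-2}|h(s)||h(t)|\,ds\,dt<\infty$; $|\mathcal H|_d$ is the set of measurable $h:\mathbb R\to\mathcal M_d(\mathbb R)$ with all entries in $|\mathcal H|$. If $h\mathbf 1_{[s,t]}\in|\mathcal H|_d$, then $\int_s^t h(u)\,dB(u)$ is the vector with $i$-th component $\sum_{j=1}^d\int_s^t h_{i,j}(u)\,dB_j(u)$, where each scalar integral is the Wiener integral (for continuous integrands, the $\mathbb L^2$-limit of Riemann sums $\sum_k h_{i,j}(t_k)(B_j(t_{k+1})-B_j(t_k))$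 as the mesh tends to $0$). If $h\mathbf 1_{]-\infty,t]}\in|\mathcal H|_d$, then $\int_{-\infty}^t h(u)\,dB(u)$ is the $\mathbb L^2$-limit of $\int_{-s}^t h(u)\,dB(u)$ as $s\to\infty$. Solution: a continuous $\mathbb R^d$-valued process $X$ is a solution of the equation iff for every $t\in\mathbb R$ $$X(t)=\int_{-\infty}^{t}S(t-s)b(s,X(s))\,ds+\int_{-\infty}^{t}S(t-s)\sigma(s)\,dB(s).$$ *)

theory Defs
  imports "HOL-Probability.Probability"
begin

section \<open>Matrix exponential\<close>

text \<open>The library operations \<open>*\<close> and \<open>^\<close> on \<^typ>\<open>real^'d^'d\<close> are componentwise, and the
  library function \<^const>\<open>exp\<close> is not available at this type; hence the exponential series
  is written with the matrix product \<open>**\<close>.\<close>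

definition matrix_pow :: "real^'d^'d \<Rightarrow> nat \<Rightarrow> real^'d^'d" where
  "matrix_pow M k = (((**) M) ^^ k) (mat 1)"

definition matrix_exp :: "real^'d^'d \<Rightarrow> real^'d^'d" where
  "matrix_exp M = (\<Sum>k. inverse (fact k) *\<^sub>R matrix_pow M k)"

section \<open>Canonical path space and Wiener shift\<close>

definition path_space :: "(real \<Rightarrow> real^'d) set" where
  "path_space = {\<omega>. continuous_on UNIV \<omega> \<and> \<omega> 0 = 0}"

text \<open>Basic neighbourhoods of a path are the sets of paths that are uniformly close to it on
  a compact set of times, which is the topology of locally uniform convergence.\<close>

definition path_topology :: "(real \<Rightarrow> real^'d) topology" where
  "path_topology = topology (\<lambda>U. U \<subseteq> path_space \<and>
     (\<forall>\<omega>\<in>U. \<exists>K e. compact K \<and> 0 < e \<and>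
        {\<eta>\<in>path_space. \<forall>t\<in>K. dist (\<eta> t) (\<omega> t) < e} \<subseteq> U))"

lemma openin_path_topology:
  "openin path_topology U \<longleftrightarrow> U \<subseteq> path_space \<and>
     (\<forall>\<omega>\<in>U. \<exists>K e. compact K \<and> 0 < e \<and>
        {\<eta>\<in>path_space. \<forall>t\<in>K. dist (\<eta> t) (\<omega> t) < e} \<subseteq> U)"
proof -
  let ?N = "\<lambda>K e \<omega>. {\<eta>\<in>path_space. \<forall>t\<in>K. dist (\<eta> t) (\<omega> t) < (e::real)}"
  let ?O = "\<lambda>U. U \<subseteq> path_space \<and> (\<forall>\<omega>\<in>U. \<exists>K e. compact K \<and> 0 < e \<and> ?N K e \<omega> \<subseteq> U)"
  have "?O (U \<inter> V)" if U: "?O U" and V: "?O V" for U V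
  proof (intro conjI ballI)
    show "U \<inter> V \<subseteq> path_space" using U by blast
    fix \<omega> assume "\<omega> \<in> U \<inter> V"
    with U V obtain K e K' e' where *: "compact K" "0 < e" "?N K e \<omega> \<subseteq> U"
      "compact K'" "0 < e'" "?N K' e' \<omega> \<subseteq> V" by (meson IntD1 IntD2)
    have "?N (K \<union> K') (min e e') \<omega> \<subseteq> ?N K e \<omega>" "?N (K \<union> K') (min e e') \<omega> \<subseteq> ?N K' e' \<omega>" by auto
    with * have "compact (K \<union> K') \<and> 0 < min e e' \<and> ?N (K \<union> K') (min e e') \<omega> \<subseteq> U \<inter> V" by auto
    then show "\<exists>K e. compact K \<and> 0 < e \<and> ?N K e \<omega> \<subseteq> U \<inter> V" by blast
  qed
  moreover have "?O (\<Union>\<U>)" if "\<forall>U\<in>\<U>. ?O U" for \<U>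
  proof (intro conjI ballI)
    show "\<Union>\<U> \<subseteq> path_space" using that by blast
    fix \<omega> assume "\<omega> \<in> \<Union>\<U>"
    then obtain U where U: "U \<in> \<U>" "\<omega> \<in> U" by blast
    with that obtain K e where "compact K" "0 < e" "?N K e \<omega> \<subseteq> U" by meson
    with U show "\<exists>K e. compact K \<and> 0 < e \<and> ?N K e \<omega> \<subseteq> \<Union>\<U>" by (meson Union_upper subset_trans)
  qed
  ultimately have "istopology ?O" unfolding istopology_def by blast
  then show ?thesis unfolding path_topology_def by (subst topology_inverse') auto
qed

lemma topspace_path_topology: "topspace path_topology = path_space"
proof -
  have "openin path_topology path_space"
    unfolding openin_path_topology by (auto intro!: exI[of _ "{}"] exI[of _ "1::real"])
  moreover have "topspace path_topology \<subseteq> path_space"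
    using openin_path_topology[of "topspace path_topology"] by auto
  ultimately show ?thesis using openin_subset by blast
qed

definition path_borel :: "(real \<Rightarrow> real^'d) measure" where
  "path_borel = sigma path_space {U. openin path_topology U}"

definition coordinate_process :: "real \<Rightarrow> (real \<Rightarrow> real^'d) \<Rightarrow> real^'d" where
  "coordinate_process t \<omega> = \<omega> t"

definition wiener_shift :: "real \<Rightarrow> (real \<Rightarrow> real^'d) \<Rightarrow> (real \<Rightarrow> real^'d)" where
  "wiener_shift t \<omega> = (\<lambda>s. \<omega> (t + s) - \<omega> t)"

section \<open>Fractional Brownian motion\<close>

text \<open>The parameters are mean and standard deviation; standard deviation 0 gives the
  Dirac measure.\<close>

definition normal_law :: "real \<Rightarrow> real \<Rightarrow> real measure" where
  "normal_law m s =
     (if s = 0 then return borel m else density lborel (\<lambda>x. ennreal (normal_density m s x)))"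

definition gaussian_process :: "'w measure \<Rightarrow> (real \<Rightarrow> 'w \<Rightarrow> real) \<Rightarrow> bool" where
  "gaussian_process M X \<longleftrightarrow> (\<forall>t. X t \<in> borel_measurable M) \<and>
     (\<forall>J a. finite J \<longrightarrow>
        (\<exists>m s. 0 \<le> s \<and> distr M borel (\<lambda>\<omega>. \<Sum>t\<in>J. a t * X t \<omega>) = normal_law m s))"

definition fbm_scalar :: "'w measure \<Rightarrow> real \<Rightarrow> (real \<Rightarrow> 'w \<Rightarrow> real) \<Rightarrow> bool" where
  "fbm_scalar M H X \<longleftrightarrow> prob_space M \<and> gaussian_process M X \<and>
     (\<forall>\<omega>\<in>space M. continuous_on UNIV (\<lambda>t. X t \<omega>)) \<and>
     (\<forall>t. (LINT \<omega>|M. X t \<omega>) = 0) \<and>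
     (\<forall>s t. (LINT \<omega>|M. X s \<omega> * X t \<omega>) =
        (\<bar>s\<bar> powr (2 * H) + \<bar>t\<bar> powr (2 * H) - \<bar>t - s\<bar> powr (2 * H)) / 2)"

text \<open>Independence of the components is independence of the whole processes, viewed as random
  elements of the product space of real functions on the time axis.\<close>

definition fbm :: "'w measure \<Rightarrow> real \<Rightarrow> (real \<Rightarrow> 'w \<Rightarrow> real^'d) \<Rightarrow> bool" where
  "fbm M H B \<longleftrightarrow> prob_space M \<and> (\<forall>i. fbm_scalar M H (\<lambda>t \<omega>. B t \<omega> $ i)) \<and>
     prob_space.indep_vars M (\<lambda>i::'d. \<Pi>\<^sub>M t\<in>(UNIV::real set). (borel :: real measure))
       (\<lambda>i \<omega> t. B t \<omega> $ i) UNIV"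

definition canonical_fbm_law :: "real \<Rightarrow> (real \<Rightarrow> real^'d) measure \<Rightarrow> bool" where
  "canonical_fbm_law H P \<longleftrightarrow> sets P = sets path_borel \<and> fbm P H coordinate_process"

section \<open>Wiener integrals\<close>

definition abs_H :: "real \<Rightarrow> (real \<Rightarrow> real) set" where
  "abs_H H = {h. h \<in> borel_measurable borel \<and>
     ennreal (H * (2 * H - 1)) *
       (\<integral>\<^sup>+t. (\<integral>\<^sup>+s. ennreal (\<bar>t - s\<bar> powr (2 * H - 2) * \<bar>h s\<bar> * \<bar>h t\<bar>) \<partial>lborel) \<partial>lborel) < \<infinity>}"

definition abs_H_mat :: "real \<Rightarrow> (real \<Rightarrow> real^'d^'d) set" where
  "abs_H_mat H = {h. \<forall>i j. (\<lambda>u. h u $ i $ j) \<in> abs_H H}"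

definition L2_dist_sq ::
  "'w measure \<Rightarrow> ('w \<Rightarrow> 'b::real_normed_vector) \<Rightarrow> ('w \<Rightarrow> 'b) \<Rightarrow> ennreal" where
  "L2_dist_sq M X Y = (\<integral>\<^sup>+\<omega>. ennreal ((norm (X \<omega> - Y \<omega>))\<^sup>2) \<partial>M)"

text \<open>The integral \<open>\<integral>\<^sub>s\<^sup>t h(u) d\<beta>(u)\<close> of a continuous integrand with respect to a scalar
  fractional Brownian motion \<open>\<beta>\<close> is the \<open>L\<^sup>2\<close> limit of the left-point Riemann sums over the
  subdivisions \<open>s = p 0 < \<dots> < p n = t\<close> as their mesh tends to 0. It is determined
  only almost surely, hence a relation: \<open>I\<close> is a version of the integral.\<close>

definition has_wiener_integral_scalar ::
  "'w measure \<Rightarrow> (real \<Rightarrow> 'w \<Rightarrow> real) \<Rightarrow> (real \<Rightarrow> real) \<Rightarrow> real \<Rightarrow> real \<Rightarrow> ('w \<Rightarrow> real) \<Rightarrow> bool" where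
  "has_wiener_integral_scalar M \<beta> h s t I \<longleftrightarrow>
     s \<le> t \<and> continuous_on {s..t} h \<and> I \<in> borel_measurable M \<and>
     (\<forall>e>0. \<exists>\<delta>>0. \<forall>n (p :: nat \<Rightarrow> real).
        p 0 = s \<and> p n = t \<and> (\<forall>k<n. p k < p (Suc k) \<and> p (Suc k) - p k < \<delta>) \<longrightarrow>
        L2_dist_sq M (\<lambda>\<omega>. \<Sum>k<n. h (p k) * (\<beta> (p (Suc k)) \<omega> - \<beta> (p k) \<omega>)) I < e)"

definition has_wiener_integral ::
  "'w measure \<Rightarrow> real \<Rightarrow> (real \<Rightarrow> 'w \<Rightarrow> real^'d) \<Rightarrow> (real \<Rightarrow> real^'d^'d) \<Rightarrow> real \<Rightarrow> real \<Rightarrow>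
     ('w \<Rightarrow> real^'d) \<Rightarrow> bool" where
  "has_wiener_integral M H B h s t I \<longleftrightarrow>
     (\<lambda>u. indicator {s..t} u *\<^sub>R h u) \<in> abs_H_mat H \<and> I \<in> borel_measurable M \<and>
     (\<exists>J. (\<forall>i j. has_wiener_integral_scalar M (\<lambda>u \<omega>. B u \<omega> $ j) (\<lambda>u. h u $ i $ j) s t (J i j)) \<and>
          (AE \<omega> in M. \<forall>i. I \<omega> $ i = (\<Sum>j\<in>UNIV. J i j \<omega>)))"

text \<open>\<open>I\<close> is a version of \<open>\<integral>\<^sub>-\<^sub>\<infinity>\<^sup>t h(u) dB(u)\<close>.\<close>

definition has_wiener_integral_lower_infinite ::
  "'w measure \<Rightarrow> real \<Rightarrow> (real \<Rightarrow> 'w \<Rightarrow> real^'d) \<Rightarrow> (real \<Rightarrow> real^'d^'d) \<Rightarrow> real \<Rightarrow>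
     ('w \<Rightarrow> real^'d) \<Rightarrow> bool" where
  "has_wiener_integral_lower_infinite M H B h t I \<longleftrightarrow>
     (\<lambda>u. indicator {..t} u *\<^sub>R h u) \<in> abs_H_mat H \<and> I \<in> borel_measurable M \<and>
     (\<exists>J. (\<forall>\<^sub>F s in at_top. has_wiener_integral M H B h (- s) t (J s)) \<and>
          ((\<lambda>s. L2_dist_sq M (J s) I) \<longlongrightarrow> 0) at_top)"

section \<open>Processes on the canonical space and solutions\<close>

definition continuous_process ::
  "'w measure \<Rightarrow> (real \<Rightarrow> 'w \<Rightarrow> 'b::real_normed_vector) \<Rightarrow> bool" where
  "continuous_process M Y \<longleftrightarrow> (\<forall>t. Y t \<in> borel_measurable M) \<and>
     (\<forall>\<omega>\<in>space M. continuous_on UNIV (\<lambda>t. Y t \<omega>))"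

definition modification_of ::
  "'w measure \<Rightarrow> (real \<Rightarrow> 'w \<Rightarrow> 'b) \<Rightarrow> (real \<Rightarrow> 'w \<Rightarrow> 'b) \<Rightarrow> bool" where
  "modification_of M Y X \<longleftrightarrow> (\<forall>t. AE \<omega> in M. Y t \<omega> = X t \<omega>)"

definition uniformly_bounded ::
  "'w measure \<Rightarrow> (real \<Rightarrow> 'w \<Rightarrow> 'b::real_normed_vector) \<Rightarrow> bool" where
  "uniformly_bounded M Y \<longleftrightarrow> (SUP t. \<integral>\<^sup>+\<omega>. ennreal ((norm (Y t \<omega>))\<^sup>2) \<partial>M) < \<infinity>"

definition shift_process ::
  "real \<Rightarrow> (real \<Rightarrow> (real \<Rightarrow> real^'d) \<Rightarrow> 'b) \<Rightarrow> real \<Rightarrow> (real \<Rightarrow> real^'d) \<Rightarrow> 'b" where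
  "shift_process \<tau> Y t \<omega> = Y (t + \<tau>) (wiener_shift (- \<tau>) \<omega>)"

definition theta_periodic ::
  "(real \<Rightarrow> real^'d) measure \<Rightarrow> real \<Rightarrow> (real \<Rightarrow> (real \<Rightarrow> real^'d) \<Rightarrow> 'b) \<Rightarrow> bool" where
  "theta_periodic P \<tau> Y \<longleftrightarrow> modification_of P (shift_process \<tau> Y) Y"

text \<open>The drift term is a pathwise Lebesgue integral. Its integrability is required explicitly,
  because the library integral of a non-integrable function is 0.\<close>

definition mild_solution ::
  "(real \<Rightarrow> real^'d) measure \<Rightarrow> real \<Rightarrow> real^'d^'d \<Rightarrow> (real \<Rightarrow> real^'d \<Rightarrow> real^'d) \<Rightarrow>
     (real \<Rightarrow> real^'d^'d) \<Rightarrow> (real \<Rightarrow> (real \<Rightarrow> real^'d) \<Rightarrow> real^'d) \<Rightarrow> bool" where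
  "mild_solution P H A b \<sigma> X \<longleftrightarrow> continuous_process P X \<and>
     (\<forall>t. \<exists>I. has_wiener_integral_lower_infinite P H coordinate_process
                (\<lambda>s. matrix_exp ((t - s) *\<^sub>R A) ** \<sigma> s) t I \<and>
        (AE \<omega> in P.
           set_integrable lborel {..t} (\<lambda>s. matrix_exp ((t - s) *\<^sub>R A) *v b s (X s \<omega>)) \<and>
           X t \<omega> =
             (LINT s:{..t}|lborel. matrix_exp ((t - s) *\<^sub>R A) *v b s (X s \<omega>)) + I \<omega>))"

end

theory Submission
  imports Defs "HOL-Library.Periodic_Fun"
begin

text \<open>For \<open>H > 1/2\<close> the increments of fractional Brownian motion are positively correlated, so
  \<open>E (\<Sum>\<^sub>k c\<^sub>k \<Delta>\<^sub>k B)\<^sup>2 \<le> (max \<bar>c\<^sub>k\<bar>)\<^sup>2 E (\<Sum>\<^sub>k \<Delta>\<^sub>k B)\<^sup>2\<close>. This one inequality yields the Wiener integral of continuous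
  integrands, the bound \<open>E \<bar>\<integral>\<^sub>s\<^sup>t h dB\<bar>\<^sup>2 \<le> C (t - s)\<^sup>2\<^sup>H\<close>, and, summing over unit intervals, the convergence of
  the stochastic convolution \<open>Z t = \<integral> S (t - s) \<sigma> s dB s\<close> over the half-line. Since \<open>2 H > 1\<close>, second moments
  suffice for a continuous version of \<open>Z\<close>. It is built as a limit of Riemann sums on grids that move with \<open>t\<close>,
  hence \<open>Z (t + \<tau>) (\<theta>\<^sub>-\<^sub>\<tau> \<omega>) = Z t \<omega>\<close> holds for every path, and invariance of the law under the
  shift is never needed. Given a path \<open>z\<close> of \<open>Z\<close>, the equation for \<open>Y = X - z\<close> is solved by Picard iteration in an
  exponentially weighted space; the iterates, and so the solution, inherit the shift property and have
  uniformly bounded second moments. Uniqueness is the contraction estimate for \<open>sup\<^sub>t E \<bar>X t - Y t\<bar>\<^sup>2\<close>.\<close>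

section \<open>Mean square convergence\<close>

text \<open>Periodicity compares values at two different paths, and the preimage of a null set under
  the shift is null only by invariance of the law. Hence exceptional sets cannot be chosen freely:
  wherever a path has to be discarded (dyadic values not regular, noise not integrable against the
  weight), the condition is one that a path satisfies exactly when its shift by
  \<open>- \<tau>\<close> does, and the value given there is 0. For the same reason the dyadic grids
  have step \<open>\<tau> / 2 ^ n\<close>, and the number of Riemann points depends neither on the
  time nor on the path.

  The Picard iterates are estimated twice. The pathwise estimate gives convergence for every path,
  but its constant depends on the path and the bound deteriorates as |t| grows, so it does not
  control second moments uniformly in time. Those come from a separate recursion in mean square, in
  which one step multiplies by \<open>(cS * cb / mS)\<^sup>2\<close> up to a factor
  \<open>1 + r\<close> that keeps the product below 1. Subtracting \<open>z\<close> helps in both: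
  the drift integral turns a path that is merely integrable against the weight into a function with
  pointwise bounded growth.\<close>

lemmas ennreal_collect = ennreal_mult''[symmetric] ennreal_numeral[symmetric] ennreal_plus[symmetric]

lemma norm_add_sq_le:
  fixes x y :: "'b::real_normed_vector"
  shows "(norm (x + y))\<^sup>2 \<le> 2 * (norm x)\<^sup>2 + 2 * (norm y)\<^sup>2"
proof -
  have "(norm (x + y))\<^sup>2 \<le> (norm x + norm y)\<^sup>2"
    by (simp add: norm_triangle_ineq power_mono)
  also have "\<dots> \<le> 2 * (norm x)\<^sup>2 + 2 * (norm y)\<^sup>2"
    using sum_squares_bound[of "norm x" "norm y"] by (simp add: power2_sum)
  finally show ?thesis .
qed

lemma L2_dist_sq_commute: "L2_dist_sq M X Y = L2_dist_sq M Y X"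
  by (simp add: L2_dist_sq_def norm_minus_commute)

lemma L2_dist_sq_cong_AE:
  assumes "AE \<omega> in M. X \<omega> = X' \<omega>" "AE \<omega> in M. Y \<omega> = Y' \<omega>"
  shows "L2_dist_sq M X Y = L2_dist_sq M X' Y'"
  unfolding L2_dist_sq_def using assms by (intro nn_integral_cong_AE) auto

lemma L2_dist_sq_add:
  fixes X Y :: "'w \<Rightarrow> 'b::{real_normed_vector, second_countable_topology}"
  assumes [measurable]: "X \<in> borel_measurable M" "X' \<in> borel_measurable M"
    "Y \<in> borel_measurable M" "Y' \<in> borel_measurable M"
  shows "L2_dist_sq M (\<lambda>\<omega>. X \<omega> + X' \<omega>) (\<lambda>\<omega>. Y \<omega> + Y' \<omega>)
    \<le> 2 * L2_dist_sq M X Y + 2 * L2_dist_sq M X' Y'"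
proof -
  have "ennreal ((norm ((X \<omega> + X' \<omega>) - (Y \<omega> + Y' \<omega>)))\<^sup>2)
      \<le> 2 * ennreal ((norm (X \<omega> - Y \<omega>))\<^sup>2) + 2 * ennreal ((norm (X' \<omega> - Y' \<omega>))\<^sup>2)" for \<omega>
    using norm_add_sq_le[of "X \<omega> - Y \<omega>" "X' \<omega> - Y' \<omega>"]
    by (auto simp: ennreal_plus[symmetric] ennreal_mult''[symmetric] ennreal_numeral[symmetric] algebra_simps
      simp del: ennreal_plus ennreal_numeral)
  then have "L2_dist_sq M (\<lambda>\<omega>. X \<omega> + X' \<omega>) (\<lambda>\<omega>. Y \<omega> + Y' \<omega>)
    \<le> (\<integral>\<^sup>+\<omega>. 2 * ennreal ((norm (X \<omega> - Y \<omega>))\<^sup>2) + 2 * ennreal ((norm (X' \<omega> - Y' \<omega>))\<^sup>2) \<partial>M)"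
    unfolding L2_dist_sq_def by (intro nn_integral_mono)
  also have "\<dots> = 2 * L2_dist_sq M X Y + 2 * L2_dist_sq M X' Y'"
    unfolding L2_dist_sq_def by (simp add: nn_integral_add nn_integral_cmult)
  finally show ?thesis .
qed

lemma L2_dist_sq_shift: "L2_dist_sq M (\<lambda>\<omega>. X \<omega> - Y \<omega>) (\<lambda>_. 0) = L2_dist_sq M X Y"
  by (simp add: L2_dist_sq_def)

lemma L2_dist_sq_triangle:
  fixes X Y :: "'w \<Rightarrow> 'b::{real_normed_vector, second_countable_topology}"
  assumes [measurable]: "X \<in> borel_measurable M" "Y \<in> borel_measurable M" "Z \<in> borel_measurable M"
  shows "L2_dist_sq M X Z \<le> 2 * L2_dist_sq M X Y + 2 * L2_dist_sq M Y Z"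
proof -
  have "L2_dist_sq M X Z = L2_dist_sq M (\<lambda>\<omega>. (X \<omega> - Y \<omega>) + (Y \<omega> - Z \<omega>)) (\<lambda>\<omega>. 0 + 0)"
    by (simp add: L2_dist_sq_def)
  also have "\<dots> \<le> 2 * L2_dist_sq M (\<lambda>\<omega>. X \<omega> - Y \<omega>) (\<lambda>_. 0) + 2 * L2_dist_sq M (\<lambda>\<omega>. Y \<omega> - Z \<omega>) (\<lambda>_. 0)"
    by (rule L2_dist_sq_add) auto
  finally show ?thesis by (simp add: L2_dist_sq_shift)
qed

lemma L2_dist_sq_diff:
  fixes X Y :: "'w \<Rightarrow> 'b::{real_normed_vector, second_countable_topology}"
  assumes [measurable]: "X \<in> borel_measurable M" "X' \<in> borel_measurable M"
    "Y \<in> borel_measurable M" "Y' \<in> borel_measurable M"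
  shows "L2_dist_sq M (\<lambda>\<omega>. X \<omega> - X' \<omega>) (\<lambda>\<omega>. Y \<omega> - Y' \<omega>)
    \<le> 2 * L2_dist_sq M X Y + 2 * L2_dist_sq M X' Y'"
proof -
  have "L2_dist_sq M (\<lambda>\<omega>. - X' \<omega>) (\<lambda>\<omega>. - Y' \<omega>) = L2_dist_sq M X' Y'"
    unfolding L2_dist_sq_def by (metis (no_types, opaque_lifting) minus_diff_minus norm_minus_cancel)
  with L2_dist_sq_add[of X M "\<lambda>\<omega>. - X' \<omega>" Y "\<lambda>\<omega>. - Y' \<omega>"] assms show ?thesis by simp
qed

lemma L2_dist_sq_eq_0_iff:
  fixes X Y :: "'w \<Rightarrow> 'b::{real_normed_vector, second_countable_topology}"
  assumes [measurable]: "X \<in> borel_measurable M" "Y \<in> borel_measurable M"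
  shows "L2_dist_sq M X Y = 0 \<longleftrightarrow> (AE \<omega> in M. X \<omega> = Y \<omega>)"
  unfolding L2_dist_sq_def by (subst nn_integral_0_iff_AE) (auto simp: ennreal_eq_0_iff)

text \<open>The sum of the squared distances has finite expectation, so almost surely the series
  converges and its terms tend to 0; no subsequence has to be extracted.\<close>

lemma AE_tendsto_of_L2_summable:
  fixes X :: "nat \<Rightarrow> 'w \<Rightarrow> 'b::{real_normed_vector, second_countable_topology}"
  assumes [measurable]: "\<And>n. X n \<in> borel_measurable M" "Y \<in> borel_measurable M"
    and le: "\<And>n. L2_dist_sq M (X n) Y \<le> ennreal (c n)" and c: "\<And>n. 0 \<le> c n" "summable c"
  shows "AE \<omega> in M. (\<lambda>n. X n \<omega>) \<longlonglongrightarrow> Y \<omega>"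
proof -
  have "(\<integral>\<^sup>+\<omega>. (\<Sum>n. ennreal ((norm (X n \<omega> - Y \<omega>))\<^sup>2)) \<partial>M) = (\<Sum>n. L2_dist_sq M (X n) Y)"
    unfolding L2_dist_sq_def by (subst nn_integral_suminf) auto
  also have "\<dots> \<le> (\<Sum>n. ennreal (c n))" by (intro suminf_le le) auto
  also have "\<dots> = ennreal (\<Sum>n. c n)" using c by (intro suminf_ennreal2)
  also have "\<dots> < \<infinity>" by simp
  finally have "AE \<omega> in M. (\<Sum>n. ennreal ((norm (X n \<omega> - Y \<omega>))\<^sup>2)) \<noteq> \<infinity>"
    by (intro nn_integral_noteq_infinite) auto
  then show ?thesis
  proof eventually_elim
    case (elim \<omega>)
    have "(\<lambda>n. (norm (X n \<omega> - Y \<omega>))\<^sup>2) \<longlonglongrightarrow> 0"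
      using elim by (intro summable_LIMSEQ_zero summable_suminf_not_top) auto
    then have "(\<lambda>n. sqrt ((norm (X n \<omega> - Y \<omega>))\<^sup>2)) \<longlonglongrightarrow> sqrt 0" by (rule tendsto_real_sqrt)
    then have "(\<lambda>n. norm (X n \<omega> - Y \<omega>)) \<longlonglongrightarrow> 0" by simp
    then show ?case by (simp add: LIM_zero_iff tendsto_norm_zero_iff)
  qed
qed

text \<open>Splitting \<open>\<bar>x\<bar> \<le> r\<^sup>-\<^sup>1 x\<^sup>2 + r\<close> with \<open>r = \<surd>q\<^sup>n\<close> turns square summability at a geometric rate
  into absolute summability.\<close>

lemma AE_summable_norm_of_L2_geometric:
  fixes D :: "nat \<Rightarrow> 'w \<Rightarrow> 'b::{real_normed_vector, second_countable_topology}"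
  assumes [measurable]: "\<And>n. D n \<in> borel_measurable M"
    and q: "0 < q" "q < 1" and C: "0 \<le> C"
    and le: "\<And>n. (\<integral>\<^sup>+\<omega>. ennreal ((norm (D n \<omega>))\<^sup>2) \<partial>M) \<le> ennreal (C * q ^ n)"
  shows "AE \<omega> in M. summable (\<lambda>n. norm (D n \<omega>))"
proof -
  define r where "r = sqrt q"
  have r: "0 < r" "r < 1" "r * r = q" using q by (auto simp: r_def)
  have "(\<integral>\<^sup>+\<omega>. (\<Sum>n. ennreal ((norm (D n \<omega>))\<^sup>2 / r ^ n)) \<partial>M)
      = (\<Sum>n. \<integral>\<^sup>+\<omega>. ennreal ((norm (D n \<omega>))\<^sup>2 / r ^ n) \<partial>M)"
    by (subst nn_integral_suminf) auto
  also have "\<dots> \<le> (\<Sum>n. ennreal (C * r ^ n))"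
  proof (intro suminf_le allI)
    fix n
    have "(\<integral>\<^sup>+\<omega>. ennreal ((norm (D n \<omega>))\<^sup>2 / r ^ n) \<partial>M)
        = (\<integral>\<^sup>+\<omega>. ennreal (1 / r ^ n) * ennreal ((norm (D n \<omega>))\<^sup>2) \<partial>M)"
      using r by (intro nn_integral_cong) (simp add: ennreal_mult[symmetric])
    also have "\<dots> = ennreal (1 / r ^ n) * (\<integral>\<^sup>+\<omega>. ennreal ((norm (D n \<omega>))\<^sup>2) \<partial>M)"
      by (rule nn_integral_cmult) auto
    also have "\<dots> \<le> ennreal (1 / r ^ n) * ennreal (C * q ^ n)"
      by (intro mult_left_mono le) auto
    also have "\<dots> = ennreal (C * r ^ n)"
      using r C by (simp add: ennreal_mult[symmetric] r(3)[symmetric] power_mult_distrib)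
    finally show "(\<integral>\<^sup>+\<omega>. ennreal ((norm (D n \<omega>))\<^sup>2 / r ^ n) \<partial>M) \<le> ennreal (C * r ^ n)" .
  qed auto
  also have "\<dots> = ennreal (\<Sum>n. C * r ^ n)"
    using r C by (intro suminf_ennreal2) (auto intro!: summable_mult summable_geometric)
  also have "\<dots> < \<infinity>" by simp
  finally have "AE \<omega> in M. (\<Sum>n. ennreal ((norm (D n \<omega>))\<^sup>2 / r ^ n)) \<noteq> \<infinity>"
    by (intro nn_integral_noteq_infinite) auto
  then show ?thesis
  proof eventually_elim
    case (elim \<omega>)
    have s: "summable (\<lambda>n. (norm (D n \<omega>))\<^sup>2 / r ^ n)"
      using elim r by (intro summable_suminf_not_top) auto
    have "norm (D n \<omega>) \<le> (norm (D n \<omega>))\<^sup>2 / r ^ n + r ^ n" for n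
    proof -
      let ?x = "norm (D n \<omega>)"
      have "?x * r ^ n \<le> ?x\<^sup>2 + (r ^ n)\<^sup>2"
      proof -
        have "0 \<le> ?x * r ^ n" using r by simp
        then show ?thesis using sum_squares_bound[of ?x "r ^ n"] by linarith
      qed
      then have "?x \<le> (?x\<^sup>2 + (r ^ n)\<^sup>2) / r ^ n" using r by (simp add: pos_le_divide_eq)
      also have "\<dots> = ?x\<^sup>2 / r ^ n + r ^ n" using r by (simp add: add_divide_distrib power2_eq_square)
      finally show ?thesis .
    qed
    moreover have "summable (\<lambda>n. (norm (D n \<omega>))\<^sup>2 / r ^ n + r ^ n)"
      using s r by (intro summable_add summable_geometric) auto
    ultimately show ?case
      by (intro summable_comparison_test[of "\<lambda>n. norm (D n \<omega>)" "\<lambda>n. (norm (D n \<omega>))\<^sup>2 / r ^ n + r ^ n"]) auto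
  qed
qed

lemma convergent_of_summable_diff:
  fixes x :: "nat \<Rightarrow> 'b::banach"
  assumes "summable (\<lambda>n. norm (x (Suc n) - x n))"
  shows "x \<longlonglongrightarrow> lim x"
proof -
  have "summable (\<lambda>n. x (Suc n) - x n)" using assms by (rule summable_norm_cancel)
  then have "convergent (\<lambda>n. x n - x 0)"
    by (simp add: summable_iff_convergent sum_lessThan_telescope[of x])
  then have "convergent x" using convergent_diff_const_right_iff by blast
  then show ?thesis by (simp add: convergent_LIMSEQ_iff)
qed

text \<open>The limit is taken path by path, and \<open>lim\<close> is measurable also where nothing
  converges. Fatou's lemma passes the Cauchy bound on to the limit with the same constant.\<close>

lemma L2_fast_Cauchy_limit:
  fixes X :: "nat \<Rightarrow> 'w \<Rightarrow> 'b::{banach, second_countable_topology}"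
  assumes [measurable]: "\<And>n. X n \<in> borel_measurable M"
    and q: "0 < q" "q < 1" and C: "0 \<le> C"
    and le: "\<And>n m. n \<le> m \<Longrightarrow> L2_dist_sq M (X n) (X m) \<le> ennreal (C * q ^ n)"
  obtains Y where "Y \<in> borel_measurable M" "\<And>n. L2_dist_sq M (X n) Y \<le> ennreal (C * q ^ n)"
proof -
  define Y where "Y \<omega> = lim (\<lambda>n. X n \<omega>)" for \<omega>
  have [measurable]: "Y \<in> borel_measurable M" unfolding Y_def by measurable
  have "AE \<omega> in M. summable (\<lambda>n. norm (X (Suc n) \<omega> - X n \<omega>))"
    using q C le[of n "Suc n" for n]
    by (intro AE_summable_norm_of_L2_geometric[of _ _ q C]) (auto simp: L2_dist_sq_def norm_minus_commute)
  then have ae: "AE \<omega> in M. (\<lambda>n. X n \<omega>) \<longlonglongrightarrow> Y \<omega>"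
    by eventually_elim (simp add: Y_def convergent_of_summable_diff)
  have "L2_dist_sq M (X n) Y \<le> ennreal (C * q ^ n)" for n
  proof -
    have "L2_dist_sq M (X n) Y = (\<integral>\<^sup>+\<omega>. liminf (\<lambda>m. ennreal ((norm (X n \<omega> - X m \<omega>))\<^sup>2)) \<partial>M)"
      unfolding L2_dist_sq_def
    proof (rule nn_integral_cong_AE)
      show "AE \<omega> in M. ennreal ((norm (X n \<omega> - Y \<omega>))\<^sup>2) = liminf (\<lambda>m. ennreal ((norm (X n \<omega> - X m \<omega>))\<^sup>2))"
        using ae
      proof eventually_elim
        case (elim \<omega>)
        have "(\<lambda>m. ennreal ((norm (X n \<omega> - X m \<omega>))\<^sup>2)) \<longlonglongrightarrow> ennreal ((norm (X n \<omega> - Y \<omega>))\<^sup>2)"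
          by (intro tendsto_intros tendsto_ennrealI elim)
        then show ?case by (rule lim_imp_Liminf[OF trivial_limit_sequentially, symmetric])
      qed
    qed
    also have "\<dots> \<le> liminf (\<lambda>m. \<integral>\<^sup>+\<omega>. ennreal ((norm (X n \<omega> - X m \<omega>))\<^sup>2) \<partial>M)"
      by (rule nn_integral_liminf) auto
    also have "\<dots> \<le> ennreal (C * q ^ n)"
    proof -
      have "\<forall>\<^sub>F m in sequentially. (\<integral>\<^sup>+\<omega>. ennreal ((norm (X n \<omega> - X m \<omega>))\<^sup>2) \<partial>M) \<le> ennreal (C * q ^ n)"
        using le[of n] eventually_ge_at_top[of n] unfolding L2_dist_sq_def by (rule eventually_mono[rotated])
      then show ?thesis by (simp add: Liminf_le)
    qed
    finally show ?thesis .
  qed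
  then show ?thesis using that[of Y] by simp
qed

section \<open>Riemann sums of fractional Brownian motion\<close>

lemma convex_on_abs_powr:
  assumes "1 \<le> p"
  shows "convex_on UNIV (\<lambda>x::real. \<bar>x\<bar> powr p)"
proof (rule convex_onI)
  fix t x y :: real
  assume t: "0 < t" "t < 1"
  \<comment> \<open>Covers arguments equal to 0, where the claim reduces to
    \<open>r powr p \<le> r\<close> for \<open>0 < r < 1\<close>; elsewhere convexity on positive
    arguments applies.\<close>
  have scale: "(r * \<bar>z\<bar>) powr p \<le> r * \<bar>z\<bar> powr p" if "0 < r" "r < 1" for r z :: real
    using that assms powr_mono'[of 1 p r] by (simp add: powr_mult mult_right_mono)
  have "\<bar>(1 - t) *\<^sub>R x + t *\<^sub>R y\<bar> \<le> (1 - t) * \<bar>x\<bar> + t * \<bar>y\<bar>"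
    using t abs_triangle_ineq[of "(1 - t) * x" "t * y"] by (simp add: abs_mult)
  then have "\<bar>(1 - t) *\<^sub>R x + t *\<^sub>R y\<bar> powr p \<le> ((1 - t) * \<bar>x\<bar> + t * \<bar>y\<bar>) powr p"
    using assms by (intro powr_mono2) auto
  also have "\<dots> \<le> (1 - t) * \<bar>x\<bar> powr p + t * \<bar>y\<bar> powr p"
  proof (cases "x = 0 \<or> y = 0")
    case True
    then show ?thesis using scale[of t y] scale[of "1 - t" x] t by auto
  next
    case False
    then show ?thesis using convex_onD[OF powr_convex[OF assms], of t "\<bar>x\<bar>" "\<bar>y\<bar>"] t by simp
  qed
  finally show "\<bar>(1 - t) *\<^sub>R x + t *\<^sub>R y\<bar> powr p \<le> (1 - t) * \<bar>x\<bar> powr p + t * \<bar>y\<bar> powr p" .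
qed simp

text \<open>Both \<open>x + d\<close> and \<open>y\<close> lie between \<open>x\<close> and
  \<open>y + d\<close>, with complementary weights \<open>l\<close> and \<open>1 - l\<close>; the
  two convexity inequalities are added.\<close>

lemma convex_on_increment_mono:
  fixes f :: "real \<Rightarrow> real"
  assumes f: "convex_on UNIV f" and "x \<le> y" "0 \<le> d"
  shows "f (x + d) - f x \<le> f (y + d) - f y"
proof (cases "y - x + d = 0")
  case True
  then have "y = x" "d = 0" using assms by linarith+
  then show ?thesis by simp
next
  case False
  define l where "l = d / (y - x + d)"
  have pos: "y - x + d > 0" using False assms by linarith
  have l: "0 \<le> l" "l \<le> 1" using assms pos by (auto simp: l_def field_simps)
  have ld: "l * (y - x + d) = d" using pos by (simp add: l_def)
  have "(1 - l) *\<^sub>R x + l *\<^sub>R (y + d) = x + d" using ld by (simp add: algebra_simps)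
  moreover have "(1 - (1 - l)) *\<^sub>R x + (1 - l) *\<^sub>R (y + d) = y" using ld by (simp add: algebra_simps)
  ultimately show ?thesis
    using convex_onD[OF f l, of x "y + d"] convex_onD[OF f, of "1 - l" x "y + d"] l
    by (simp add: algebra_simps)
qed

lemma sum_lessThan_add:
  fixes f :: "nat \<Rightarrow> 'a::comm_monoid_add"
  shows "sum f {..<n + m} = sum f {..<n} + (\<Sum>k<m. f (n + k))"
  by (induction m) (auto simp: add.assoc)

text \<open>The condition on \<open>p\<close> and \<open>n\<close> in
  \<open>has_wiener_integral_scalar\<close>. The case \<open>n = 0\<close> occurs exactly when
  \<open>s = t\<close>, so degenerate intervals are included.\<close>

definition subdivision :: "real \<Rightarrow> (nat \<Rightarrow> real) \<Rightarrow> nat \<Rightarrow> real \<Rightarrow> real \<Rightarrow> bool" where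
  "subdivision \<delta> p n s t \<longleftrightarrow> p 0 = s \<and> p n = t \<and> (\<forall>k<n. p k < p (Suc k) \<and> p (Suc k) - p k < \<delta>)"

lemma subdivision_mono: "subdivision \<delta> p n s t \<Longrightarrow> j \<le> k \<Longrightarrow> k \<le> n \<Longrightarrow> p j \<le> p k"
proof (induction k)
  case (Suc k)
  show ?case
  proof (cases "j = Suc k")
    case False
    then have "p j \<le> p k" using Suc by simp
    also have "p k < p (Suc k)" using Suc.prems by (simp add: subdivision_def)
    finally show ?thesis by simp
  qed simp
qed simp

lemma subdivision_bounds: "subdivision \<delta> p n s t \<Longrightarrow> k \<le> n \<Longrightarrow> s \<le> p k \<and> p k \<le> t"
  using subdivision_mono[of \<delta> p n s t 0 k] subdivision_mono[of \<delta> p n s t k n] by (auto simp: subdivision_def)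

lemma subdivision_mesh_mono: "subdivision \<delta> p n s t \<Longrightarrow> \<delta> \<le> \<delta>' \<Longrightarrow> subdivision \<delta>' p n s t"
  by (force simp: subdivision_def)

lemma subdivision_uniform:
  assumes "s < t" "0 < n" "(t - s) / n < \<delta>"
  shows "subdivision \<delta> (\<lambda>k. s + real k * ((t - s) / n)) n s t"
proof -
  define d where "d = (t - s) / n"
  have "0 < d" "d < \<delta>" "real n * d = t - s" using assms by (auto simp: d_def)
  then show ?thesis unfolding subdivision_def d_def[symmetric] by (simp add: distrib_right)
qed

lemma subdivision_exists:
  assumes "s \<le> t" "0 < \<delta>"
  obtains p n where "subdivision \<delta> p n s t"
proof (cases "s = t")
  case True
  then show ?thesis using that[of "\<lambda>_. s" 0] by (simp add: subdivision_def)
next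
  case False
  obtain n :: nat where n: "(t - s) / \<delta> < n" using reals_Archimedean2 by blast
  moreover have "0 < (t - s) / \<delta>" using False assms by simp
  ultimately have "0 < n" by (metis of_nat_0_less_iff order_less_trans)
  with n assms False show ?thesis
    by (intro that[OF subdivision_uniform[of s t n \<delta>]]) (auto simp: field_simps)
qed

lemma subdivision_append:
  assumes "subdivision \<delta> p n s u" "subdivision \<delta> q m u t"
  shows "subdivision \<delta> (\<lambda>k. if k < n then p k else q (k - n)) (n + m) s t"
  unfolding subdivision_def
proof (intro conjI allI impI)
  fix k assume k: "k < n + m"
  consider "Suc k < n" | "Suc k = n" | "n \<le> k" by linarith
  then have "\<exists>x y. (if k < n then p k else q (k - n)) = x \<and> (if Suc k < n then p (Suc k) else q (Suc k - n)) = y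
     \<and> x < y \<and> y - x < \<delta>"
  proof cases
    case 2
    then have "p (Suc k) = q 0" using assms by (simp add: subdivision_def)
    with 2 assms(1) show ?thesis unfolding subdivision_def by (metis diff_self_eq_0 lessI less_irrefl)
  qed (use assms k in \<open>auto simp: subdivision_def Suc_diff_le\<close>)
  then show "(if k < n then p k else q (k - n)) < (if Suc k < n then p (Suc k) else q (Suc k - n))"
    "(if Suc k < n then p (Suc k) else q (Suc k - n)) - (if k < n then p k else q (k - n)) < \<delta>" by auto
qed (use assms in \<open>auto simp: subdivision_def\<close>)

text \<open>Only the covariances of the process enter the \<open>L\<^sup>2\<close> theory of the Wiener integral.\<close>

locale fbm_cov = prob_space M for M :: "'w measure" +
  fixes H :: real and \<beta> :: "real \<Rightarrow> 'w \<Rightarrow> real"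
  assumes H: "1/2 < H" "H < 1"
    and measurable_beta[measurable]: "\<And>t. \<beta> t \<in> borel_measurable M"
    and square_integrable: "\<And>t. integrable M (\<lambda>\<omega>. (\<beta> t \<omega>)\<^sup>2)"
    and cov: "\<And>s t. (LINT \<omega>|M. \<beta> s \<omega> * \<beta> t \<omega>) =
        (\<bar>s\<bar> powr (2 * H) + \<bar>t\<bar> powr (2 * H) - \<bar>t - s\<bar> powr (2 * H)) / 2"
begin

lemma integrable_mult_beta: "integrable M (\<lambda>\<omega>. \<beta> s \<omega> * \<beta> t \<omega>)"
proof (rule Bochner_Integration.integrable_bound)
  show "integrable M (\<lambda>\<omega>. (\<beta> s \<omega>)\<^sup>2 + (\<beta> t \<omega>)\<^sup>2)" using square_integrable by simp
  show "AE \<omega> in M. norm (\<beta> s \<omega> * \<beta> t \<omega>) \<le> norm ((\<beta> s \<omega>)\<^sup>2 + (\<beta> t \<omega>)\<^sup>2)"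
  proof (intro AE_I2)
    fix \<omega>
    have "2 * (\<bar>\<beta> s \<omega>\<bar> * \<bar>\<beta> t \<omega>\<bar>) \<le> (\<beta> s \<omega>)\<^sup>2 + (\<beta> t \<omega>)\<^sup>2"
      using sum_squares_bound[of "\<bar>\<beta> s \<omega>\<bar>" "\<bar>\<beta> t \<omega>\<bar>"] by simp
    moreover have "0 \<le> \<bar>\<beta> s \<omega>\<bar> * \<bar>\<beta> t \<omega>\<bar>" by simp
    ultimately have "\<bar>\<beta> s \<omega>\<bar> * \<bar>\<beta> t \<omega>\<bar> \<le> (\<beta> s \<omega>)\<^sup>2 + (\<beta> t \<omega>)\<^sup>2" by linarith
    then show "norm (\<beta> s \<omega> * \<beta> t \<omega>) \<le> norm ((\<beta> s \<omega>)\<^sup>2 + (\<beta> t \<omega>)\<^sup>2)" by (simp add: abs_mult)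
  qed
qed auto

definition incr :: "real \<Rightarrow> real \<Rightarrow> 'w \<Rightarrow> real" where
  "incr a b \<omega> = \<beta> b \<omega> - \<beta> a \<omega>"

lemma measurable_incr[measurable]: "incr a b \<in> borel_measurable M"
  unfolding incr_def[abs_def] by measurable

lemma incr_expand: "incr a b \<omega> * incr c d \<omega> =
    \<beta> b \<omega> * \<beta> d \<omega> - \<beta> b \<omega> * \<beta> c \<omega> - \<beta> a \<omega> * \<beta> d \<omega> + \<beta> a \<omega> * \<beta> c \<omega>"
  by (simp add: incr_def algebra_simps)

lemma integrable_incr: "integrable M (\<lambda>\<omega>. incr a b \<omega> * incr c d \<omega>)"
  unfolding incr_expand using integrable_mult_beta by simp

lemma incr_cov: "(LINT \<omega>|M. incr a b \<omega> * incr c d \<omega>) =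
    (\<bar>d - a\<bar> powr (2 * H) + \<bar>c - b\<bar> powr (2 * H) - \<bar>d - b\<bar> powr (2 * H) - \<bar>c - a\<bar> powr (2 * H)) / 2"
  unfolding incr_expand using integrable_mult_beta by (simp add: cov diff_divide_distrib add_divide_distrib)

lemma incr_variance: "s \<le> t \<Longrightarrow> (LINT \<omega>|M. (incr s t \<omega>)\<^sup>2) = (t - s) powr (2 * H)"
  by (simp add: power2_eq_square incr_cov)

text \<open>The covariance is half a mixed second difference of \<open>|x| powr (2 * H)\<close>,
  which is nonnegative by convexity because \<open>2 * H > 1\<close>.\<close>

lemma incr_cov_nonneg:
  assumes "a \<le> b" "c \<le> d"
  shows "0 \<le> (LINT \<omega>|M. incr a b \<omega> * incr c d \<omega>)"
  using convex_on_increment_mono[OF convex_on_abs_powr[of "2 * H"], of "c - b" "d - b" "b - a"] H assms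
  by (simp add: incr_cov)

text \<open>In the expanded square every covariance is nonnegative, so each product
  \<open>c i * c j\<close> may be replaced by \<open>C\<^sup>2\<close>. The bound on
  \<open>c i\<close> is asked only where \<open>a i < b i\<close>: on the common refinement of two
  subdivisions many intervals are degenerate and carry uncontrolled coefficients.\<close>

lemma sum_incr_second_moment_le:
  fixes c :: "'i \<Rightarrow> real"
  assumes K: "finite K" and ab: "\<And>i. i \<in> K \<Longrightarrow> a i \<le> b i"
    and c: "\<And>i. i \<in> K \<Longrightarrow> a i < b i \<Longrightarrow> \<bar>c i\<bar> \<le> C"
  shows "(LINT \<omega>|M. (\<Sum>i\<in>K. c i * incr (a i) (b i) \<omega>)\<^sup>2)
      \<le> C\<^sup>2 * (LINT \<omega>|M. (\<Sum>i\<in>K. incr (a i) (b i) \<omega>)\<^sup>2)"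
    and "integrable M (\<lambda>\<omega>. (\<Sum>i\<in>K. c i * incr (a i) (b i) \<omega>)\<^sup>2)"
proof -
  have sq: "(\<Sum>i\<in>K. e i * incr (a i) (b i) \<omega>)\<^sup>2
      = (\<Sum>i\<in>K. \<Sum>j\<in>K. (e i * e j) * (incr (a i) (b i) \<omega> * incr (a j) (b j) \<omega>))" for e \<omega>
    by (simp add: power2_eq_square sum_product algebra_simps)
  have L: "(LINT \<omega>|M. (\<Sum>i\<in>K. e i * incr (a i) (b i) \<omega>)\<^sup>2)
      = (\<Sum>i\<in>K. \<Sum>j\<in>K. (e i * e j) * (LINT \<omega>|M. incr (a i) (b i) \<omega> * incr (a j) (b j) \<omega>))" for e
    unfolding sq using integrable_incr by (subst Bochner_Integration.integral_sum | simp)+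
  show "integrable M (\<lambda>\<omega>. (\<Sum>i\<in>K. c i * incr (a i) (b i) \<omega>)\<^sup>2)"
    unfolding sq using integrable_incr by simp
  have "(LINT \<omega>|M. (\<Sum>i\<in>K. c i * incr (a i) (b i) \<omega>)\<^sup>2)
      \<le> (\<Sum>i\<in>K. \<Sum>j\<in>K. C\<^sup>2 * (LINT \<omega>|M. incr (a i) (b i) \<omega> * incr (a j) (b j) \<omega>))"
    unfolding L
  proof (intro sum_mono)
    fix i j assume ij: "i \<in> K" "j \<in> K"
    show "c i * c j * (LINT \<omega>|M. incr (a i) (b i) \<omega> * incr (a j) (b j) \<omega>)
      \<le> C\<^sup>2 * (LINT \<omega>|M. incr (a i) (b i) \<omega> * incr (a j) (b j) \<omega>)"
    proof (cases "a i < b i \<and> a j < b j")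
      case True
      then have "\<bar>c i\<bar> * \<bar>c j\<bar> \<le> C * C" using c ij by (intro mult_mono') auto
      then have "c i * c j \<le> C\<^sup>2" unfolding power2_eq_square by (metis abs_le_D1 abs_mult)
      then show ?thesis using ab ij by (intro mult_right_mono incr_cov_nonneg) auto
    next
      case False
      then have "a i = b i \<or> a j = b j" using ab ij by force
      then show ?thesis by (auto simp: incr_def)
    qed
  qed
  also have "\<dots> = C\<^sup>2 * (LINT \<omega>|M. (\<Sum>i\<in>K. incr (a i) (b i) \<omega>)\<^sup>2)"
    using L[of "\<lambda>_. 1"] by (simp add: sum_distrib_left)
  finally show "(LINT \<omega>|M. (\<Sum>i\<in>K. c i * incr (a i) (b i) \<omega>)\<^sup>2)
      \<le> C\<^sup>2 * (LINT \<omega>|M. (\<Sum>i\<in>K. incr (a i) (b i) \<omega>)\<^sup>2)" .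
qed

definition riemann :: "(nat \<Rightarrow> real) \<Rightarrow> nat \<Rightarrow> (real \<Rightarrow> real) \<Rightarrow> 'w \<Rightarrow> real" where
  "riemann p n h \<omega> = (\<Sum>k<n. h (p k) * (\<beta> (p (Suc k)) \<omega> - \<beta> (p k) \<omega>))"

lemma measurable_riemann[measurable]: "riemann p n h \<in> borel_measurable M"
  unfolding riemann_def[abs_def] by measurable

text \<open>The two Riemann sums are compared on the common refinement, whose intervals are obtained by
  clamping the points of one subdivision to the intervals of the other.\<close>

lemma riemann_close:
  assumes p: "subdivision \<delta> p n s t" and q: "subdivision \<delta> q m s t" and st: "s \<le> t"
    and close: "\<And>u v. u \<in> {s..t} \<Longrightarrow> v \<in> {s..t} \<Longrightarrow> \<bar>u - v\<bar> < \<delta> \<Longrightarrow> \<bar>h u - g v\<bar> \<le> \<epsilon>"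
  shows "L2_dist_sq M (riemann p n h) (riemann q m g) \<le> ennreal (\<epsilon>\<^sup>2 * (t - s) powr (2 * H))"
proof -
  define a where "a = (\<lambda>(k, l). max (p k) (min (p (Suc k)) (q l)))"
  define b where "b = (\<lambda>(k, l). max (p k) (min (p (Suc k)) (q (Suc l))))"
  define K where "K = {..<n} \<times> {..<m}"
  have pS: "p k < p (Suc k)" "p (Suc k) - p k < \<delta>" if "k < n" for k using p that by (auto simp: subdivision_def)
  have qS: "q l < q (Suc l)" "q (Suc l) - q l < \<delta>" if "l < m" for l using q that by (auto simp: subdivision_def)
  have pb: "s \<le> p k" "p k \<le> t" if "k \<le> n" for k using subdivision_bounds[OF p that] by auto
  have qb: "s \<le> q l" "q l \<le> t" if "l \<le> m" for l using subdivision_bounds[OF q that] by auto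
  \<comment> \<open>Clamping to the two cells in either order gives the same increment, which is 0
    if they do not overlap. Summation over \<open>l\<close> thus telescopes to the cell of
    \<open>p\<close>, summation over \<open>k\<close> to the cell of \<open>q\<close>.\<close>
  have clamp: "f (max x (min x' y')) - f (max x (min x' y)) = f (max y (min y' x')) - f (max y (min y' x))"
    if "x \<le> x'" "y \<le> y'" for f :: "real \<Rightarrow> real" and x x' y y'
    using that by (auto simp: max_def min_def)
  have rowp: "(\<Sum>l<m. incr (a (k, l)) (b (k, l)) \<omega>) = \<beta> (p (Suc k)) \<omega> - \<beta> (p k) \<omega>" if "k < n" for k \<omega>
  proof -
    have "(\<Sum>l<m. incr (a (k, l)) (b (k, l)) \<omega>)
      = \<beta> (max (p k) (min (p (Suc k)) (q m))) \<omega> - \<beta> (max (p k) (min (p (Suc k)) (q 0))) \<omega>"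
      unfolding incr_def a_def b_def prod.case by (rule sum_lessThan_telescope)
    moreover have "q m = t" "q 0 = s" using q by (auto simp: subdivision_def)
    ultimately show ?thesis using pb[of k] pb[of "Suc k"] pS[of k] that by (simp add: max_def min_def)
  qed
  have rowq: "(\<Sum>k<n. incr (a (k, l)) (b (k, l)) \<omega>) = \<beta> (q (Suc l)) \<omega> - \<beta> (q l) \<omega>" if "l < m" for l \<omega>
  proof -
    have "(\<Sum>k<n. incr (a (k, l)) (b (k, l)) \<omega>)
      = (\<Sum>k<n. \<beta> (max (q l) (min (q (Suc l)) (p (Suc k)))) \<omega> - \<beta> (max (q l) (min (q (Suc l)) (p k))) \<omega>)"
      unfolding incr_def a_def b_def prod.case
      using pS qS that by (intro sum.cong refl clamp[of _ _ _ _ "\<lambda>z. \<beta> z \<omega>"]) (auto intro: less_imp_le)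
    also have "\<dots> = \<beta> (max (q l) (min (q (Suc l)) (p n))) \<omega> - \<beta> (max (q l) (min (q (Suc l)) (p 0))) \<omega>"
      by (rule sum_lessThan_telescope)
    also have "p n = t" using p by (auto simp: subdivision_def)
    also have "p 0 = s" using p by (auto simp: subdivision_def)
    finally show ?thesis using qb[of l] qb[of "Suc l"] qS[of l] that by (simp add: max_def min_def)
  qed
  have Rp: "riemann p n h \<omega> = (\<Sum>(k, l)\<in>K. h (p k) * incr (a (k, l)) (b (k, l)) \<omega>)" for \<omega>
    unfolding K_def riemann_def
    by (subst sum.cartesian_product[symmetric]) (simp add: sum_distrib_left[symmetric] rowp)
  have Rq: "riemann q m g \<omega> = (\<Sum>(k, l)\<in>K. g (q l) * incr (a (k, l)) (b (k, l)) \<omega>)" for \<omega>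
    unfolding K_def riemann_def
    by (subst sum.cartesian_product[symmetric], subst sum.swap) (simp add: sum_distrib_left[symmetric] rowq)
  have diff: "riemann p n h \<omega> - riemann q m g \<omega>
      = (\<Sum>i\<in>K. (h (p (fst i)) - g (q (snd i))) * incr (a i) (b i) \<omega>)" for \<omega>
    unfolding Rp Rq by (simp add: sum_subtractf[symmetric] algebra_simps case_prod_beta)
  have tot: "(\<Sum>i\<in>K. incr (a i) (b i) \<omega>) = incr s t \<omega>" for \<omega>
  proof -
    have "(\<Sum>i\<in>K. incr (a i) (b i) \<omega>) = (\<Sum>k<n. \<Sum>l<m. incr (a (k, l)) (b (k, l)) \<omega>)"
      unfolding K_def by (subst sum.cartesian_product) (simp add: case_prod_beta)
    also have "\<dots> = (\<Sum>k<n. \<beta> (p (Suc k)) \<omega> - \<beta> (p k) \<omega>)" by (simp add: rowp)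
    also have "\<dots> = \<beta> (p n) \<omega> - \<beta> (p 0) \<omega>" by (rule sum_lessThan_telescope)
    also have "\<dots> = incr s t \<omega>" using p by (simp add: subdivision_def incr_def)
    finally show ?thesis .
  qed
  have K: "finite K" "\<And>i. i \<in> K \<Longrightarrow> a i \<le> b i"
    using qS by (fastforce simp: K_def a_def b_def intro: max.mono min.mono less_imp_le)+
  have c: "\<bar>h (p (fst i)) - g (q (snd i))\<bar> \<le> \<epsilon>" if "i \<in> K" "a i < b i" for i
  proof -
    obtain k l where i: "i = (k, l)" by force
    have kl: "k < n" "l < m" using that i by (auto simp: K_def)
    \<comment> \<open>A nondegenerate piece means that the two cells overlap, and then their left
      ends differ by less than the mesh.\<close>
    have "q l < p (Suc k)" "p k < q (Suc l)" using that(2) pS[OF kl(1)] qS[OF kl(2)]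
      by (auto simp: i a_def b_def max_def min_def split: if_splits)
    then have "\<bar>p k - q l\<bar> < \<delta>" using pS[OF kl(1)] qS[OF kl(2)] by linarith
    then show ?thesis using close[of "p k" "q l"] pb[of k] qb[of l] kl by (simp add: i)
  qed
  note * = sum_incr_second_moment_le[of K a b "\<lambda>i. h (p (fst i)) - g (q (snd i))" \<epsilon>, OF K c, folded diff, simplified tot]
  have "L2_dist_sq M (riemann p n h) (riemann q m g)
      = ennreal (LINT \<omega>|M. (riemann p n h \<omega> - riemann q m g \<omega>)\<^sup>2)"
    unfolding L2_dist_sq_def using *(2) by (subst nn_integral_eq_integral[symmetric]) auto
  then show ?thesis using *(1) incr_variance[OF st] by (simp add: ennreal_leI)
qed

end

section \<open>Wiener integrals over bounded intervals\<close>

text \<open>Removes an error term that decays as a truncation point tends to minus infinity.\<close>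

lemma ennreal_le_of_exp_decay:
  assumes "\<And>n::nat. x \<le> ennreal (D * exp (- m * real n) + B)" "0 < m" "0 \<le> D"
  shows "x \<le> ennreal B"
proof (rule LIMSEQ_le_const)
  have "(\<lambda>n. exp (- m) ^ n) \<longlonglongrightarrow> 0" using assms by (intro LIMSEQ_power_zero) auto
  then have "(\<lambda>n::nat. exp (- m * real n)) \<longlonglongrightarrow> 0" by (simp add: exp_of_nat_mult[symmetric] mult.commute)
  then have "(\<lambda>n::nat. D * exp (- m * real n) + B) \<longlonglongrightarrow> D * 0 + B" by (intro tendsto_intros)
  then show "(\<lambda>n. ennreal (D * exp (- m * real n) + B)) \<longlonglongrightarrow> ennreal B" by (intro tendsto_ennrealI) simp
qed (use assms in auto)

text \<open>Equivalent to \<open>0 \<le> (r * x - y)\<^sup>2 / r\<close>. The free \<open>r\<close>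
  lets one summand keep a small factor at the expense of the other, which recursive estimates
  need.\<close>

lemma power2_add_weighted:
  fixes x y r :: real
  assumes "0 < r"
  shows "(x + y)\<^sup>2 \<le> (1 + r) * x\<^sup>2 + (1 + 1 / r) * y\<^sup>2"
proof -
  have "0 \<le> (r * x - y)\<^sup>2 / r" using assms by simp
  also have "\<dots> = r * x\<^sup>2 + y\<^sup>2 / r - 2 * x * y"
    using assms by (simp add: power2_eq_square field_simps)
  finally show ?thesis by (simp add: power2_sum algebra_simps)
qed

lemma L2_dist_sq_add_weighted:
  fixes X Y :: "'w \<Rightarrow> real"
  assumes [measurable]: "X \<in> borel_measurable M" "Y \<in> borel_measurable M" and r: "0 < r"
  shows "L2_dist_sq M (\<lambda>\<omega>. X \<omega> + Y \<omega>) (\<lambda>_. 0)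
    \<le> ennreal (1 + r) * L2_dist_sq M X (\<lambda>_. 0) + ennreal (1 + 1 / r) * L2_dist_sq M Y (\<lambda>_. 0)"
proof -
  have "ennreal ((X \<omega> + Y \<omega>)\<^sup>2) \<le> ennreal (1 + r) * ennreal ((X \<omega>)\<^sup>2) + ennreal (1 + 1 / r) * ennreal ((Y \<omega>)\<^sup>2)" for \<omega>
  proof -
    note power2_add_weighted[OF r, of "X \<omega>" "Y \<omega>"]
    then show ?thesis using r by (simp add: ennreal_mult[symmetric] ennreal_plus[symmetric] ennreal_leI del: ennreal_plus)
  qed
  then have "L2_dist_sq M (\<lambda>\<omega>. X \<omega> + Y \<omega>) (\<lambda>_. 0)
    \<le> (\<integral>\<^sup>+\<omega>. ennreal (1 + r) * ennreal ((X \<omega>)\<^sup>2) + ennreal (1 + 1 / r) * ennreal ((Y \<omega>)\<^sup>2) \<partial>M)"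
    unfolding L2_dist_sq_def by (intro nn_integral_mono) simp
  also have "\<dots> = ennreal (1 + r) * L2_dist_sq M X (\<lambda>_. 0) + ennreal (1 + 1 / r) * L2_dist_sq M Y (\<lambda>_. 0)"
    unfolding L2_dist_sq_def by (simp add: nn_integral_add nn_integral_cmult)
  finally show ?thesis .
qed

context fbm_cov
begin

abbreviation "wiener \<equiv> has_wiener_integral_scalar M \<beta>"

lemma wiener_integralD:
  assumes "wiener h s t I"
  shows "s \<le> t" "continuous_on {s..t} h" "I \<in> borel_measurable M"
    "\<And>e. 0 < e \<Longrightarrow> \<exists>\<delta>>0. \<forall>n p. subdivision \<delta> p n s t \<longrightarrow> L2_dist_sq M (riemann p n h) I < e"
  using assms unfolding has_wiener_integral_scalar_def subdivision_def riemann_def by blast+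

lemma wiener_integralI:
  assumes "s \<le> t" "continuous_on {s..t} h" "I \<in> borel_measurable M"
    "\<And>e. 0 < e \<Longrightarrow> \<exists>\<delta>>0. \<forall>n p. subdivision \<delta> p n s t \<longrightarrow> L2_dist_sq M (riemann p n h) I < e"
  shows "wiener h s t I"
  using assms unfolding has_wiener_integral_scalar_def subdivision_def riemann_def by blast

lemma wiener_integral_approx:
  assumes I: "wiener h s t I" and "0 < \<delta>" "0 < (e::ennreal)"
  obtains p n where "subdivision \<delta> p n s t" "L2_dist_sq M (riemann p n h) I < e"
proof -
  obtain \<delta>' where d: "0 < \<delta>'" "\<And>n p. subdivision \<delta>' p n s t \<Longrightarrow> L2_dist_sq M (riemann p n h) I < e"
    using wiener_integralD(4)[OF I \<open>0 < e\<close>] by blast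
  obtain p n where pn: "subdivision (min \<delta> \<delta>') p n s t"
    using subdivision_exists[OF wiener_integralD(1)[OF I], of "min \<delta> \<delta>'"] d assms(2) by auto
  then have "subdivision \<delta> p n s t" "subdivision \<delta>' p n s t" by (auto elim: subdivision_mesh_mono)
  with d show ?thesis using that by blast
qed

text \<open>The integral is replaced by a Riemann sum of \<open>h\<close> that is arbitrarily close
  to it and has mesh below \<open>\<delta>\<close>. Two integrands are allowed so that
  \<open>g = h\<close> yields the approximation error and \<open>g = 0\<close> the norm bound for
  the integral; the factor 2 is that of the squared triangle inequality.\<close>

lemma riemann_wiener_integral_le:
  assumes I: "wiener h s t I" and p: "subdivision \<delta> p n s t" and "0 < \<delta>"
    and osc: "\<And>u v. u \<in> {s..t} \<Longrightarrow> v \<in> {s..t} \<Longrightarrow> \<bar>u - v\<bar> < \<delta> \<Longrightarrow> \<bar>g u - h v\<bar> \<le> \<epsilon>"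
  shows "L2_dist_sq M (riemann p n g) I \<le> ennreal (2 * \<epsilon>\<^sup>2 * (t - s) powr (2 * H))"
proof (rule ennreal_le_epsilon)
  fix e :: real assume e: "0 < e"
  note [measurable] = wiener_integralD(3)[OF I]
  obtain q m where q: "subdivision \<delta> q m s t" "L2_dist_sq M (riemann q m h) I < ennreal (e / 2)"
    using wiener_integral_approx[OF I \<open>0 < \<delta>\<close>, of "ennreal (e / 2)"] e by auto
  have "L2_dist_sq M (riemann p n g) I \<le> 2 * L2_dist_sq M (riemann p n g) (riemann q m h) + 2 * L2_dist_sq M (riemann q m h) I"
    by (rule L2_dist_sq_triangle) auto
  also have "\<dots> \<le> 2 * ennreal (\<epsilon>\<^sup>2 * (t - s) powr (2 * H)) + 2 * ennreal (e / 2)"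
    using q riemann_close[OF p q(1) wiener_integralD(1)[OF I] osc]
    by (intro add_mono mult_left_mono) auto
  also have "\<dots> = ennreal (2 * \<epsilon>\<^sup>2 * (t - s) powr (2 * H)) + ennreal e"
    using e by (simp add: ennreal_mult''[symmetric] ennreal_numeral[symmetric] ac_simps del: ennreal_numeral)
  finally show "L2_dist_sq M (riemann p n g) I \<le> ennreal (2 * \<epsilon>\<^sup>2 * (t - s) powr (2 * H)) + ennreal e" .
qed

lemma wiener_integral_bound:
  assumes I: "wiener h s t I" and b: "\<And>u. u \<in> {s..t} \<Longrightarrow> \<bar>h u\<bar> \<le> C"
  shows "L2_dist_sq M I (\<lambda>_. 0) \<le> ennreal (2 * C\<^sup>2 * (t - s) powr (2 * H))"
proof -
  obtain p n where p: "subdivision 1 p n s t"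
    using subdivision_exists[OF wiener_integralD(1)[OF I], of 1] by auto
  have "L2_dist_sq M (riemann p n (\<lambda>_. 0)) I \<le> ennreal (2 * C\<^sup>2 * (t - s) powr (2 * H))"
    by (rule riemann_wiener_integral_le[OF I p]) (use b in auto)
  moreover have "riemann p n (\<lambda>_. 0) = (\<lambda>_. 0)" by (simp add: riemann_def fun_eq_iff)
  ultimately show ?thesis by (simp add: L2_dist_sq_commute)
qed

lemma wiener_integral_unique:
  assumes I: "wiener h s t I" and J: "wiener h s t J"
  shows "AE \<omega> in M. I \<omega> = J \<omega>"
proof -
  note [measurable] = wiener_integralD(3)[OF I] wiener_integralD(3)[OF J]
  have "L2_dist_sq M I J \<le> 0"
  proof (rule ennreal_le_epsilon)
    fix e :: real assume e: "0 < e"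
    obtain \<delta> where d: "0 < \<delta>" "\<And>n p. subdivision \<delta> p n s t \<Longrightarrow> L2_dist_sq M (riemann p n h) I < ennreal (e / 4)"
      using wiener_integralD(4)[OF I, of "ennreal (e / 4)"] e by auto
    obtain p n where p: "subdivision \<delta> p n s t" "L2_dist_sq M (riemann p n h) J < ennreal (e / 4)"
      using wiener_integral_approx[OF J d(1), of "ennreal (e / 4)"] e by auto
    have "L2_dist_sq M I J \<le> 2 * L2_dist_sq M I (riemann p n h) + 2 * L2_dist_sq M (riemann p n h) J"
      by (rule L2_dist_sq_triangle) auto
    also have "\<dots> \<le> 2 * ennreal (e / 4) + 2 * ennreal (e / 4)"
      using d(2)[OF p(1)] p(2) by (intro add_mono mult_left_mono) (auto simp: L2_dist_sq_commute)
    also have "\<dots> = 0 + ennreal e"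
      using e by (simp add: ennreal_collect del: ennreal_numeral ennreal_plus)
    finally show "L2_dist_sq M I J \<le> 0 + ennreal e" .
  qed
  then show ?thesis by (simp add: L2_dist_sq_eq_0_iff)
qed

lemma wiener_integral_diff:
  assumes I: "wiener h s t I" and J: "wiener g s t J"
  shows "wiener (\<lambda>u. h u - g u) s t (\<lambda>\<omega>. I \<omega> - J \<omega>)"
proof (rule wiener_integralI)
  note [measurable] = wiener_integralD(3)[OF I] wiener_integralD(3)[OF J]
  show "(\<lambda>\<omega>. I \<omega> - J \<omega>) \<in> borel_measurable M" by measurable
  show "s \<le> t" "continuous_on {s..t} (\<lambda>u. h u - g u)"
    using wiener_integralD[OF I] wiener_integralD[OF J] by (auto intro!: continuous_intros)
  fix e :: ennreal assume "0 < e"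
  then have e: "0 < e / 4" by (simp add: ennreal_divide_eq_0_iff zero_less_iff_neq_zero)
  obtain \<delta> where d: "0 < \<delta>" "\<And>n p. subdivision \<delta> p n s t \<Longrightarrow> L2_dist_sq M (riemann p n h) I < e / 4"
    using wiener_integralD(4)[OF I e] by blast
  obtain \<delta>' where d': "0 < \<delta>'" "\<And>n p. subdivision \<delta>' p n s t \<Longrightarrow> L2_dist_sq M (riemann p n g) J < e / 4"
    using wiener_integralD(4)[OF J e] by blast
  have "L2_dist_sq M (riemann p n (\<lambda>u. h u - g u)) (\<lambda>\<omega>. I \<omega> - J \<omega>) < e"
    if p: "subdivision (min \<delta> \<delta>') p n s t" for p n
  proof -
    have "subdivision \<delta> p n s t" "subdivision \<delta>' p n s t"
      using p by (auto elim: subdivision_mesh_mono)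
    note * = d(2)[OF this(1)] d'(2)[OF this(2)]
    have "riemann p n (\<lambda>u. h u - g u) = (\<lambda>\<omega>. riemann p n h \<omega> - riemann p n g \<omega>)"
      by (simp add: riemann_def fun_eq_iff sum_subtractf[symmetric] algebra_simps)
    then have "L2_dist_sq M (riemann p n (\<lambda>u. h u - g u)) (\<lambda>\<omega>. I \<omega> - J \<omega>)
        \<le> 2 * L2_dist_sq M (riemann p n h) I + 2 * L2_dist_sq M (riemann p n g) J"
      using L2_dist_sq_diff[of "riemann p n h" M "riemann p n g" I J] by simp
    also have "\<dots> = 2 * (L2_dist_sq M (riemann p n h) I + L2_dist_sq M (riemann p n g) J)"
      by (simp add: distrib_left)
    also have "\<dots> < 2 * (e / 4 + e / 4)"
      using add_strict_mono[OF *] by (intro ennreal_mult_strict_left_mono) auto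
    also have "\<dots> = e"
    proof -
      have "2 * (e / 4 + e / 4) = 4 * (e / 4)" by (simp add: mult_2[symmetric] mult.assoc[symmetric])
      also have "\<dots> = e" by (simp add: ennreal_times_divide mult_divide_eq_ennreal mult.commute)
      finally show ?thesis .
    qed
    finally show ?thesis .
  qed
  moreover have "0 < min \<delta> \<delta>'" using d d' by simp
  ultimately show "\<exists>\<delta>>0. \<forall>n p. subdivision \<delta> p n s t \<longrightarrow>
      L2_dist_sq M (riemann p n (\<lambda>u. h u - g u)) (\<lambda>\<omega>. I \<omega> - J \<omega>) < e" by blast
qed

lemma riemann_append:
  assumes "subdivision \<delta> p n s u" "subdivision \<delta> q m u t"
  shows "riemann (\<lambda>k. if k < n then p k else q (k - n)) (n + m) h \<omega> = riemann p n h \<omega> + riemann q m h \<omega>"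
proof -
  have "p n = q 0" using assms by (simp add: subdivision_def)
  then have "(\<Sum>k<n. h (if k < n then p k else q (k - n)) *
      (\<beta> (if Suc k < n then p (Suc k) else q (Suc k - n)) \<omega> - \<beta> (if k < n then p k else q (k - n)) \<omega>))
      = riemann p n h \<omega>"
    unfolding riemann_def by (intro sum.cong refl) (auto simp: not_less Suc_le_eq[symmetric] dest: le_antisym)
  then show ?thesis by (simp add: riemann_def sum_lessThan_add Suc_diff_le)
qed

text \<open>Concatenating subdivisions of the two pieces gives one of the whole interval with the
  same mesh bound, so all three integrals are approximated at once.\<close>

lemma wiener_integral_append:
  assumes I1: "wiener h s u I1" and I2: "wiener h u t I2"
    and I: "wiener h s t I"
  shows "AE \<omega> in M. I \<omega> = I1 \<omega> + I2 \<omega>"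
proof -
  note [measurable] = wiener_integralD(3)[OF I] wiener_integralD(3)[OF I1] wiener_integralD(3)[OF I2]
  have "L2_dist_sq M I (\<lambda>\<omega>. I1 \<omega> + I2 \<omega>) \<le> 0"
  proof (rule ennreal_le_epsilon)
    fix e :: real assume e: "0 < e"
    \<comment> \<open>The two squared triangle inequalities below produce
      \<open>2 + 2 * (2 + 2) = 10\<close> errors.\<close>
    obtain \<delta> where d: "0 < \<delta>" "\<And>n p. subdivision \<delta> p n s t \<Longrightarrow> L2_dist_sq M (riemann p n h) I < ennreal (e / 10)"
      using wiener_integralD(4)[OF I, of "ennreal (e / 10)"] e by auto
    obtain p n where p: "subdivision \<delta> p n s u" "L2_dist_sq M (riemann p n h) I1 < ennreal (e / 10)"
      using wiener_integral_approx[OF I1 d(1), of "ennreal (e / 10)"] e by auto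
    obtain q m where q: "subdivision \<delta> q m u t" "L2_dist_sq M (riemann q m h) I2 < ennreal (e / 10)"
      using wiener_integral_approx[OF I2 d(1), of "ennreal (e / 10)"] e by auto
    define R where "R = (\<lambda>\<omega>. riemann p n h \<omega> + riemann q m h \<omega>)"
    have [measurable]: "R \<in> borel_measurable M" unfolding R_def by measurable
    have "riemann (\<lambda>k. if k < n then p k else q (k - n)) (n + m) h = R"
      unfolding R_def by (rule ext) (rule riemann_append[OF p(1) q(1)])
    then have "L2_dist_sq M R I < ennreal (e / 10)"
      using d(2)[OF subdivision_append[OF p(1) q(1)]] by simp
    moreover have "L2_dist_sq M R (\<lambda>\<omega>. I1 \<omega> + I2 \<omega>) \<le> 2 * L2_dist_sq M (riemann p n h) I1 + 2 * L2_dist_sq M (riemann q m h) I2"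
      unfolding R_def by (rule L2_dist_sq_add) auto
    then have "L2_dist_sq M R (\<lambda>\<omega>. I1 \<omega> + I2 \<omega>) \<le> 2 * ennreal (e / 10) + 2 * ennreal (e / 10)"
      by (rule order_trans) (use p(2) q(2) in \<open>intro add_mono mult_left_mono\<close>, auto)
    ultimately have "2 * L2_dist_sq M I R + 2 * L2_dist_sq M R (\<lambda>\<omega>. I1 \<omega> + I2 \<omega>)
        \<le> 2 * ennreal (e / 10) + 2 * (2 * ennreal (e / 10) + 2 * ennreal (e / 10))"
      by (intro add_mono mult_left_mono) (auto simp: L2_dist_sq_commute)
    also have "\<dots> = 0 + ennreal e"
      using e by (simp add: ennreal_collect del: ennreal_numeral ennreal_plus)
    finally show "L2_dist_sq M I (\<lambda>\<omega>. I1 \<omega> + I2 \<omega>) \<le> 0 + ennreal e"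
      using L2_dist_sq_triangle[of I M R "\<lambda>\<omega>. I1 \<omega> + I2 \<omega>"] by simp
  qed
  then show ?thesis by (simp add: L2_dist_sq_eq_0_iff)
qed

lemma wiener_integral_refl: "wiener h t t (\<lambda>_. 0)"
proof (rule wiener_integralI)
  fix e :: ennreal assume e: "0 < e"
  have "L2_dist_sq M (riemann p n h) (\<lambda>_. 0) < e" if p: "subdivision 1 p n t t" for p n
  proof -
    have "n = 0"
    proof (rule ccontr)
      assume "n \<noteq> 0"
      then have "p 0 < p (Suc 0)" "p (Suc 0) \<le> t"
        using p subdivision_bounds[OF p, of "Suc 0"] by (auto simp: subdivision_def)
      then show False using p by (simp add: subdivision_def)
    qed
    then show ?thesis using e by (simp add: riemann_def L2_dist_sq_def)
  qed
  then show "\<exists>\<delta>>0. \<forall>n p. subdivision \<delta> p n t t \<longrightarrow> L2_dist_sq M (riemann p n h) (\<lambda>_. 0) < e"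
    by (intro exI[of _ 1]) auto
qed auto

lemma wiener_integral_exists:
  assumes st: "s \<le> t" and h: "continuous_on {s..t} h"
  obtains I where "wiener h s t I"
proof -
  have "uniformly_continuous_on {s..t} h" using h by (intro compact_uniformly_continuous) auto
  then have "\<forall>n::nat. \<exists>\<delta>>0. \<forall>u\<in>{s..t}. \<forall>v\<in>{s..t}. \<bar>u - v\<bar> < \<delta> \<longrightarrow> \<bar>h u - h v\<bar> < (1/2) ^ n"
    unfolding uniformly_continuous_on_def dist_real_def
    by (metis abs_minus_commute zero_less_power half_gt_zero zero_less_one)
  then obtain \<delta> where \<delta>: "\<And>n::nat. 0 < \<delta> n"
    "\<And>n u v. u \<in> {s..t} \<Longrightarrow> v \<in> {s..t} \<Longrightarrow> \<bar>u - v\<bar> < \<delta> n \<Longrightarrow> \<bar>h u - h v\<bar> < (1/2) ^ n"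
    by metis
  \<comment> \<open>The running minimum makes the meshes decrease, so that the \<open>m\<close>-th
    subdivision is admissible for every tolerance \<open>n \<le> m\<close>.\<close>
  define \<delta>' where "\<delta>' n = Min (\<delta> ` {..n})" for n
  have \<delta>': "0 < \<delta>' n" for n using \<delta>(1) by (simp add: \<delta>'_def)
  have \<delta>'_mono: "\<delta>' m \<le> \<delta> n" if "n \<le> m" for n m using that by (simp add: \<delta>'_def)
  have "\<forall>n. \<exists>p k. subdivision (\<delta>' n) p k s t" using subdivision_exists[OF st \<delta>'] by metis
  then obtain p k where pk: "\<And>n. subdivision (\<delta>' n) (p n) (k n) s t" by metis
  define C where "C = (t - s) powr (2 * H)"
  have C: "0 \<le> C" by (simp add: C_def)
  have close: "L2_dist_sq M (riemann q j h) (riemann (p m) (k m) h) \<le> ennreal (C * (1/4) ^ n)"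
    if "n \<le> m" "subdivision (\<delta> n) q j s t" for n m q j
  proof -
    have "subdivision (\<delta> n) (p m) (k m) s t" using pk[of m] \<delta>'_mono[OF that(1)] by (rule subdivision_mesh_mono)
    from riemann_close[OF that(2) this st, of h h "(1/2) ^ n"] \<delta>(2)[of _ _ n]
    have "L2_dist_sq M (riemann q j h) (riemann (p m) (k m) h) \<le> ennreal (((1/2) ^ n)\<^sup>2 * (t - s) powr (2 * H))"
      by (meson less_imp_le)
    also have "((1/2) ^ n)\<^sup>2 = (1/4::real) ^ n" by (simp add: power2_eq_square power_mult_distrib[symmetric])
    finally show ?thesis by (simp add: C_def mult.commute)
  qed
  obtain I where I[measurable]: "I \<in> borel_measurable M"
    and I_le: "\<And>n. L2_dist_sq M (riemann (p n) (k n) h) I \<le> ennreal (C * (1/4) ^ n)"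
    using L2_fast_Cauchy_limit[of "\<lambda>n. riemann (p n) (k n) h" M "1/4" C]
      close[OF _ subdivision_mesh_mono[OF pk \<delta>'_mono]] C by auto
  have "wiener h s t I"
  proof (rule wiener_integralI[OF st h I])
    fix e :: ennreal assume e: "0 < e"
    have "(\<lambda>n. ennreal (4 * C * (1/4) ^ n)) \<longlonglongrightarrow> ennreal (4 * C * 0)"
      by (intro tendsto_ennrealI tendsto_intros LIMSEQ_power_zero) auto
    then have "\<forall>\<^sub>F n in sequentially. ennreal (4 * C * (1/4) ^ n) < e" using e by (intro order_tendstoD) auto
    then obtain n where n: "ennreal (4 * C * (1/4) ^ n) < e" by (auto simp: eventually_sequentially)
    \<comment> \<open>Every subdivision of mesh below \<open>\<delta> n\<close> is compared with the
      \<open>n\<close>-th reference sum, so the limit does not depend on the reference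
      subdivisions.\<close>
    have "L2_dist_sq M (riemann q j h) I < e" if q: "subdivision (\<delta> n) q j s t" for j q
    proof -
      have "L2_dist_sq M (riemann q j h) I \<le> 2 * L2_dist_sq M (riemann q j h) (riemann (p n) (k n) h)
          + 2 * L2_dist_sq M (riemann (p n) (k n) h) I"
        by (rule L2_dist_sq_triangle) auto
      also have "\<dots> \<le> 2 * ennreal (C * (1/4) ^ n) + 2 * ennreal (C * (1/4) ^ n)"
        using close[OF order_refl q] I_le[of n] by (intro add_mono mult_left_mono) auto
      also have "\<dots> = ennreal (4 * C * (1/4) ^ n)"
        using C by (simp add: ennreal_collect del: ennreal_numeral ennreal_plus)
      finally show ?thesis using n by (rule le_less_trans)
    qed
    then show "\<exists>\<delta>>0. \<forall>n p. subdivision \<delta> p n s t \<longrightarrow> L2_dist_sq M (riemann p n h) I < e"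
      using \<delta>(1)[of n] by blast
  qed
  then show ?thesis using that by blast
qed

end

section \<open>Wiener integrals over half-lines\<close>

text \<open>The solution \<open>K\<close> of
  \<open>exp (- m) * K + 2 * (1 + 1 / (exp m - 1)) = K\<close>, the equation under which the
  recursion over unit intervals in \<open>wiener_integral_exp_bound\<close> reproduces its own
  bound.\<close>

definition exp_const :: "real \<Rightarrow> real" where
  "exp_const m = 2 * (1 + 1 / (exp m - 1)) / (1 - exp (- m))"

lemma exp_const_ge: assumes "0 < m" shows "2 \<le> exp_const m"
proof -
  define x where "x = 1 / (exp m - 1)"
  have d: "0 < 1 - exp (- m)" "1 - exp (- m) \<le> 1" "0 \<le> x" using assms by (auto simp: x_def)
  then have "2 * (1 - exp (- m)) \<le> 2 * (1 + x)" by argo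
  with d show ?thesis unfolding exp_const_def x_def[symmetric] by (subst pos_le_divide_eq) auto
qed

lemma exp_const_sq_ge: "0 < m \<Longrightarrow> 2 * C\<^sup>2 \<le> C\<^sup>2 * exp_const m"
  using mult_left_mono[OF exp_const_ge zero_le_power2[of C]] by (metis mult.commute)

context fbm_cov
begin

text \<open>Splitting off the last unit interval reproduces the bound with the constant \<open>C exp (-m)\<close>;
  the weights in the square of the sum are chosen so that the induction closes.\<close>

lemma wiener_integral_exp_bound:
  assumes m: "0 < m" and I: "wiener h a b I"
    and C: "0 \<le> C" and h: "\<And>u. u \<in> {a..b} \<Longrightarrow> \<bar>h u\<bar> \<le> C * exp (- m * (b - u))"
  shows "L2_dist_sq M I (\<lambda>_. 0) \<le> ennreal (C\<^sup>2 * exp_const m)"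
proof -
  \<comment> \<open>On length at most 1 the factor \<open>(b - a) powr (2 * H)\<close> is at most 1
    and the decay may be dropped.\<close>
  have short: "L2_dist_sq M I (\<lambda>_. 0) \<le> ennreal (2 * C\<^sup>2)"
    if "wiener h a b I" "0 \<le> C" "b - a \<le> 1"
      "\<And>u. u \<in> {a..b} \<Longrightarrow> \<bar>h u\<bar> \<le> C * exp (- m * (b - u))" for a b C I
  proof -
    have "\<bar>h u\<bar> \<le> C" if "u \<in> {a..b}" for u
    proof -
      have "C * exp (- m * (b - u)) \<le> C * 1" using \<open>0 \<le> C\<close> m that by (intro mult_left_mono) auto
      then show ?thesis using \<open>\<And>u. u \<in> {a..b} \<Longrightarrow> \<bar>h u\<bar> \<le> C * exp (- m * (b - u))\<close>[OF that] by simp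
    qed
    from wiener_integral_bound[OF that(1) this]
    have "L2_dist_sq M I (\<lambda>_. 0) \<le> ennreal (2 * C\<^sup>2 * (b - a) powr (2 * H))" .
    also have "(b - a) powr (2 * H) \<le> 1"
      using that(3) wiener_integralD(1)[OF that(1)] H by (intro powr_le1) auto
    then have "ennreal (2 * C\<^sup>2 * (b - a) powr (2 * H)) \<le> ennreal (2 * C\<^sup>2)"
      by (intro ennreal_leI) (simp add: mult_left_le)
    finally show ?thesis .
  qed
  obtain N :: nat where "b - a \<le> real N" using real_arch_simple by blast
  then show ?thesis using I C h
  proof (induction N arbitrary: b C I)
    case 0
    then have "L2_dist_sq M I (\<lambda>_. 0) \<le> ennreal (2 * C\<^sup>2)" by (intro short[of a b I C]) auto
    also have "\<dots> \<le> ennreal (C\<^sup>2 * exp_const m)"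
      by (rule ennreal_leI[OF exp_const_sq_ge[OF m]])
    finally show ?case .
  next
    case (Suc N)
    show ?case
    proof (cases "b - a \<le> 1")
      case True
      then have "L2_dist_sq M I (\<lambda>_. 0) \<le> ennreal (2 * C\<^sup>2)" using Suc.prems by (intro short[of a b I C]) auto
      also have "\<dots> \<le> ennreal (C\<^sup>2 * exp_const m)"
        by (rule ennreal_leI[OF exp_const_sq_ge[OF m]])
      finally show ?thesis .
    next
      case False
      note hI = Suc.prems(2)
      have cont: "continuous_on {a..b - 1} h" "continuous_on {b - 1..b} h"
        using wiener_integralD(2)[OF hI] False by (auto elim: continuous_on_subset)
      obtain I1 where I1: "wiener h a (b - 1) I1"
        using wiener_integral_exists[OF _ cont(1)] False by auto
      obtain I2 where I2: "wiener h (b - 1) b I2"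
        using wiener_integral_exists[OF _ cont(2)] by auto
      note [measurable] = wiener_integralD(3)[OF I1] wiener_integralD(3)[OF I2]
      have le1: "L2_dist_sq M I1 (\<lambda>_. 0) \<le> ennreal ((C * exp (- m))\<^sup>2 * exp_const m)"
      proof (rule Suc.IH[OF _ I1])
        fix u assume "u \<in> {a..b - 1}"
        then have "\<bar>h u\<bar> \<le> C * exp (- m * (b - u))" using Suc.prems(4)[of u] by simp
        also have "\<dots> = C * exp (- m) * exp (- m * (b - 1 - u))"
          by (simp add: mult_exp_exp algebra_simps)
        finally show "\<bar>h u\<bar> \<le> C * exp (- m) * exp (- m * (b - 1 - u))" .
      qed (use Suc.prems in auto)
      have le2: "L2_dist_sq M I2 (\<lambda>_. 0) \<le> ennreal (2 * C\<^sup>2)"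
        using Suc.prems False by (intro short[OF I2]) auto
      \<comment> \<open>The weight \<open>1 + r = exp m\<close> on the earlier part
        \<open>I1\<close> uses up one of the two factors \<open>exp (- m)\<close> produced by
        squaring; the other one makes the recursion contract.\<close>
      have r: "0 < exp m - 1" using m by simp
      have "L2_dist_sq M I (\<lambda>_. 0) = L2_dist_sq M (\<lambda>\<omega>. I1 \<omega> + I2 \<omega>) (\<lambda>_. 0)"
        using wiener_integral_append[OF I1 I2 hI] by (intro L2_dist_sq_cong_AE) auto
      also have "\<dots> \<le> ennreal (1 + (exp m - 1)) * L2_dist_sq M I1 (\<lambda>_. 0)
          + ennreal (1 + 1 / (exp m - 1)) * L2_dist_sq M I2 (\<lambda>_. 0)"
        by (rule L2_dist_sq_add_weighted) (use r in auto)
      also have "\<dots> \<le> ennreal (1 + (exp m - 1)) * ennreal ((C * exp (- m))\<^sup>2 * exp_const m)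
          + ennreal (1 + 1 / (exp m - 1)) * ennreal (2 * C\<^sup>2)"
        by (intro add_mono mult_left_mono le1 le2) auto
      also have "\<dots> = ennreal (exp m * ((C * exp (- m))\<^sup>2 * exp_const m) + (1 + 1 / (exp m - 1)) * (2 * C\<^sup>2))"
        using r exp_const_ge[OF m] by (simp add: ennreal_mult[symmetric] ennreal_plus[symmetric] del: ennreal_plus)
      also have "exp m * ((C * exp (- m))\<^sup>2 * exp_const m) + (1 + 1 / (exp m - 1)) * (2 * C\<^sup>2) = C\<^sup>2 * exp_const m"
      proof -
        have "exp m * (C * exp (- m))\<^sup>2 = C\<^sup>2 * exp (- m)"
          by (simp add: power2_eq_square mult_exp_exp[symmetric] exp_minus field_simps)
        moreover have "2 * (1 + 1 / (exp m - 1)) = exp_const m * (1 - exp (- m))"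
          using m by (simp add: exp_const_def)
        moreover have "exp m * ((C * exp (- m))\<^sup>2 * exp_const m) + (1 + 1 / (exp m - 1)) * (2 * C\<^sup>2)
            = (exp m * (C * exp (- m))\<^sup>2) * exp_const m + C\<^sup>2 * (2 * (1 + 1 / (exp m - 1)))"
          by (simp only: ac_simps)
        ultimately show ?thesis by (simp only:) (simp add: algebra_simps)
      qed
      finally show ?thesis .
    qed
  qed
qed

text \<open>Extending the range adds the integral over \<open>{a'..a}\<close>, where
  \<open>h\<close> is at most \<open>C * exp (- m * (t - a))\<close> times the decay measured from
  \<open>a\<close>.\<close>

lemma wiener_integral_extend:
  assumes m: "0 < m" and C: "0 \<le> C" and h: "\<And>u. u \<le> t \<Longrightarrow> \<bar>h u\<bar> \<le> C * exp (- m * (t - u))"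
    and J: "wiener h a t J" and J': "wiener h a' t J'"
    and "a' \<le> a"
  shows "L2_dist_sq M J' J \<le> ennreal (C\<^sup>2 * exp_const m * exp (- (2 * m) * (t - a)))"
proof -
  have at: "a \<le> t" using wiener_integralD(1)[OF J] .
  have "continuous_on {a'..a} h" using wiener_integralD(2)[OF J'] at by (auto elim: continuous_on_subset)
  then obtain I where I: "wiener h a' a I"
    using wiener_integral_exists[OF \<open>a' \<le> a\<close>] by blast
  have "L2_dist_sq M J' J = L2_dist_sq M (\<lambda>\<omega>. I \<omega> + J \<omega>) J"
    using wiener_integral_append[OF I J J'] by (intro L2_dist_sq_cong_AE) auto
  also have "\<dots> = L2_dist_sq M I (\<lambda>_. 0)" by (simp add: L2_dist_sq_def)
  also have "\<dots> \<le> ennreal ((C * exp (- m * (t - a)))\<^sup>2 * exp_const m)"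
  proof (rule wiener_integral_exp_bound[OF m I])
    fix u assume "u \<in> {a'..a}"
    then show "\<bar>h u\<bar> \<le> C * exp (- m * (t - a)) * exp (- m * (a - u))"
      using h[of u] at by (simp add: mult_exp_exp algebra_simps)
  qed (use C in auto)
  also have "(C * exp (- m * (t - a)))\<^sup>2 * exp_const m = C\<^sup>2 * exp_const m * exp (- (2 * m) * (t - a))"
    by (simp add: power2_eq_square mult_exp_exp algebra_simps)
  finally show ?thesis .
qed

text \<open>The integral over \<open>]-\<infinity>, t]\<close> is characterized by an explicit rate for its truncations.\<close>

definition lower_integral :: "real \<Rightarrow> real \<Rightarrow> (real \<Rightarrow> real) \<Rightarrow> real \<Rightarrow> ('w \<Rightarrow> real) \<Rightarrow> bool" where
  "lower_integral D m h t I \<longleftrightarrow> I \<in> borel_measurable M \<and>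
     (\<forall>a J. wiener h a t J \<longrightarrow>
        L2_dist_sq M J I \<le> ennreal (D * exp (- (2 * m) * (t - a))))"

lemma lower_integral_exists:
  assumes m: "0 < m" and C: "0 \<le> C" and h: "\<And>u. u \<le> t \<Longrightarrow> \<bar>h u\<bar> \<le> C * exp (- m * (t - u))"
    and cont: "continuous_on {..t} h"
  obtains I where "lower_integral (4 * C\<^sup>2 * exp_const m) m h t I"
proof -
  define D where "D = C\<^sup>2 * exp_const m"
  have D: "0 \<le> D" using exp_const_ge[OF m] by (simp add: D_def)
  have "\<exists>J. wiener h (t - real n) t J" for n
    using wiener_integral_exists[of "t - real n" t h] continuous_on_subset[OF cont, of "{t - real n..t}"] by auto
  then obtain J where J: "\<And>n. wiener h (t - real n) t (J n)" by metis
  note [measurable] = wiener_integralD(3)[OF J]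
  have ex: "exp (- (2 * m)) ^ n = exp (- (2 * m) * real n)" for n
    by (simp add: exp_of_nat_mult[symmetric] mult.commute)
  have "L2_dist_sq M (J n) (J k) \<le> ennreal (D * exp (- (2 * m)) ^ n)" if "n \<le> k" for n k
    using wiener_integral_extend[OF m C h J[of n] J[of k]] that unfolding D_def ex by (simp add: L2_dist_sq_commute)
  then obtain I where I[measurable]: "I \<in> borel_measurable M"
    and I_le: "\<And>n. L2_dist_sq M (J n) I \<le> ennreal (D * exp (- (2 * m)) ^ n)"
    using L2_fast_Cauchy_limit[of J M "exp (- (2 * m))" D] m D by auto
  have "L2_dist_sq M J' I \<le> ennreal (4 * D * exp (- (2 * m) * (t - a)))"
    if J': "wiener h a t J'" for a J'
  proof -
    note [measurable] = wiener_integralD(3)[OF J']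
    \<comment> \<open>With \<open>n\<close> at least \<open>t - a\<close>, the integral
      \<open>J'\<close> is the shorter truncation and its left end governs both errors; the squared
      triangle inequality turns them into the factor 4.\<close>
    obtain n :: nat where n: "t - a \<le> real n" using real_arch_simple by blast
    have "L2_dist_sq M J' I \<le> 2 * L2_dist_sq M J' (J n) + 2 * L2_dist_sq M (J n) I"
      by (rule L2_dist_sq_triangle) auto
    also have "\<dots> \<le> 2 * ennreal (D * exp (- (2 * m) * (t - a))) + 2 * ennreal (D * exp (- (2 * m) * (t - a)))"
    proof (intro add_mono mult_left_mono)
      show "L2_dist_sq M J' (J n) \<le> ennreal (D * exp (- (2 * m) * (t - a)))"
        using wiener_integral_extend[OF m C h J' J[of n]] n by (simp add: D_def L2_dist_sq_commute)
      have "D * exp (- (2 * m)) ^ n \<le> D * exp (- (2 * m) * (t - a))"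
        unfolding ex using D n m by (intro mult_left_mono) auto
      then show "L2_dist_sq M (J n) I \<le> ennreal (D * exp (- (2 * m) * (t - a)))"
        using I_le[of n] by (meson ennreal_leI order_trans)
    qed auto
    also have "\<dots> = ennreal (4 * D * exp (- (2 * m) * (t - a)))"
      using D by (simp add: ennreal_collect del: ennreal_numeral ennreal_plus)
    finally show ?thesis .
  qed
  then have "lower_integral (4 * C\<^sup>2 * exp_const m) m h t I"
    unfolding lower_integral_def D_def by (auto simp: mult.assoc)
  then show ?thesis using that by blast
qed

lemma lower_integral_bound:
  assumes "lower_integral D m h t I"
  shows "L2_dist_sq M I (\<lambda>_. 0) \<le> ennreal D"
  using assms wiener_integral_refl[of h t] unfolding lower_integral_def by (force simp: L2_dist_sq_commute)

text \<open>Both integrals are truncated at \<open>s - n\<close> and the later one is split at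
  \<open>s\<close>: the noise on \<open>{s..t}\<close> is controlled by the length of this interval,
  and on the past only the difference of the integrands counts. The truncation errors vanish as
  \<open>n\<close> grows.\<close>

lemma lower_integral_increment:
  assumes m: "0 < m" and I: "lower_integral D m h t I" and J: "lower_integral D m g s J" and D: "0 \<le> D"
    and st: "s \<le> t" and h: "continuous_on {..t} h" and g: "continuous_on {..s} g"
    and C1: "\<And>u. u \<in> {s..t} \<Longrightarrow> \<bar>h u\<bar> \<le> C1"
    and C2: "0 \<le> C2" "\<And>u. u \<le> s \<Longrightarrow> \<bar>h u - g u\<bar> \<le> C2 * exp (- m * (s - u))"
  shows "L2_dist_sq M I J \<le> ennreal (16 * C1\<^sup>2 * (t - s) powr (2 * H) + 8 * C2\<^sup>2 * exp_const m)"
proof (rule ennreal_le_of_exp_decay)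
  fix n :: nat
  define a where "a = s - real n"
  have a: "a \<le> s" "a \<le> t" using st by (auto simp: a_def)
  have cont: "continuous_on {a..t} h" "continuous_on {s..t} h" "continuous_on {a..s} h" "continuous_on {a..s} g"
    using h g st by (auto elim!: continuous_on_subset)
  obtain Jt where Jt: "wiener h a t Jt" using wiener_integral_exists[OF a(2) cont(1)] .
  obtain J1 where J1: "wiener h s t J1" using wiener_integral_exists[OF st cont(2)] .
  obtain J2 where J2: "wiener h a s J2" using wiener_integral_exists[OF a(1) cont(3)] .
  obtain Js where Js: "wiener g a s Js" using wiener_integral_exists[OF a(1) cont(4)] .
  note [measurable] = wiener_integralD(3)[OF Jt] wiener_integralD(3)[OF J1] wiener_integralD(3)[OF J2]
    wiener_integralD(3)[OF Js]
  have [measurable]: "I \<in> borel_measurable M" "J \<in> borel_measurable M"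
    using I J by (auto simp: lower_integral_def)
  define E where "E = D * exp (- (2 * m) * real n)"
  have E: "0 \<le> E" using D by (simp add: E_def)
  have IJt: "L2_dist_sq M I Jt \<le> ennreal E"
  proof -
    have "L2_dist_sq M Jt I \<le> ennreal (D * exp (- (2 * m) * (t - a)))"
      using I Jt by (simp add: lower_integral_def)
    also have "\<dots> \<le> ennreal E"
      unfolding E_def a_def using st m D by (intro ennreal_leI mult_left_mono) auto
    finally show ?thesis by (simp add: L2_dist_sq_commute)
  qed
  have JsJ: "L2_dist_sq M Js J \<le> ennreal E"
  proof -
    have "L2_dist_sq M Js J \<le> ennreal (D * exp (- (2 * m) * (s - a)))"
      using J Js by (simp add: lower_integral_def)
    then show ?thesis by (simp add: E_def a_def)
  qed
  have J1_le: "L2_dist_sq M J1 (\<lambda>_. 0) \<le> ennreal (2 * C1\<^sup>2 * (t - s) powr (2 * H))"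
    by (rule wiener_integral_bound[OF J1 C1])
  have J2_le: "L2_dist_sq M J2 Js \<le> ennreal (C2\<^sup>2 * exp_const m)"
    using wiener_integral_exp_bound[OF m wiener_integral_diff[OF J2 Js] C2(1)] C2(2)
    by (simp add: L2_dist_sq_shift)
  have "L2_dist_sq M Jt Js = L2_dist_sq M (\<lambda>\<omega>. J2 \<omega> + J1 \<omega>) (\<lambda>\<omega>. Js \<omega> + 0)"
    using wiener_integral_append[OF J2 J1 Jt] by (intro L2_dist_sq_cong_AE) auto
  also have "\<dots> \<le> 2 * L2_dist_sq M J2 Js + 2 * L2_dist_sq M J1 (\<lambda>_. 0)"
    by (rule L2_dist_sq_add) auto
  also have "\<dots> \<le> 2 * ennreal (C2\<^sup>2 * exp_const m) + 2 * ennreal (2 * C1\<^sup>2 * (t - s) powr (2 * H))"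
    by (intro add_mono mult_left_mono J1_le J2_le) auto
  finally have JtJs: "L2_dist_sq M Jt Js \<le> \<dots>" .
  have "L2_dist_sq M I J \<le> 2 * L2_dist_sq M I Jt + 2 * L2_dist_sq M Jt J"
    by (rule L2_dist_sq_triangle) auto
  also have "\<dots> \<le> 2 * L2_dist_sq M I Jt + 2 * (2 * L2_dist_sq M Jt Js + 2 * L2_dist_sq M Js J)"
    by (intro add_mono mult_left_mono order_refl L2_dist_sq_triangle) auto
  also have "\<dots> \<le> 2 * ennreal E + 2 * (2 * (2 * ennreal (C2\<^sup>2 * exp_const m)
      + 2 * ennreal (2 * C1\<^sup>2 * (t - s) powr (2 * H))) + 2 * ennreal E)"
    by (intro add_mono mult_left_mono IJt JtJs JsJ) auto
  also have "\<dots> = ennreal (6 * D * exp (- (2 * m) * real n)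
      + (16 * C1\<^sup>2 * (t - s) powr (2 * H) + 8 * C2\<^sup>2 * exp_const m))"
    using E exp_const_ge[OF m]
    by (simp add: ennreal_collect E_def del: ennreal_numeral ennreal_plus)
  finally show "L2_dist_sq M I J \<le> \<dots>" .
qed (use m D in auto)

end

section \<open>The matrix exponential\<close>

lemma matrix_pow_0 [simp]: "matrix_pow M 0 = mat 1"
  by (simp add: matrix_pow_def)

lemma matrix_pow_Suc: "matrix_pow M (Suc k) = M ** matrix_pow M k"
  by (simp add: matrix_pow_def)

lemma matrix_pow_add: "matrix_pow M (i + j) = matrix_pow M i ** matrix_pow M j"
  by (induction i) (simp_all add: matrix_pow_Suc matrix_mul_assoc)

lemma matrix_pow_scaleR: "matrix_pow (t *\<^sub>R M) k = t ^ k *\<^sub>R matrix_pow M k"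
  by (induction k)
    (auto simp: matrix_pow_Suc matrix_matrix_mult_def vec_eq_iff sum_distrib_left mult.assoc algebra_simps)

lemma norm_matrix_vector_le: "norm (M *v x) \<le> onorm ((*v) (M::real^'n^'m)) * norm x"
  by (rule onorm) (rule matrix_vector_mul_bounded_linear)

lemma onorm_matrix_mult_le:
  fixes M :: "real^'n^'m" and N :: "real^'k^'n"
  shows "onorm ((*v) (M ** N)) \<le> onorm ((*v) M) * onorm ((*v) N)"
proof (rule onorm_bound)
  show "0 \<le> onorm ((*v) M) * onorm ((*v) N)"
    by (intro mult_nonneg_nonneg onorm_pos_le matrix_vector_mul_bounded_linear)
  fix x
  have "norm ((M ** N) *v x) \<le> onorm ((*v) M) * norm (N *v x)"
    by (simp add: matrix_vector_mul_assoc[symmetric] norm_matrix_vector_le)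
  also have "\<dots> \<le> onorm ((*v) M) * (onorm ((*v) N) * norm x)"
    by (intro mult_left_mono norm_matrix_vector_le onorm_pos_le matrix_vector_mul_bounded_linear)
  finally show "norm ((M ** N) *v x) \<le> onorm ((*v) M) * onorm ((*v) N) * norm x" by (simp add: mult.assoc)
qed

lemma onorm_matrix_pow_le: "onorm ((*v) (matrix_pow M k)) \<le> onorm ((*v) M) ^ k"
proof (induction k)
  case 0
  have "(*v) (mat 1 :: real^'a^'a) = (\<lambda>x. x)" by auto
  then show ?case using onorm_id_le by simp
next
  case (Suc k)
  have "onorm ((*v) (matrix_pow M (Suc k))) \<le> onorm ((*v) M) * onorm ((*v) (matrix_pow M k))"
    unfolding matrix_pow_Suc by (rule onorm_matrix_mult_le)
  also have "\<dots> \<le> onorm ((*v) M) * onorm ((*v) M) ^ k"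
    by (intro mult_left_mono Suc onorm_pos_le matrix_vector_mul_bounded_linear)
  finally show ?case by simp
qed

lemma matrix_pow_entry_le: "\<bar>matrix_pow M k $ i $ j\<bar> \<le> onorm ((*v) M) ^ k"
  using matrix_component_le_onorm onorm_matrix_pow_le by (rule order_trans)

lemma summable_matrix_exp_entry:
  "summable (\<lambda>k. norm (t ^ k / fact k * matrix_pow M k $ i $ j))"
proof (rule summable_comparison_test)
  show "summable (\<lambda>k. inverse (fact k) * (\<bar>t\<bar> * onorm ((*v) M)) ^ k)" by (rule summable_exp)
  have "\<bar>t\<bar> ^ k * \<bar>matrix_pow M k $ i $ j\<bar> \<le> \<bar>t\<bar> ^ k * onorm ((*v) M) ^ k" for k
    by (intro mult_left_mono matrix_pow_entry_le) simp
  then show "\<exists>N. \<forall>k\<ge>N. norm (norm (t ^ k / fact k * matrix_pow M k $ i $ j))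
      \<le> inverse (fact k) * (\<bar>t\<bar> * onorm ((*v) M)) ^ k"
    by (auto simp: abs_mult power_abs power_mult_distrib divide_simps)
qed

text \<open>Entry by entry the matrix series is an absolutely convergent real series, to which
  Cauchy products and the continuity of power series apply.\<close>

lemma matrix_exp_entry_sums:
  "(\<lambda>k. t ^ k / fact k * matrix_pow M k $ i $ j) sums (matrix_exp (t *\<^sub>R M) $ i $ j)"
proof -
  let ?f = "\<lambda>k. inverse (fact k) *\<^sub>R matrix_pow (t *\<^sub>R M) k"
  have entry: "?f k $ i $ j = t ^ k / fact k * matrix_pow M k $ i $ j" for k i j
    by (simp add: matrix_pow_scaleR divide_inverse)
  have "summable ?f"
  proof (rule summable_norm_cancel, rule summable_comparison_test)
    show "summable (\<lambda>k. \<Sum>i\<in>UNIV. \<Sum>j\<in>UNIV. norm (t ^ k / fact k * matrix_pow M k $ i $ j))"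
      by (intro summable_sum summable_matrix_exp_entry)
    have le: "norm x \<le> (\<Sum>i\<in>UNIV. \<Sum>j\<in>UNIV. norm (x $ i $ j))" for x :: "real^'a^'a"
      by (rule order_trans[OF norm_le_componentwise_cart[of x "\<chi> i. norm (x $ i)"], THEN order_trans])
        (auto intro!: order_trans[OF norm_le_l1_cart] sum_mono)
    then show "\<exists>N. \<forall>k\<ge>N. norm (norm (?f k)) \<le> (\<Sum>i\<in>UNIV. \<Sum>j\<in>UNIV. norm (t ^ k / fact k * matrix_pow M k $ i $ j))"
      unfolding entry[symmetric] using le[of "?f k" for k] by (intro exI[of _ 0] allI impI) simp
  qed
  then have "?f sums matrix_exp (t *\<^sub>R M)" unfolding matrix_exp_def by (rule summable_sums)
  then have "(\<lambda>k. ?f k $ i $ j) sums (matrix_exp (t *\<^sub>R M) $ i $ j)"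
    by (intro bounded_linear.sums[OF bounded_linear_vec_nth])
  then show ?thesis unfolding entry .
qed

text \<open>Cauchy product of the entry series: \<open>matrix_pow_add\<close> merges the two powers
  and the binomial theorem collects the coefficients.\<close>

lemma matrix_exp_add: "matrix_exp ((t + s) *\<^sub>R M) = matrix_exp (t *\<^sub>R M) ** matrix_exp (s *\<^sub>R M)"
proof -
  have "(matrix_exp (t *\<^sub>R M) ** matrix_exp (s *\<^sub>R M)) $ i $ j = matrix_exp ((t + s) *\<^sub>R M) $ i $ j" for i j
  proof -
    let ?a = "\<lambda>l k. t ^ k / fact k * matrix_pow M k $ i $ l"
    let ?b = "\<lambda>l k. s ^ k / fact k * matrix_pow M k $ l $ j"
    have "(\<lambda>k. \<Sum>l\<in>UNIV. \<Sum>n\<le>k. ?a l n * ?b l (k - n)) sums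
        (\<Sum>l\<in>UNIV. (\<Sum>k. ?a l k) * (\<Sum>k. ?b l k))"
      by (intro sums_sum Cauchy_product_sums summable_matrix_exp_entry)
    also have "(\<Sum>l\<in>UNIV. (\<Sum>k. ?a l k) * (\<Sum>k. ?b l k)) = (matrix_exp (t *\<^sub>R M) ** matrix_exp (s *\<^sub>R M)) $ i $ j"
      by (simp only: matrix_matrix_mult_def vec_lambda_beta sums_unique[OF matrix_exp_entry_sums, symmetric])
    also have "(\<lambda>k. \<Sum>l\<in>UNIV. \<Sum>n\<le>k. ?a l n * ?b l (k - n)) = (\<lambda>k. (t + s) ^ k / fact k * matrix_pow M k $ i $ j)"
    proof
      fix k
      have "(\<Sum>l\<in>UNIV. \<Sum>n\<le>k. ?a l n * ?b l (k - n))
          = (\<Sum>n\<le>k. t ^ n / fact n * (s ^ (k - n) / fact (k - n)) * (\<Sum>l\<in>UNIV. matrix_pow M n $ i $ l * matrix_pow M (k - n) $ l $ j))"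
        by (subst sum.swap) (simp add: sum_distrib_left ac_simps)
      also have "\<dots> = (\<Sum>n\<le>k. (of_nat (k choose n) * t ^ n * s ^ (k - n)) * (matrix_pow M k $ i $ j / fact k))"
      proof (intro sum.cong refl)
        fix n assume "n \<in> {..k}"
        then have n: "n \<le> k" by simp
        then have "(\<Sum>l\<in>UNIV. matrix_pow M n $ i $ l * matrix_pow M (k - n) $ l $ j) = matrix_pow M k $ i $ j"
          using matrix_pow_add[of M n "k - n"] by (simp add: matrix_matrix_mult_def)
        with n show "t ^ n / fact n * (s ^ (k - n) / fact (k - n)) * (\<Sum>l\<in>UNIV. matrix_pow M n $ i $ l * matrix_pow M (k - n) $ l $ j)
            = (of_nat (k choose n) * t ^ n * s ^ (k - n)) * (matrix_pow M k $ i $ j / fact k)"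
          by (simp add: binomial_fact field_simps)
      qed
      also have "\<dots> = (t + s) ^ k / fact k * matrix_pow M k $ i $ j"
        by (simp add: binomial_ring sum_distrib_right sum_divide_distrib)
      finally show "(\<Sum>l\<in>UNIV. \<Sum>n\<le>k. ?a l n * ?b l (k - n)) = (t + s) ^ k / fact k * matrix_pow M k $ i $ j" .
    qed
    finally have "(\<lambda>k. (t + s) ^ k / fact k * matrix_pow M k $ i $ j) sums
        (matrix_exp (t *\<^sub>R M) ** matrix_exp (s *\<^sub>R M)) $ i $ j" .
    then show ?thesis using matrix_exp_entry_sums sums_unique2 by blast
  qed
  then show ?thesis by (simp add: vec_eq_iff)
qed

lemma continuous_on_matrix_exp: "continuous_on UNIV (\<lambda>t. matrix_exp (t *\<^sub>R M))"
proof -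
  have "isCont (\<lambda>t. matrix_exp (t *\<^sub>R M) $ i $ j) x" for i j x
  proof -
    have eq: "(\<lambda>t. matrix_exp (t *\<^sub>R M) $ i $ j) = (\<lambda>t. \<Sum>k. (matrix_pow M k $ i $ j / fact k) * t ^ k)"
    proof
      fix t
      have "matrix_exp (t *\<^sub>R M) $ i $ j = (\<Sum>k. t ^ k / fact k * matrix_pow M k $ i $ j)"
        by (rule sums_unique[OF matrix_exp_entry_sums])
      also have "\<dots> = (\<Sum>k. (matrix_pow M k $ i $ j / fact k) * t ^ k)" by (intro suminf_cong) simp
      finally show "matrix_exp (t *\<^sub>R M) $ i $ j = \<dots>" .
    qed
    show ?thesis unfolding eq
      by (rule isCont_powser_converges_everywhere)
        (use summable_norm_cancel[OF summable_matrix_exp_entry[of _ M i j]] in \<open>simp add: field_simps\<close>)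
  qed
  then have "continuous_on UNIV (\<lambda>t. \<chi> i j. matrix_exp (t *\<^sub>R M) $ i $ j)"
    by (intro continuous_on_vec_lambda continuous_at_imp_continuous_on) auto
  then show ?thesis by (simp add: vec_nth_inverse)
qed

text \<open>Without its constant term the series has a factor \<open>r\<close>; with
  \<open>a\<close> the operator norm, what remains is dominated by the series of
  \<open>a * exp (a * T)\<close>, since \<open>fact k \<le> fact (Suc k)\<close>.\<close>

lemma matrix_exp_lipschitz_0:
  fixes M :: "real^'d^'d"
  assumes "0 \<le> r" "r \<le> T"
  shows "\<bar>(matrix_exp (r *\<^sub>R M) - mat 1) $ i $ j\<bar> \<le> r * (onorm ((*v) M) * exp (onorm ((*v) M) * T))"
proof -
  define a where "a = onorm ((*v) M)"
  have a: "0 \<le> a" unfolding a_def by (intro onorm_pos_le matrix_vector_mul_bounded_linear)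
  let ?f = "\<lambda>k. r ^ k / fact k * matrix_pow M k $ i $ j"
  have "?f sums (matrix_exp (r *\<^sub>R M) $ i $ j)" by (rule matrix_exp_entry_sums)
  then have "(\<lambda>k. ?f (Suc k)) sums (matrix_exp (r *\<^sub>R M) $ i $ j - ?f 0)"
    by (subst sums_Suc_iff) simp
  then have f: "(\<lambda>k. ?f (Suc k)) sums ((matrix_exp (r *\<^sub>R M) - mat 1) $ i $ j)" by simp
  let ?g = "\<lambda>k. r * (a * (inverse (fact k) * (a * T) ^ k))"
  have g: "?g sums (r * (a * exp (a * T)))"
    using exp_converges[of "a * T"] by (intro sums_mult) simp
  have le: "\<bar>?f (Suc k)\<bar> \<le> ?g k" for k
  proof -
    have "\<bar>?f (Suc k)\<bar> = r ^ Suc k / fact (Suc k) * \<bar>matrix_pow M (Suc k) $ i $ j\<bar>"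
      using assms by (simp only: abs_mult) simp
    also have "\<dots> \<le> r ^ Suc k / fact k * a ^ Suc k"
      unfolding a_def using assms
      by (intro mult_mono divide_left_mono matrix_pow_entry_le fact_mono zero_le_divide_iff[THEN iffD2] disjI1 conjI)
        (auto simp: zero_le_mult_iff)
    also have "\<dots> = r * (a * (inverse (fact k) * (a * r) ^ k))"
      by (simp add: power_mult_distrib divide_inverse ac_simps)
    also have "\<dots> \<le> ?g k" using assms a by (intro mult_left_mono power_mono) auto
    finally show ?thesis .
  qed
  have sg: "summable (\<lambda>k. \<bar>?f (Suc k)\<bar>)"
    by (rule summable_comparison_test[OF _ sums_summable[OF g]]) (use le in auto)
  have "\<bar>\<Sum>k. ?f (Suc k)\<bar> \<le> (\<Sum>k. \<bar>?f (Suc k)\<bar>)" by (rule summable_rabs[OF sg])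
  also have "\<dots> \<le> (\<Sum>k. ?g k)" by (rule suminf_le[OF le sg sums_summable[OF g]])
  finally show ?thesis using sums_unique[OF f] sums_unique[OF g] by (simp add: a_def)
qed

section \<open>Continuous versions from dyadic values\<close>

text \<open>One factor of the dimension comes from the Cauchy-Schwarz inequality for the sum over
  \<open>j\<close>, two from the number of entries.\<close>

lemma L2_dist_sq_row_sums_le:
  fixes X Y :: "'d::finite \<Rightarrow> 'd \<Rightarrow> 'w \<Rightarrow> real"
  assumes [measurable]: "\<And>i j. X i j \<in> borel_measurable M" "\<And>i j. Y i j \<in> borel_measurable M"
    and le: "\<And>i j. L2_dist_sq M (X i j) (Y i j) \<le> ennreal B" and B: "0 \<le> B"
  shows "L2_dist_sq M (\<lambda>\<omega>. \<chi> i. \<Sum>j\<in>UNIV. X i j \<omega>) (\<lambda>\<omega>. \<chi> i. \<Sum>j\<in>UNIV. Y i j \<omega>)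
    \<le> ennreal (real CARD('d) ^ 3 * B)"
proof -
  have pt: "(norm ((\<chi> i. \<Sum>j\<in>UNIV. X i j \<omega>) - (\<chi> i. \<Sum>j\<in>UNIV. Y i j \<omega>)))\<^sup>2
      \<le> real CARD('d) * (\<Sum>i\<in>UNIV. \<Sum>j\<in>UNIV. (X i j \<omega> - Y i j \<omega>)\<^sup>2)" for \<omega>
  proof -
    have "(norm ((\<chi> i. \<Sum>j\<in>UNIV. X i j \<omega>) - (\<chi> i. \<Sum>j\<in>UNIV. Y i j \<omega>)))\<^sup>2
        = (\<Sum>i\<in>UNIV. (\<Sum>j\<in>UNIV. X i j \<omega> - Y i j \<omega>)\<^sup>2)"
      unfolding power2_norm_eq_inner inner_vec_def by (simp add: power2_eq_square sum_subtractf)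
    also have "\<dots> \<le> (\<Sum>i\<in>UNIV. (\<Sum>j\<in>UNIV. (X i j \<omega> - Y i j \<omega>)\<^sup>2) * real CARD('d))"
      by (intro sum_mono sum_squared_le_sum_of_squares)
    finally show ?thesis by (simp add: sum_distrib_left mult.commute)
  qed
  have "L2_dist_sq M (\<lambda>\<omega>. \<chi> i. \<Sum>j\<in>UNIV. X i j \<omega>) (\<lambda>\<omega>. \<chi> i. \<Sum>j\<in>UNIV. Y i j \<omega>)
     \<le> (\<integral>\<^sup>+\<omega>. ennreal (real CARD('d)) * (\<Sum>i\<in>UNIV. \<Sum>j\<in>UNIV. ennreal ((X i j \<omega> - Y i j \<omega>)\<^sup>2)) \<partial>M)"
    unfolding L2_dist_sq_def using pt
    by (intro nn_integral_mono) (simp add: sum_ennreal sum_nonneg ennreal_mult[symmetric] ennreal_leI)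
  also have "\<dots> = ennreal (real CARD('d)) * (\<Sum>i\<in>UNIV. \<Sum>j\<in>UNIV. L2_dist_sq M (X i j) (Y i j))"
    unfolding L2_dist_sq_def by (simp add: nn_integral_cmult nn_integral_sum del: sum_ennreal)
  also have "\<dots> \<le> ennreal (real CARD('d)) * (\<Sum>i\<in>(UNIV::'d set). \<Sum>j\<in>(UNIV::'d set). ennreal B)"
    by (intro mult_left_mono sum_mono le) auto
  also have "\<dots> = ennreal (real CARD('d) ^ 3 * B)"
    using B by (simp add: ennreal_of_nat_eq_real_of_nat ennreal_mult[symmetric] power3_eq_cube mult.assoc del: sum_ennreal)
  finally show ?thesis .
qed

text \<open>The left end of the cell of \<open>s\<close> on the grid of step
  \<open>\<tau> / 2 ^ n\<close>. Taking the period as unit makes every grid invariant under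
  translation by \<open>\<tau>\<close>.\<close>

definition dyadic_grid :: "real \<Rightarrow> nat \<Rightarrow> real \<Rightarrow> real" where
  "dyadic_grid \<tau> n s = of_int \<lfloor>2 ^ n * s / \<tau>\<rfloor> * (\<tau> / 2 ^ n)"

text \<open>The Euclidean norm of the increments over a window of \<open>N\<close> periods on each
  side of 0. It dominates each single increment, and the expectation of its square is computed term
  by term.\<close>

definition dyadic_osc :: "real \<Rightarrow> nat \<Rightarrow> nat \<Rightarrow> (real \<Rightarrow> 'b::real_normed_vector) \<Rightarrow> real" where
  "dyadic_osc \<tau> N n z = sqrt (\<Sum>i\<in>{- int (N * 2 ^ n)..int (N * 2 ^ n)}.
     (norm (z (of_int (i + 1) * (\<tau> / 2 ^ n)) - z (of_int i * (\<tau> / 2 ^ n))))\<^sup>2)"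

text \<open>Summability of the dyadic oscillations is what makes the step functions on the dyadic grids
  converge locally uniformly, so \<open>dyadic_ext\<close> is then continuous.\<close>

definition dyadic_regular :: "real \<Rightarrow> (real \<Rightarrow> 'b::real_normed_vector) \<Rightarrow> bool" where
  "dyadic_regular \<tau> z \<longleftrightarrow> (\<forall>N. (\<Sum>n. ennreal (dyadic_osc \<tau> N n z)) < \<infinity>)"

definition dyadic_ext :: "real \<Rightarrow> (real \<Rightarrow> 'b::real_normed_vector) \<Rightarrow> real \<Rightarrow> 'b" where
  "dyadic_ext \<tau> z s = lim (\<lambda>n. z (dyadic_grid \<tau> n s))"

lemma dyadic_grid_bounds:
  assumes "0 < \<tau>"
  shows "dyadic_grid \<tau> n s \<le> s" "s - dyadic_grid \<tau> n s \<le> \<tau> / 2 ^ n"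
proof -
  have h: "0 < \<tau> / 2 ^ n" "2 ^ n * s / \<tau> * (\<tau> / 2 ^ n) = s" using assms by auto
  have "dyadic_grid \<tau> n s \<le> 2 ^ n * s / \<tau> * (\<tau> / 2 ^ n)"
    unfolding dyadic_grid_def using h(1) by (intro mult_right_mono) auto
  then show "dyadic_grid \<tau> n s \<le> s" unfolding h(2) .
  have "2 ^ n * s / \<tau> * (\<tau> / 2 ^ n) \<le> (of_int \<lfloor>2 ^ n * s / \<tau>\<rfloor> + 1) * (\<tau> / 2 ^ n)"
    using h(1) by (intro mult_right_mono) linarith+
  then show "s - dyadic_grid \<tau> n s \<le> \<tau> / 2 ^ n"
    unfolding h(2) dyadic_grid_def by (simp only: distrib_right)
qed

lemma dyadic_grid_tendsto:
  assumes "0 < \<tau>"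
  shows "(\<lambda>n. dyadic_grid \<tau> n s) \<longlonglongrightarrow> s"
proof (rule LIM_zero_cancel, rule Lim_null_comparison)
  show "\<forall>\<^sub>F n in sequentially. norm (dyadic_grid \<tau> n s - s) \<le> \<tau> * (1/2) ^ n"
  proof (intro always_eventually allI)
    fix n
    have "\<bar>dyadic_grid \<tau> n s - s\<bar> \<le> \<tau> / 2 ^ n"
      using dyadic_grid_bounds[OF assms, where s=s and n=n] by linarith
    then show "norm (dyadic_grid \<tau> n s - s) \<le> \<tau> * (1/2) ^ n" by (simp add: power_divide)
  qed
  have "(\<lambda>n. \<tau> * (1/2) ^ n) \<longlonglongrightarrow> \<tau> * 0" by (intro tendsto_intros LIMSEQ_power_zero) auto
  then show "(\<lambda>n. \<tau> * (1/2) ^ n) \<longlonglongrightarrow> 0" by simp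
qed

lemma dyadic_osc_nonneg: "0 \<le> dyadic_osc \<tau> N n z"
  by (simp add: dyadic_osc_def sum_nonneg)

lemma norm_le_dyadic_osc:
  assumes "i \<in> {- int (N * 2 ^ n)..int (N * 2 ^ n)}"
  shows "norm (z (of_int (i + 1) * (\<tau> / 2 ^ n)) - z (of_int i * (\<tau> / 2 ^ n))) \<le> dyadic_osc \<tau> N n z"
  unfolding dyadic_osc_def
  using assms by (intro real_le_rsqrt member_le_sum[where f="\<lambda>i. (norm (z (of_int (i + 1) * (\<tau> / 2 ^ n)) - z (of_int i * (\<tau> / 2 ^ n))))\<^sup>2"]) auto

lemma dyadic_osc_summable: "dyadic_regular \<tau> z \<Longrightarrow> summable (\<lambda>n. dyadic_osc \<tau> N n z)"
  unfolding dyadic_regular_def using dyadic_osc_nonneg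
  by (intro summable_suminf_not_top) (auto simp: top.not_eq_extremum)

lemma floor_dyadic_range:
  assumes "0 < \<tau>" "\<bar>s\<bar> \<le> real N * \<tau>"
  shows "\<lfloor>2 ^ n * s / \<tau>\<rfloor> \<in> {- int (N * 2 ^ n)..int (N * 2 ^ n)}"
proof -
  have "\<bar>2 ^ n * s / \<tau>\<bar> = 2 ^ n * (\<bar>s\<bar> / \<tau>)" using assms by (simp add: abs_mult)
  also have "\<dots> \<le> 2 ^ n * real N" using assms by (intro mult_left_mono) (auto simp: field_simps)
  finally have "\<bar>2 ^ n * s / \<tau>\<bar> \<le> real_of_int (int (N * 2 ^ n))" by (simp add: mult.commute)
  then have "2 ^ n * s / \<tau> \<le> real_of_int (int (N * 2 ^ n))" "- (2 ^ n * s / \<tau>) \<le> real_of_int (int (N * 2 ^ n))"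
    by (simp_all only: abs_le_iff)
  then show ?thesis unfolding atLeastAtMost_iff by linarith
qed

text \<open>The finer grid point is the coarser one or its right neighbour on the finer grid, so one
  increment of level \<open>Suc n\<close> accounts for the change.\<close>

lemma dyadic_grid_refine:
  assumes "0 < \<tau>" "\<bar>s\<bar> \<le> real N * \<tau>"
  shows "norm (z (dyadic_grid \<tau> (Suc n) s) - z (dyadic_grid \<tau> n s)) \<le> dyadic_osc \<tau> N (Suc n) z"
proof -
  define y where "y = 2 ^ n * s / \<tau>"
  have g: "dyadic_grid \<tau> n s = of_int (2 * \<lfloor>y\<rfloor>) * (\<tau> / 2 ^ Suc n)"
    "dyadic_grid \<tau> (Suc n) s = of_int \<lfloor>2 * y\<rfloor> * (\<tau> / 2 ^ Suc n)"
    unfolding dyadic_grid_def y_def by (simp_all add: mult.assoc)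
  have "\<lfloor>y\<rfloor> \<in> {- int (N * 2 ^ n)..int (N * 2 ^ n)}" unfolding y_def by (rule floor_dyadic_range[OF assms])
  then have "2 * \<lfloor>y\<rfloor> \<in> {- int (N * 2 ^ Suc n)..int (N * 2 ^ Suc n)}"
  proof -
    have "int (N * 2 ^ Suc n) = 2 * int (N * 2 ^ n)" by simp
    then show ?thesis using \<open>\<lfloor>y\<rfloor> \<in> _\<close> unfolding atLeastAtMost_iff by linarith
  qed
  note osc = norm_le_dyadic_osc[OF this, of z \<tau>]
  have "\<lfloor>2 * y\<rfloor> = 2 * \<lfloor>y\<rfloor> \<or> \<lfloor>2 * y\<rfloor> = 2 * \<lfloor>y\<rfloor> + 1" by linarith
  then show ?thesis
  proof
    assume "\<lfloor>2 * y\<rfloor> = 2 * \<lfloor>y\<rfloor>"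
    show ?thesis unfolding g \<open>\<lfloor>2 * y\<rfloor> = 2 * \<lfloor>y\<rfloor>\<close> by (simp only: diff_self norm_zero dyadic_osc_nonneg)
  next
    assume "\<lfloor>2 * y\<rfloor> = 2 * \<lfloor>y\<rfloor> + 1"
    show ?thesis unfolding g \<open>\<lfloor>2 * y\<rfloor> = 2 * \<lfloor>y\<rfloor> + 1\<close> by (rule osc)
  qed
qed

lemma dyadic_ext_approx:
  fixes z :: "real \<Rightarrow> 'b::banach"
  assumes \<tau>: "0 < \<tau>" and reg: "dyadic_regular \<tau> z" and s: "\<bar>s\<bar> \<le> real N * \<tau>"
  shows "(\<lambda>n. z (dyadic_grid \<tau> n s)) \<longlonglongrightarrow> dyadic_ext \<tau> z s"
    and "norm (dyadic_ext \<tau> z s - z (dyadic_grid \<tau> n s)) \<le> (\<Sum>k. dyadic_osc \<tau> N (Suc (k + n)) z)"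
proof -
  let ?x = "\<lambda>k. z (dyadic_grid \<tau> (k + n) s)"
  have sum: "summable (\<lambda>k. dyadic_osc \<tau> N (Suc (k + n)) z)" for n
    using summable_ignore_initial_segment[OF dyadic_osc_summable[OF reg, of N], of "Suc n"] by simp
  have d: "norm (z (dyadic_grid \<tau> (Suc k + n) s) - z (dyadic_grid \<tau> (k + n) s)) \<le> dyadic_osc \<tau> N (Suc (k + n)) z" for k n
    using dyadic_grid_refine[OF \<tau> s, of z "k + n"] by simp
  have sd: "summable (\<lambda>k. norm (z (dyadic_grid \<tau> (Suc k + n) s) - z (dyadic_grid \<tau> (k + n) s)))" for n
    by (rule summable_comparison_test[OF _ sum[of n]]) (use d in auto)
  have conv: "(\<lambda>n. z (dyadic_grid \<tau> n s)) \<longlonglongrightarrow> dyadic_ext \<tau> z s"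
    unfolding dyadic_ext_def using sd[of 0] by (intro convergent_of_summable_diff) simp
  then show "(\<lambda>n. z (dyadic_grid \<tau> n s)) \<longlonglongrightarrow> dyadic_ext \<tau> z s" .
  have "?x \<longlonglongrightarrow> dyadic_ext \<tau> z s" using conv by (rule LIMSEQ_ignore_initial_segment)
  then have "(\<lambda>k. ?x (Suc k) - ?x k) sums (dyadic_ext \<tau> z s - ?x 0)" by (rule telescope_sums)
  then have "dyadic_ext \<tau> z s - ?x 0 = (\<Sum>k. ?x (Suc k) - ?x k)" by (rule sums_unique)
  also have "norm \<dots> \<le> (\<Sum>k. norm (?x (Suc k) - ?x k))" using sd[of n] by (intro summable_norm) simp
  also have "\<dots> \<le> (\<Sum>k. dyadic_osc \<tau> N (Suc (k + n)) z)" using d sd[of n] sum by (intro suminf_le) auto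
  finally show "norm (dyadic_ext \<tau> z s - z (dyadic_grid \<tau> n s)) \<le> (\<Sum>k. dyadic_osc \<tau> N (Suc (k + n)) z)" by simp
qed

text \<open>Two points closer than the cell length lie in equal or adjacent cells of level
  \<open>n\<close>, so their values differ by at most two approximation tails and one oscillation of
  that level.\<close>

lemma dyadic_ext_continuous:
  fixes z :: "real \<Rightarrow> 'b::banach"
  assumes \<tau>: "0 < \<tau>" and reg: "dyadic_regular \<tau> z"
  shows "continuous_on UNIV (dyadic_ext \<tau> z)"
proof -
  have "continuous (at x) (dyadic_ext \<tau> z)" for x
  proof -
    \<comment> \<open>The extra 1 keeps all points within distance 1 of \<open>x\<close> inside the
      window.\<close>
    obtain N :: nat where "(\<bar>x\<bar> + 1) / \<tau> \<le> real N" using real_arch_simple by blast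
    then have N: "\<bar>x\<bar> + 1 \<le> real N * \<tau>" using \<tau> by (simp add: pos_divide_le_eq)
    define T where "T n = (\<Sum>k. dyadic_osc \<tau> N (Suc (k + n)) z)" for n
    note so = dyadic_osc_summable[OF reg, of N]
    have "(\<lambda>n. \<Sum>k. dyadic_osc \<tau> N (k + Suc n) z) \<longlonglongrightarrow> 0"
      using suminf_exist_split2[OF so] by (rule LIMSEQ_Suc)
    then have T0: "T \<longlonglongrightarrow> 0" unfolding T_def by simp
    have "(\<lambda>n. 2 * T n + dyadic_osc \<tau> N n z) \<longlonglongrightarrow> 2 * 0 + 0"
      by (intro tendsto_intros T0 summable_LIMSEQ_zero[OF so])
    then have lim: "(\<lambda>n. 2 * T n + dyadic_osc \<tau> N n z) \<longlonglongrightarrow> 0" by simp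
    show ?thesis unfolding continuous_at_eps_delta
    proof (intro allI impI)
      fix e :: real assume "0 < e"
      then have "\<forall>\<^sub>F n in sequentially. 2 * T n + dyadic_osc \<tau> N n z < e" using lim by (intro order_tendstoD)
      then obtain n where n: "2 * T n + dyadic_osc \<tau> N n z < e" by (auto simp: eventually_sequentially)
      have "dist (dyadic_ext \<tau> z y) (dyadic_ext \<tau> z x) < e" if y: "dist y x < min 1 (\<tau> / 2 ^ n)" for y
      proof -
        have xy: "\<bar>x\<bar> \<le> real N * \<tau>" "\<bar>y\<bar> \<le> real N * \<tau>" using y N by (auto simp: dist_real_def)
        let ?i = "\<lfloor>2 ^ n * x / \<tau>\<rfloor>" and ?j = "\<lfloor>2 ^ n * y / \<tau>\<rfloor>"
        have "\<bar>2 ^ n * x / \<tau> - 2 ^ n * y / \<tau>\<bar> = \<bar>x - y\<bar> * (2 ^ n / \<tau>)"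
        proof -
          have "2 ^ n * x / \<tau> - 2 ^ n * y / \<tau> = (x - y) * (2 ^ n / \<tau>)"
            by (simp add: diff_divide_distrib algebra_simps)
          then show ?thesis using \<tau> by (simp only: abs_mult) simp
        qed
        also have "\<dots> < 1" using y \<tau> by (simp add: dist_real_def abs_minus_commute field_simps)
        finally have ij: "?j = ?i \<or> ?j = ?i + 1 \<or> ?i = ?j + 1" by linarith
        have "norm (z (dyadic_grid \<tau> n y) - z (dyadic_grid \<tau> n x)) \<le> dyadic_osc \<tau> N n z"
          using ij norm_le_dyadic_osc[OF floor_dyadic_range[OF \<tau> xy(1)], where z=z and n=n and \<tau>=\<tau>]
            norm_le_dyadic_osc[OF floor_dyadic_range[OF \<tau> xy(2)], where z=z and n=n and \<tau>=\<tau>] dyadic_osc_nonneg[of \<tau> N n z]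
          unfolding dyadic_grid_def by (auto simp: norm_minus_commute)
        moreover have "norm (dyadic_ext \<tau> z x - z (dyadic_grid \<tau> n x)) \<le> T n"
          "norm (dyadic_ext \<tau> z y - z (dyadic_grid \<tau> n y)) \<le> T n"
          using dyadic_ext_approx(2)[OF \<tau> reg] xy by (auto simp: T_def)
        moreover have "dyadic_ext \<tau> z y - dyadic_ext \<tau> z x = (dyadic_ext \<tau> z y - z (dyadic_grid \<tau> n y))
            + (z (dyadic_grid \<tau> n y) - z (dyadic_grid \<tau> n x)) - (dyadic_ext \<tau> z x - z (dyadic_grid \<tau> n x))" by simp
        ultimately have "norm (dyadic_ext \<tau> z y - dyadic_ext \<tau> z x) \<le> 2 * T n + dyadic_osc \<tau> N n z"
          by (smt (verit) norm_triangle_ineq norm_triangle_ineq4)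
        with n show ?thesis by (simp add: dist_norm)
      qed
      moreover have "0 < min 1 (\<tau> / 2 ^ n)" using \<tau> by simp
      ultimately show "\<exists>d>0. \<forall>y. dist y x < d \<longrightarrow> dist (dyadic_ext \<tau> z y) (dyadic_ext \<tau> z x) < e" by blast
    qed
  qed
  then show ?thesis by (intro continuous_at_imp_continuous_on) auto
qed

text \<open>Translation by a period moves the index on level \<open>n\<close> by
  \<open>2 ^ n\<close>, which the window \<open>Suc N\<close> absorbs. Both signs of
  \<open>c\<close> are allowed so that regularity becomes equivalent for a function and its
  translate.\<close>

lemma dyadic_regular_shift:
  assumes \<tau>: "0 < \<tau>" and c: "c = 1 \<or> c = (-1::int)" and reg: "dyadic_regular \<tau> z"
    and z': "\<And>s. z' s = z (s + of_int c * \<tau>)"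
  shows "dyadic_regular \<tau> z'"
  unfolding dyadic_regular_def
proof
  fix N
  have "dyadic_osc \<tau> N n z' \<le> dyadic_osc \<tau> (Suc N) n z" for n
  proof -
    let ?f = "\<lambda>i::int. (norm (z (of_int (i + 1) * (\<tau> / 2 ^ n)) - z (of_int i * (\<tau> / 2 ^ n))))\<^sup>2"
    have sh: "of_int i * (\<tau> / 2 ^ n) + of_int c * \<tau> = of_int (i + c * 2 ^ n) * (\<tau> / 2 ^ n)" for i
      by (simp add: field_simps)
    have "(\<Sum>i\<in>{- int (N * 2 ^ n)..int (N * 2 ^ n)}.
        (norm (z' (of_int (i + 1) * (\<tau> / 2 ^ n)) - z' (of_int i * (\<tau> / 2 ^ n))))\<^sup>2)
      = (\<Sum>i\<in>{- int (N * 2 ^ n)..int (N * 2 ^ n)}. ?f (i + c * 2 ^ n))"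
      unfolding z' sh by (simp only: ac_simps)
    also have "\<dots> = (\<Sum>i\<in>(\<lambda>i. i + c * 2 ^ n) ` {- int (N * 2 ^ n)..int (N * 2 ^ n)}. ?f i)"
      by (subst sum.reindex) (auto simp: inj_on_def)
    also have "\<dots> \<le> (\<Sum>i\<in>{- int (Suc N * 2 ^ n)..int (Suc N * 2 ^ n)}. ?f i)"
      using c by (intro sum_mono2) auto
    finally show ?thesis unfolding dyadic_osc_def by (rule real_sqrt_le_mono)
  qed
  then have "(\<Sum>n. ennreal (dyadic_osc \<tau> N n z')) \<le> (\<Sum>n. ennreal (dyadic_osc \<tau> (Suc N) n z))"
    by (intro suminf_le ennreal_leI) auto
  also have "\<dots> < \<infinity>" using reg by (simp add: dyadic_regular_def)
  finally show "(\<Sum>n. ennreal (dyadic_osc \<tau> N n z')) < \<infinity>" .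
qed

lemma dyadic_regular_shift_iff:
  assumes "0 < \<tau>" "\<And>s. z' (s + \<tau>) = z s"
  shows "dyadic_regular \<tau> z' \<longleftrightarrow> dyadic_regular \<tau> z"
  using dyadic_regular_shift[of \<tau> 1 z' z] dyadic_regular_shift[of \<tau> "-1" z z'] assms assms(2)[of "_ - \<tau>"]
  by auto

lemma dyadic_ext_shift:
  assumes "0 < \<tau>" "\<And>s. z' (s + \<tau>) = z s"
  shows "dyadic_ext \<tau> z' (s + \<tau>) = dyadic_ext \<tau> z s"
proof -
  have "dyadic_grid \<tau> n (s + \<tau>) = dyadic_grid \<tau> n s + \<tau>" for n
  proof -
    have "2 ^ n * (s + \<tau>) / \<tau> = 2 ^ n * s / \<tau> + of_int (2 ^ n)" using assms(1) by (simp add: field_simps)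
    then have "\<lfloor>2 ^ n * (s + \<tau>) / \<tau>\<rfloor> = \<lfloor>2 ^ n * s / \<tau>\<rfloor> + 2 ^ n" by (simp only: floor_add_int)
    then show ?thesis unfolding dyadic_grid_def by (simp add: field_simps)
  qed
  then show ?thesis by (simp add: dyadic_ext_def assms(2))
qed

lemma measurable_swap_lborel:
  assumes F: "(\<lambda>p. F (fst p) (snd p)) \<in> borel_measurable (borel \<Otimes>\<^sub>M M)"
  shows "(\<lambda>p. F (snd p) (fst p)) \<in> borel_measurable (M \<Otimes>\<^sub>M lborel)"
proof -
  have "(\<lambda>p. F (fst (snd p, fst p)) (snd (snd p, fst p))) \<in> borel_measurable (M \<Otimes>\<^sub>M borel)"
    by (rule measurable_compose[OF _ F]) measurable
  then show ?thesis by simp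
qed

text \<open>On level \<open>n\<close> the grid has countably many points, so the process sampled
  there is jointly measurable; path continuity passes this on to the limit.\<close>

lemma continuous_process_jointly_measurable:
  fixes X :: "real \<Rightarrow> 'w \<Rightarrow> 'b::{real_normed_vector, second_countable_topology}"
  assumes X: "continuous_process M X"
  shows "(\<lambda>p. X (fst p) (snd p)) \<in> borel_measurable (borel \<Otimes>\<^sub>M M)"
proof (rule borel_measurable_LIMSEQ_metric)
  have [measurable]: "X t \<in> borel_measurable M" for t using X by (simp add: continuous_process_def)
  fix n
  have "(\<lambda>p. X (of_int i * (1 / 2 ^ n)) (snd p)) \<in> borel_measurable (borel \<Otimes>\<^sub>M M)" for i :: int by measurable
  moreover have "(\<lambda>p. \<lfloor>(2::real) ^ n * fst p / 1\<rfloor>) \<in> borel \<Otimes>\<^sub>M M \<rightarrow>\<^sub>M count_space UNIV" by measurable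
  ultimately show "(\<lambda>p. X (dyadic_grid 1 n (fst p)) (snd p)) \<in> borel_measurable (borel \<Otimes>\<^sub>M M)"
    unfolding dyadic_grid_def by (rule measurable_compose_countable)
next
  fix p :: "real \<times> 'w" assume "p \<in> space (borel \<Otimes>\<^sub>M M)"
  then have "isCont (\<lambda>t. X t (snd p)) (fst p)"
    using X by (auto simp: continuous_process_def space_pair_measure continuous_on_eq_continuous_at)
  then show "(\<lambda>n. X (dyadic_grid 1 n (fst p)) (snd p)) \<longlonglongrightarrow> X (fst p) (snd p)"
    by (rule isCont_tendsto_compose) (rule dyadic_grid_tendsto, simp)
qed

section \<open>The stochastic convolution\<close>

lemma borel_measurable_vec:
  fixes f :: "'w \<Rightarrow> real^'d"
  assumes "\<And>i. (\<lambda>\<omega>. f \<omega> $ i) \<in> borel_measurable M"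
  shows "f \<in> borel_measurable M"
proof (rule borel_measurable_euclidean_space[THEN iffD2], intro ballI)
  fix b :: "real^'d" assume "b \<in> Basis"
  then obtain i where "b = axis i 1" by (auto simp: Basis_vec_def)
  then show "(\<lambda>\<omega>. f \<omega> \<bullet> b) \<in> borel_measurable M" using assms[of i] by (simp add: inner_axis)
qed

lemma norm_matrix_entry_le: "\<bar>M $ i $ j\<bar> \<le> norm (M :: real^'n^'m)"
  using component_le_norm_cart[of "M $ i" j] Finite_Cartesian_Product.norm_nth_le[of M i] by simp

lemma matrix_diff_mult: "(X - Y) ** W = X ** W - Y ** (W :: real^'k^'n)"
  by (simp add: vec_eq_iff matrix_matrix_mult_def left_diff_distrib sum_subtractf)

lemma abs_H_indicator:
  assumes h: "h \<in> abs_H H" and B: "B \<in> sets borel"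
  shows "(\<lambda>u. indicator B u * h u) \<in> abs_H H"
proof -
  have [measurable]: "h \<in> borel_measurable borel" using h by (simp add: abs_H_def)
  have "ennreal (H * (2 * H - 1)) * (\<integral>\<^sup>+t. (\<integral>\<^sup>+s. ennreal (\<bar>t - s\<bar> powr (2 * H - 2) * \<bar>indicator B s * h s\<bar> * \<bar>indicator B t * h t\<bar>) \<partial>lborel) \<partial>lborel)
      \<le> ennreal (H * (2 * H - 1)) * (\<integral>\<^sup>+t. (\<integral>\<^sup>+s. ennreal (\<bar>t - s\<bar> powr (2 * H - 2) * \<bar>h s\<bar> * \<bar>h t\<bar>) \<partial>lborel) \<partial>lborel)"
    by (intro mult_left_mono nn_integral_mono ennreal_leI mult_mono) (auto simp: indicator_def)
  also have "\<dots> < \<infinity>" using h by (simp add: abs_H_def)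
  finally show ?thesis using B by (simp add: abs_H_def)
qed

locale ou_setting =
  fixes H cS mS \<tau> :: real and A :: "real^'d^'d" and S \<sigma> :: "real \<Rightarrow> real^'d^'d"
    and P :: "(real \<Rightarrow> real^'d) measure"
  assumes H: "1/2 < H" "H < 1"
    and S: "\<And>t. S t = matrix_exp (t *\<^sub>R A)"
    and sigma_cont: "continuous_on UNIV \<sigma>"
    and P: "canonical_fbm_law H P"
    and S_pos: "cS > 0" "mS > 0"
    and S_bound: "\<And>t. onorm ((*v) (S t)) \<le> cS * exp (- mS * t)"
    and S_sigma: "\<And>t. (\<lambda>s. indicator {..t} s *\<^sub>R (S (t - s) ** \<sigma> s)) \<in> abs_H_mat H"
    and tau_pos: "\<tau> > 0"
    and sigma_periodic: "\<And>t. \<sigma> (t + \<tau>) = \<sigma> t"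
begin

lemma space_P: "space P = path_space"
proof -
  have "sets P = sets path_borel" using P by (simp add: canonical_fbm_law_def)
  then have "space P = space path_borel" by (rule sets_eq_imp_space_eq)
  also have "\<dots> = path_space"
    unfolding path_borel_def by (rule space_measure_of) (auto simp: openin_path_topology)
  finally show ?thesis .
qed

lemma fbm_component: "fbm_cov P H (\<lambda>t \<omega>. \<omega> t $ j)"
proof -
  have sc: "fbm_scalar P H (\<lambda>t \<omega>. \<omega> t $ j)" and pr: "prob_space P"
    using P by (auto simp: canonical_fbm_law_def fbm_def coordinate_process_def)
  have cov: "(LINT \<omega>|P. \<omega> s $ j * \<omega> t $ j) =
      (\<bar>s\<bar> powr (2 * H) + \<bar>t\<bar> powr (2 * H) - \<bar>t - s\<bar> powr (2 * H)) / 2" for s t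
    using sc by (auto simp: fbm_scalar_def)
  have m: "(\<lambda>\<omega>. \<omega> t $ j) \<in> borel_measurable P" for t
    using sc by (auto simp: fbm_scalar_def gaussian_process_def)
  have "integrable P (\<lambda>\<omega>. (\<omega> t $ j)\<^sup>2)" for t
  \<comment> \<open>A nonzero Bochner integral proves integrability, because the integral of a
    nonintegrable function is 0. At \<open>t = 0\<close> the variance vanishes, but so does every
    path.\<close>
  proof (cases "t = 0")
    case True
    then have "integrable P (\<lambda>\<omega>. (\<omega> t $ j)\<^sup>2) = integrable P (\<lambda>\<omega>. 0::real)"
      by (intro Bochner_Integration.integrable_cong) (auto simp: space_P path_space_def)
    then show ?thesis by simp
  next
    case False
    then have "(LINT \<omega>|P. (\<omega> t $ j)\<^sup>2) \<noteq> 0" using cov[of t t] by (simp add: power2_eq_square)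
    then show ?thesis using not_integrable_integral_eq by blast
  qed
  with pr m cov H show ?thesis by (simp add: fbm_cov_def fbm_cov_axioms_def)
qed

sublocale comp: fbm_cov P H "\<lambda>t \<omega>. \<omega> t $ j" for j
  by (rule fbm_component)

sublocale prob_space P
  by (rule comp.prob_space_axioms)

lemma measurable_coord[measurable]: "(\<lambda>\<omega>. \<omega> t) \<in> borel_measurable P"
  by (rule borel_measurable_vec) (rule comp.measurable_beta)

lemma sigma_shift: "\<sigma> (u + of_int k * \<tau>) = \<sigma> u"
proof -
  interpret periodic_fun_simple \<sigma> \<tau> by unfold_locales (rule sigma_periodic)
  show ?thesis by (rule plus_of_int)
qed

lemma reduce_period: "u + of_int (- \<lfloor>u / \<tau>\<rfloor>) * \<tau> \<in> {0..\<tau>}"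
proof -
  have "of_int \<lfloor>u / \<tau>\<rfloor> * \<tau> \<le> u / \<tau> * \<tau>" "u / \<tau> * \<tau> \<le> (of_int \<lfloor>u / \<tau>\<rfloor> + 1) * \<tau>"
    using tau_pos by (intro mult_right_mono; linarith)+
  then show ?thesis using tau_pos by (simp add: algebra_simps)
qed

lemma sigma_onorm_bound: "\<exists>b\<ge>0. \<forall>u. onorm ((*v) (\<sigma> u)) \<le> b"
proof -
  have "compact (\<sigma> ` {0..\<tau>})"
    using sigma_cont by (intro compact_continuous_image) (auto elim: continuous_on_subset)
  then obtain b where b: "\<And>u. u \<in> {0..\<tau>} \<Longrightarrow> norm (\<sigma> u) \<le> b"
    using compact_imp_bounded bounded_iff by (metis imageI)
  have "norm (\<sigma> u) \<le> b" for u using b[OF reduce_period[of u]] sigma_shift by metis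
  then have "onorm ((*v) (\<sigma> u)) \<le> real CARD('d) * real CARD('d) * b" for u
    using norm_matrix_entry_le order_trans by (intro onorm_le_matrix_component) blast
  then show ?thesis by (meson onorm_pos_le matrix_vector_mul_bounded_linear order_trans)
qed

definition sigma_bound :: real where "sigma_bound = (SOME b. 0 \<le> b \<and> (\<forall>u. onorm ((*v) (\<sigma> u)) \<le> b))"

lemma sigma_bound: "0 \<le> sigma_bound" "onorm ((*v) (\<sigma> u)) \<le> sigma_bound"
  using someI_ex[of "\<lambda>b. 0 \<le> b \<and> (\<forall>u. onorm ((*v) (\<sigma> u)) \<le> b)"] sigma_onorm_bound
  unfolding sigma_bound_def by blast+

section \<open>The convolution kernel: decay and moduli of continuity\<close>

definition kernel :: "real \<Rightarrow> real \<Rightarrow> real^'d^'d" where "kernel t u = S (t - u) ** \<sigma> u"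

definition kernel_const :: real where "kernel_const = cS * sigma_bound"

lemma kernel_const: "0 \<le> kernel_const" using S_pos sigma_bound by (simp add: kernel_const_def)

lemma kernel_onorm: "onorm ((*v) (kernel t u)) \<le> kernel_const * exp (- mS * (t - u))"
proof -
  have "onorm ((*v) (kernel t u)) \<le> onorm ((*v) (S (t - u))) * onorm ((*v) (\<sigma> u))"
    unfolding kernel_def by (rule onorm_matrix_mult_le)
  also have "\<dots> \<le> (cS * exp (- mS * (t - u))) * sigma_bound"
    using S_pos by (intro mult_mono S_bound sigma_bound onorm_pos_le matrix_vector_mul_bounded_linear) auto
  finally show ?thesis by (simp add: kernel_const_def ac_simps)
qed

lemma kernel_entry: "\<bar>kernel t u $ i $ j\<bar> \<le> kernel_const * exp (- mS * (t - u))"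
  using matrix_component_le_onorm kernel_onorm by (rule order_trans)

lemma kernel_entry_le: "u \<le> t \<Longrightarrow> \<bar>kernel t u $ i $ j\<bar> \<le> kernel_const"
proof -
  assume "u \<le> t"
  then have "kernel_const * exp (- mS * (t - u)) \<le> kernel_const * 1" using kernel_const S_pos by (intro mult_left_mono) auto
  then show ?thesis using kernel_entry[of t u i j] by linarith
qed

text \<open>Bounds the operator norm of \<open>S r - mat 1\<close> by a multiple of \<open>r\<close>
  for \<open>0 \<le> r \<le> \<tau>\<close>: the entrywise bound of
  \<open>matrix_exp_lipschitz_0\<close> with \<open>T = \<tau>\<close>, times the number of
  entries.\<close>

definition lipschitz_const :: real where
  "lipschitz_const = real CARD('d) * real CARD('d) * (onorm ((*v) A) * exp (onorm ((*v) A) * \<tau>))"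

lemma lipschitz_const: "0 \<le> lipschitz_const"
  unfolding lipschitz_const_def by (intro mult_nonneg_nonneg onorm_pos_le matrix_vector_mul_bounded_linear) auto

lemma S_add: "S (t + s) = S t ** S s"
  unfolding S by (rule matrix_exp_add)

text \<open>By the semigroup law \<open>kernel t u = S (t - s) ** kernel s u\<close>, so moving the
  time costs a factor \<open>S (t - s) - mat 1\<close>, which is of order
  \<open>t - s\<close>.\<close>

lemma kernel_increment:
  assumes "s \<le> t" "t - s \<le> \<tau>"
  shows "\<bar>kernel t u $ i $ j - kernel s u $ i $ j\<bar> \<le> lipschitz_const * kernel_const * (t - s) * exp (- mS * (s - u))"
proof -
  have "kernel t u = S (t - s) ** kernel s u"
    using S_add[of "t - s" "s - u"] by (simp add: kernel_def matrix_mul_assoc)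
  then have "kernel t u $ i $ j - kernel s u $ i $ j = ((S (t - s) - mat 1) ** kernel s u) $ i $ j"
    by (simp add: matrix_diff_mult)
  also have "\<bar>\<dots>\<bar> \<le> onorm ((*v) ((S (t - s) - mat 1) ** kernel s u))"
    by (rule matrix_component_le_onorm)
  also have "\<dots> \<le> onorm ((*v) (S (t - s) - mat 1)) * onorm ((*v) (kernel s u))"
    by (rule onorm_matrix_mult_le)
  also have "\<dots> \<le> (lipschitz_const * (t - s)) * (kernel_const * exp (- mS * (s - u)))"
  proof (intro mult_mono kernel_onorm)
    have "onorm ((*v) (S (t - s) - mat 1))
        \<le> real CARD('d) * real CARD('d) * ((t - s) * (onorm ((*v) A) * exp (onorm ((*v) A) * \<tau>)))"
      unfolding S using assms by (intro onorm_le_matrix_component matrix_exp_lipschitz_0) auto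
    then show "onorm ((*v) (S (t - s) - mat 1)) \<le> lipschitz_const * (t - s)" by (simp add: lipschitz_const_def ac_simps)
    show "0 \<le> lipschitz_const * (t - s)" using lipschitz_const assms by simp
  qed (intro onorm_pos_le matrix_vector_mul_bounded_linear)
  finally show ?thesis by (simp add: ac_simps)
qed

lemma continuous_on_S: "continuous_on UNIV S"
  unfolding S using continuous_on_matrix_exp .

lemma continuous_on_kernel_pair: "continuous_on UNIV (\<lambda>p. S (fst p) ** \<sigma> (snd p))"
proof -
  have "continuous_on UNIV (\<lambda>p. S (fst p))" "continuous_on UNIV (\<lambda>p. \<sigma> (snd p))"
    using continuous_on_compose2[OF continuous_on_S continuous_on_fst[OF continuous_on_id], of UNIV]
      continuous_on_compose2[OF sigma_cont continuous_on_snd[OF continuous_on_id], of UNIV] by auto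
  then show ?thesis unfolding matrix_matrix_mult_def
    by (intro continuous_on_vec_lambda continuous_on_sum continuous_on_mult continuous_on_component)
qed

lemma continuous_on_kernel: "continuous_on B (\<lambda>u. kernel t u $ i $ j)"
proof -
  have "continuous_on B (\<lambda>u. (t - u, u))" by (intro continuous_intros)
  from continuous_on_compose2[OF continuous_on_kernel_pair this]
  have "continuous_on B (\<lambda>u. kernel t u)" by (simp add: kernel_def)
  then show ?thesis by (intro continuous_on_component)
qed

text \<open>The kernel depends on the lag \<open>t - u\<close> and on \<open>u\<close> modulo the
  period, so uniform continuity on one compact set gives a \<open>\<delta>\<close> valid for all
  \<open>t\<close>. This is what permits a number of grid points independent of
  \<open>t\<close>.\<close>

lemma kernel_uniform_osc:
  assumes "0 < \<epsilon>" "0 \<le> N"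
  shows "\<exists>\<delta>>0. \<forall>t u v i j. u \<in> {t - N..t} \<longrightarrow> v \<in> {t - N..t} \<longrightarrow> \<bar>u - v\<bar> < \<delta> \<longrightarrow>
     \<bar>kernel t u $ i $ j - kernel t v $ i $ j\<bar> \<le> \<epsilon>"
proof -
  let ?f = "\<lambda>p. S (fst p) ** \<sigma> (snd p)"
  \<comment> \<open>One point is moved into \<open>{0..\<tau>}\<close> by whole periods; the other
    stays within distance \<open>\<tau>\<close> of it, whence the margin on both sides.\<close>
  let ?K = "{0..N} \<times> {- \<tau>..2 * \<tau>}"
  have "uniformly_continuous_on ?K ?f"
    using continuous_on_kernel_pair by (intro compact_uniformly_continuous compact_Times) (auto elim: continuous_on_subset)
  then obtain d where d: "0 < d" "\<And>x y. x \<in> ?K \<Longrightarrow> y \<in> ?K \<Longrightarrow> dist y x < d \<Longrightarrow> dist (?f y) (?f x) < \<epsilon>"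
    using assms unfolding uniformly_continuous_on_def by metis
  have "\<bar>kernel t u $ i $ j - kernel t v $ i $ j\<bar> \<le> \<epsilon>"
    if u: "u \<in> {t - N..t}" and v: "v \<in> {t - N..t}" and uv: "\<bar>u - v\<bar> < min \<tau> (d / 2)" for t u v i j
  proof -
    define k where "k = - \<lfloor>u / \<tau>\<rfloor>"
    define u' v' where "u' = u + of_int k * \<tau>" and "v' = v + of_int k * \<tau>"
    have u': "u' \<in> {0..\<tau>}" using reduce_period[of u] by (simp add: u'_def k_def)
    have diff: "u' - v' = u - v" by (simp add: u'_def v'_def)
    have K: "(t - u, u') \<in> ?K" "(t - v, v') \<in> ?K" using u v u' uv diff tau_pos by auto
    have "dist (t - u, u') (t - v, v') \<le> \<bar>u - v\<bar> + \<bar>u - v\<bar>"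
      unfolding dist_Pair_Pair dist_real_def diff using sqrt_sum_squares_le_sum_abs[of "u - v" "u - v"]
      by (simp add: power2_commute)
    then have "dist (?f (t - u, u')) (?f (t - v, v')) < \<epsilon>" using uv by (intro d K) linarith
    moreover have "?f (t - u, u') = kernel t u" "?f (t - v, v') = kernel t v"
      by (simp_all add: kernel_def u'_def v'_def sigma_shift)
    ultimately show ?thesis using norm_matrix_entry_le[of "kernel t u - kernel t v" i j]
      by (simp add: dist_norm)
  qed
  then show ?thesis using d tau_pos by (intro exI[of _ "min \<tau> (d / 2)"]) auto
qed

section \<open>Riemann sums on grids that move with the time\<close>

definition osc_tol :: "nat \<Rightarrow> real" where
  "osc_tol n = sqrt (exp (- (2 * mS) * real (Suc n)) / (2 * real (Suc n) powr (2 * H)))"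

text \<open>The tolerance is chosen by solving this equation: the Riemann error over an interval of
  length \<open>Suc n\<close> gets the same exponential order as the error of truncating
  there.\<close>

lemma osc_tol: "0 < osc_tol n" "2 * (osc_tol n)\<^sup>2 * real (Suc n) powr (2 * H) = exp (- (2 * mS) * real (Suc n))"
  by (auto simp: osc_tol_def divide_simps)

definition fine_enough :: "nat \<Rightarrow> nat \<Rightarrow> bool" where
  "fine_enough n k \<longleftrightarrow> 0 < k \<and> (\<exists>\<delta>. real (Suc n) / real k < \<delta> \<and>
     (\<forall>t u v i j. u \<in> {t - real (Suc n)..t} \<longrightarrow> v \<in> {t - real (Suc n)..t} \<longrightarrow> \<bar>u - v\<bar> < \<delta> \<longrightarrow>
       \<bar>kernel t u $ i $ j - kernel t v $ i $ j\<bar> \<le> osc_tol n))"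

text \<open>Chosen from \<open>n\<close> alone, without reference to time or path, which is what
  \<open>approx_shift\<close> relies on.\<close>

definition pieces :: "nat \<Rightarrow> nat" where "pieces n = (SOME k. fine_enough n k)"

lemma fine_pieces: "fine_enough n (pieces n)"
proof -
  obtain \<delta> where \<delta>: "0 < \<delta>" "\<forall>t u v i j. u \<in> {t - real (Suc n)..t} \<longrightarrow> v \<in> {t - real (Suc n)..t} \<longrightarrow> \<bar>u - v\<bar> < \<delta> \<longrightarrow>
       \<bar>kernel t u $ i $ j - kernel t v $ i $ j\<bar> \<le> osc_tol n"
    using kernel_uniform_osc[OF osc_tol(1)[of n], of "real (Suc n)"] by (metis of_nat_0_le_iff)
  obtain k :: nat where k: "real (Suc n) / \<delta> < real k" using reals_Archimedean2 by blast
  have "0 < real (Suc n) / \<delta>" using \<delta>(1) by simp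
  then have "0 < real k" using k by linarith
  then have "0 < k" "real (Suc n) / real k < \<delta>" using k \<delta>(1) by (simp_all add: field_simps)
  then have "fine_enough n k" unfolding fine_enough_def using \<delta>(2) by blast
  then show ?thesis unfolding pieces_def by (rule someI)
qed

text \<open>The grid is attached to \<open>t\<close> and covers \<open>Suc n\<close> units of the
  past; the successor keeps its length positive for \<open>n = 0\<close>.\<close>

definition grid_point :: "nat \<Rightarrow> real \<Rightarrow> nat \<Rightarrow> real" where
  "grid_point n t k = (t - real (Suc n)) + real k * (real (Suc n) / real (pieces n))"

definition approx :: "nat \<Rightarrow> real \<Rightarrow> (real \<Rightarrow> real^'d) \<Rightarrow> real^'d" where
  "approx n t \<omega> = (\<Sum>k<pieces n. kernel t (grid_point n t k) *v (\<omega> (grid_point n t (Suc k)) - \<omega> (grid_point n t k)))"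

abbreviation entry_sum :: "nat \<Rightarrow> real \<Rightarrow> 'd \<Rightarrow> 'd \<Rightarrow> (real \<Rightarrow> real^'d) \<Rightarrow> real" where
  "entry_sum n t i j \<equiv> comp.riemann j (grid_point n t) (pieces n) (\<lambda>u. kernel t u $ i $ j)"

lemma approx_entries:
  "approx n t \<omega> = (\<chi> i. \<Sum>j\<in>UNIV. entry_sum n t i j \<omega>)"
proof -
  have "approx n t \<omega> $ i = (\<Sum>j\<in>UNIV. entry_sum n t i j \<omega>)" for i
    unfolding approx_def comp.riemann_def sum_component matrix_vector_mult_def
    by (subst sum.swap) simp
  then show ?thesis by (simp add: vec_eq_iff)
qed

text \<open>This pathwise identity replaces the invariance of the law under the shift.\<close>

lemma approx_shift: "approx n (t + \<tau>) (wiener_shift (- \<tau>) \<omega>) = approx n t \<omega>"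
proof -
  have "kernel (t + \<tau>) (u + \<tau>) = kernel t u" for u by (simp add: kernel_def sigma_periodic)
  moreover have "grid_point n (t + \<tau>) k = grid_point n t k + \<tau>" for k by (simp add: grid_point_def)
  ultimately show ?thesis by (simp add: approx_def wiener_shift_def)
qed

definition tail_const :: real where "tail_const = 4 * kernel_const\<^sup>2 * exp_const mS"

lemma tail_const: "0 \<le> tail_const" using exp_const_ge[OF S_pos(2)] by (simp add: tail_const_def)

text \<open>An arbitrary version for each \<open>t\<close> separately, with no link between
  different times or paths. It serves as the target of mean square estimates.\<close>

definition lower_version :: "'d \<Rightarrow> 'd \<Rightarrow> real \<Rightarrow> (real \<Rightarrow> real^'d) \<Rightarrow> real" where
  "lower_version i j t = (SOME I. comp.lower_integral j tail_const mS (\<lambda>u. kernel t u $ i $ j) t I)"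

lemma lower_version: "comp.lower_integral j tail_const mS (\<lambda>u. kernel t u $ i $ j) t (lower_version i j t)"
proof -
  obtain I where "comp.lower_integral j tail_const mS (\<lambda>u. kernel t u $ i $ j) t I"
    by (rule comp.lower_integral_exists[OF S_pos(2) kernel_const kernel_entry continuous_on_kernel, folded tail_const_def])
  then show ?thesis unfolding lower_version_def
    by (rule someI[where P = "comp.lower_integral j tail_const mS (\<lambda>u. kernel t u $ i $ j) t"])
qed

lemma measurable_lower_version[measurable]: "lower_version i j t \<in> borel_measurable P"
  using lower_version[of j t i] by (simp add: comp.lower_integral_def)

definition conv_version :: "real \<Rightarrow> (real \<Rightarrow> real^'d) \<Rightarrow> real^'d" where
  "conv_version t \<omega> = (\<chi> i. \<Sum>j\<in>UNIV. lower_version i j t \<omega>)"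

lemma measurable_conv_version[measurable]: "conv_version t \<in> borel_measurable P"
  by (rule borel_measurable_vec) (simp add: conv_version_def)

lemma measurable_approx[measurable]: "approx n t \<in> borel_measurable P"
  unfolding approx_def[abs_def] by (rule borel_measurable_vec) (simp add: sum_component matrix_vector_mult_def)

text \<open>Riemann error over the last \<open>Suc n\<close> units of time plus truncation error of
  the lower integral, both of order \<open>exp (- (2 * mS)) ^ Suc n\<close>.\<close>

lemma lower_version_approx:
  "L2_dist_sq P (entry_sum n t i j) (lower_version i j t)
    \<le> ennreal ((2 + 2 * tail_const) * exp (- (2 * mS)) ^ Suc n)"
proof -
  define N where "N = real (Suc n)"
  have N: "0 < N" by (simp add: N_def)
  obtain \<delta> where \<delta>: "N / real (pieces n) < \<delta>" "0 < pieces n"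
    "\<And>u v. u \<in> {t - N..t} \<Longrightarrow> v \<in> {t - N..t} \<Longrightarrow> \<bar>u - v\<bar> < \<delta> \<Longrightarrow>
       \<bar>kernel t u $ i $ j - kernel t v $ i $ j\<bar> \<le> osc_tol n"
    using fine_pieces[of n] unfolding fine_enough_def N_def by blast
  have sub: "subdivision \<delta> (grid_point n t) (pieces n) (t - N) t"
    using subdivision_uniform[of "t - N" t "pieces n" \<delta>] \<delta> N unfolding grid_point_def[abs_def] N_def[symmetric] by simp
  have "t - N \<le> t" using N by simp
  then obtain J where J: "has_wiener_integral_scalar P (\<lambda>t \<omega>. \<omega> t $ j) (\<lambda>u. kernel t u $ i $ j) (t - N) t J"
    using comp.wiener_integral_exists[OF _ continuous_on_kernel] by blast
  note [measurable] = comp.wiener_integralD(3)[OF J]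
  have "0 < \<delta>" using \<delta>(1,2) N by (meson divide_pos_pos of_nat_0_less_iff less_trans)
  have "L2_dist_sq P (entry_sum n t i j) J
      \<le> ennreal (2 * (osc_tol n)\<^sup>2 * (t - (t - N)) powr (2 * H))"
    by (rule comp.riemann_wiener_integral_le[OF J sub \<open>0 < \<delta>\<close> \<delta>(3)])
  then have 1: "L2_dist_sq P (entry_sum n t i j) J
      \<le> ennreal (exp (- (2 * mS) * N))"
    using osc_tol(2)[of n] by (simp add: N_def)
  have 2: "L2_dist_sq P J (lower_version i j t) \<le> ennreal (tail_const * exp (- (2 * mS) * N))"
    using lower_version[of j t i] J unfolding comp.lower_integral_def by force
  have "L2_dist_sq P (entry_sum n t i j) (lower_version i j t)
     \<le> 2 * L2_dist_sq P (entry_sum n t i j) J + 2 * L2_dist_sq P J (lower_version i j t)"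
    by (rule L2_dist_sq_triangle) auto
  also have "\<dots> \<le> 2 * ennreal (exp (- (2 * mS) * N)) + 2 * ennreal (tail_const * exp (- (2 * mS) * N))"
    by (intro add_mono mult_left_mono 1 2) auto
  also have "\<dots> = ennreal ((2 + 2 * tail_const) * exp (- (2 * mS) * N))"
    using tail_const by (simp add: ennreal_collect distrib_right del: ennreal_numeral ennreal_plus)
  also have "exp (- (2 * mS) * N) = exp (- (2 * mS)) ^ Suc n"
    unfolding N_def by (simp only: exp_of_nat_mult[symmetric] mult.commute)
  finally show ?thesis .
qed

lemma AE_approx_tendsto: "AE \<omega> in P. (\<lambda>n. approx n t \<omega>) \<longlonglongrightarrow> conv_version t \<omega>"
proof (rule AE_tendsto_of_L2_summable)
  let ?c = "\<lambda>n. real CARD('d) ^ 3 * ((2 + 2 * tail_const) * exp (- (2 * mS)) ^ Suc n)"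
  show "L2_dist_sq P (approx n t) (conv_version t) \<le> ennreal (?c n)" for n
    unfolding approx_entries[abs_def] conv_version_def[abs_def]
    by (rule L2_dist_sq_row_sums_le[OF _ _ lower_version_approx]) (use tail_const in auto)
  show "0 \<le> ?c n" for n using tail_const by simp
  show "summable ?c" using S_pos
    by (intro summable_mult summable_Suc_iff[THEN iffD2] summable_geometric) auto
qed auto

text \<open>Taken for every path. Even where there is no limit, \<open>lim\<close> depends only on
  the sequence, so \<open>approx_shift\<close> carries over without an exceptional set.\<close>

definition conv_raw :: "real \<Rightarrow> (real \<Rightarrow> real^'d) \<Rightarrow> real^'d" where
  "conv_raw t \<omega> = lim (\<lambda>n. approx n t \<omega>)"

lemma measurable_conv_raw[measurable]: "conv_raw t \<in> borel_measurable P"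
  unfolding conv_raw_def[abs_def] by measurable

lemma conv_raw_shift: "conv_raw (t + \<tau>) (wiener_shift (- \<tau>) \<omega>) = conv_raw t \<omega>"
  by (simp add: conv_raw_def approx_shift)

lemma AE_conv_raw: "AE \<omega> in P. conv_raw t \<omega> = conv_version t \<omega>"
  using AE_approx_tendsto[of t] by eventually_elim (simp add: conv_raw_def limI)

lemma conv_raw_bound: "L2_dist_sq P (conv_raw t) (\<lambda>_. 0) \<le> ennreal (real CARD('d) ^ 3 * tail_const)"
proof -
  have "L2_dist_sq P (conv_raw t) (\<lambda>_. 0) = L2_dist_sq P (conv_version t) (\<lambda>\<omega>. \<chi> i. \<Sum>j\<in>(UNIV::'d set). 0)"
    using AE_conv_raw[of t] by (intro L2_dist_sq_cong_AE) (auto simp: vec_eq_iff)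
  also have "\<dots> \<le> ennreal (real CARD('d) ^ 3 * tail_const)"
    unfolding conv_version_def[abs_def]
    by (rule L2_dist_sq_row_sums_le[OF _ _ comp.lower_integral_bound[OF lower_version]]) (use tail_const in auto)
  finally show ?thesis .
qed

definition increment_const :: real where
  "increment_const = real CARD('d) ^ 3 * (16 * kernel_const\<^sup>2 + 8 * (lipschitz_const * kernel_const)\<^sup>2 * \<tau> powr (2 - 2 * H) * exp_const mS)"

lemma increment_const: "0 \<le> increment_const" using exp_const_ge[OF S_pos(2)] by (simp add: increment_const_def)

text \<open>The noise on \<open>{s..t}\<close> contributes the order
  \<open>(t - s) powr (2 * H)\<close>. The change of the kernel on the past contributes
  \<open>(t - s)\<^sup>2\<close>, which is absorbed at the price of
  \<open>\<tau> powr (2 - 2 * H)\<close> since \<open>t - s \<le> \<tau>\<close>.\<close>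

lemma conv_raw_increment:
  assumes "s \<le> t" "t - s \<le> \<tau>"
  shows "L2_dist_sq P (conv_raw t) (conv_raw s) \<le> ennreal (increment_const * (t - s) powr (2 * H))"
proof -
  define B where "B = (16 * kernel_const\<^sup>2 + 8 * (lipschitz_const * kernel_const)\<^sup>2 * \<tau> powr (2 - 2 * H) * exp_const mS) * (t - s) powr (2 * H)"
  have sq: "(t - s)\<^sup>2 \<le> \<tau> powr (2 - 2 * H) * (t - s) powr (2 * H)"
  proof -
    have "(t - s)\<^sup>2 = (t - s) powr (2 - 2 * H) * (t - s) powr (2 * H)"
      using assms by (cases "t = s") (auto simp: powr_add[symmetric] powr_numeral)
    also have "\<dots> \<le> \<tau> powr (2 - 2 * H) * (t - s) powr (2 * H)"
      using assms H by (intro mult_right_mono powr_mono2) auto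
    finally show ?thesis .
  qed
  have "L2_dist_sq P (lower_version i j t) (lower_version i j s) \<le> ennreal B" for i j
  proof -
    have "L2_dist_sq P (lower_version i j t) (lower_version i j s)
        \<le> ennreal (16 * kernel_const\<^sup>2 * (t - s) powr (2 * H) + 8 * (lipschitz_const * kernel_const * (t - s))\<^sup>2 * exp_const mS)"
      using assms lipschitz_const kernel_const
      by (intro comp.lower_integral_increment[OF S_pos(2) lower_version lower_version tail_const assms(1) continuous_on_kernel continuous_on_kernel]
          kernel_entry_le kernel_increment) auto
    also have "16 * kernel_const\<^sup>2 * (t - s) powr (2 * H) + 8 * (lipschitz_const * kernel_const * (t - s))\<^sup>2 * exp_const mS
        = 16 * kernel_const\<^sup>2 * (t - s) powr (2 * H) + (8 * (lipschitz_const * kernel_const)\<^sup>2 * exp_const mS) * (t - s)\<^sup>2"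
      by (simp add: power_mult_distrib ac_simps)
    also have "\<dots> \<le> 16 * kernel_const\<^sup>2 * (t - s) powr (2 * H)
        + (8 * (lipschitz_const * kernel_const)\<^sup>2 * exp_const mS) * (\<tau> powr (2 - 2 * H) * (t - s) powr (2 * H))"
      using exp_const_ge[OF S_pos(2)] by (intro add_left_mono mult_left_mono sq) auto
    also have "\<dots> = B" by (simp add: B_def algebra_simps)
    finally show ?thesis by (simp add: ennreal_leI)
  qed
  moreover have "0 \<le> B" using exp_const_ge[OF S_pos(2)] by (simp add: B_def)
  ultimately have "L2_dist_sq P (conv_version t) (conv_version s) \<le> ennreal (real CARD('d) ^ 3 * B)"
    unfolding conv_version_def[abs_def] by (intro L2_dist_sq_row_sums_le) auto
  moreover have "L2_dist_sq P (conv_raw t) (conv_raw s) = L2_dist_sq P (conv_version t) (conv_version s)"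
    using AE_conv_raw by (intro L2_dist_sq_cong_AE) auto
  ultimately show ?thesis by (simp add: increment_const_def B_def mult.assoc)
qed

end

section \<open>Exponential weights on the time axis\<close>

lemma nn_integral_exp_past:
  assumes "0 < a"
  shows "(\<integral>\<^sup>+s. ennreal (exp (- a * (t - s))) * indicator {..t} s \<partial>lborel) = ennreal (1 / a)"
proof -
  interpret prob_space "density lborel (exponential_density a)" using assms by (rule prob_space_exponential_density)
  have "(\<integral>\<^sup>+x. ennreal (exponential_density a x) \<partial>lborel) = 1"
    using emeasure_space_1 by (simp add: emeasure_density)
  then have one: "ennreal \<bar>-1\<bar> * (\<integral>\<^sup>+s. ennreal (exponential_density a (t + (-1) * s)) \<partial>lborel) = 1"
    by (subst nn_integral_real_affine[symmetric]) auto
  have "(\<integral>\<^sup>+s. ennreal (exp (- a * (t - s))) * indicator {..t} s \<partial>lborel)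
      = (\<integral>\<^sup>+s. ennreal (1 / a) * ennreal (exponential_density a (t + (-1) * s)) \<partial>lborel)"
    using assms by (intro nn_integral_cong)
      (auto simp: exponential_density_def indicator_def ennreal_mult[symmetric] algebra_simps)
  also have "\<dots> = ennreal (1 / a) * (\<integral>\<^sup>+s. ennreal (exponential_density a (t + (-1) * s)) \<partial>lborel)"
    by (rule nn_integral_cmult) measurable
  finally show ?thesis using one by simp
qed

lemma nn_integral_exp_abs_finite:
  assumes "0 < a"
  shows "(\<integral>\<^sup>+s. ennreal (exp (- a * \<bar>s\<bar>)) \<partial>lborel) < \<infinity>"
proof -
  define g where "g s = ennreal (exp (- a * (0 - s))) * indicator {..0} s" for s :: real
  have [measurable]: "g \<in> borel_measurable borel" unfolding g_def[abs_def] by measurable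
  have g: "(\<integral>\<^sup>+s. g s \<partial>lborel) = ennreal (1 / a)"
    unfolding g_def by (rule nn_integral_exp_past[OF assms])
  have "(\<integral>\<^sup>+s. g (0 + (-1) * s) \<partial>lborel) = ennreal (1 / a)"
    using g nn_integral_real_affine[of g "-1" 0] by simp
  then have "(\<integral>\<^sup>+s. g s + g (0 + (-1) * s) \<partial>lborel) = ennreal (1 / a) + ennreal (1 / a)"
    by (subst nn_integral_add) (auto simp: g)
  moreover have "(\<integral>\<^sup>+s. ennreal (exp (- a * \<bar>s\<bar>)) \<partial>lborel) \<le> (\<integral>\<^sup>+s. g s + g (0 + (-1) * s) \<partial>lborel)"
    by (intro nn_integral_mono) (auto simp: g_def indicator_def abs_if)
  ultimately show ?thesis by (auto simp: le_less_trans)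
qed

definition weighted_norm :: "real \<Rightarrow> (real \<Rightarrow> 'b::real_normed_vector) \<Rightarrow> ennreal" where
  "weighted_norm \<epsilon> z = (\<integral>\<^sup>+s. ennreal (exp (- \<epsilon> * \<bar>s\<bar>) * norm (z s)) \<partial>lborel)"

text \<open>Translation by \<open>c\<close> changes the weight by a factor of at most
  \<open>exp (\<epsilon> * |c|)\<close>; finiteness of the norm is therefore invariant under
  translation.\<close>

lemma weighted_norm_shift_le:
  fixes z :: "real \<Rightarrow> 'b::real_normed_vector"
  assumes z: "z \<in> borel_measurable borel" and \<epsilon>: "0 < \<epsilon>" and z': "\<And>s. z' (s + c) = z s"
  shows "weighted_norm \<epsilon> z' \<le> ennreal (exp (\<epsilon> * \<bar>c\<bar>)) * weighted_norm \<epsilon> z"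
proof -
  note [measurable] = z
  have eq: "z' = (\<lambda>s. z (s - c))" using z'[of "_ - c"] by (simp add: fun_eq_iff)
  have [measurable]: "z' \<in> borel_measurable borel" unfolding eq by measurable
  have "weighted_norm \<epsilon> z' = (\<integral>\<^sup>+s. ennreal (exp (- \<epsilon> * \<bar>c + 1 * s\<bar>) * norm (z' (c + 1 * s))) \<partial>lborel)"
    unfolding weighted_norm_def
    by (subst nn_integral_real_affine[where c=1 and t=c]) (auto simp: add.commute)
  also have "\<dots> \<le> (\<integral>\<^sup>+s. ennreal (exp (\<epsilon> * \<bar>c\<bar>)) * ennreal (exp (- \<epsilon> * \<bar>s\<bar>) * norm (z s)) \<partial>lborel)"
  proof (intro nn_integral_mono)
    fix s
    have "\<epsilon> * \<bar>s\<bar> \<le> \<epsilon> * (\<bar>c + s\<bar> + \<bar>c\<bar>)" using \<epsilon> by (intro mult_left_mono) auto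
    then have "exp (- \<epsilon> * \<bar>c + s\<bar>) \<le> exp (\<epsilon> * \<bar>c\<bar> + - \<epsilon> * \<bar>s\<bar>)" by (simp add: algebra_simps)
    then have "exp (- \<epsilon> * \<bar>c + s\<bar>) * norm (z s) \<le> exp (\<epsilon> * \<bar>c\<bar>) * (exp (- \<epsilon> * \<bar>s\<bar>) * norm (z s))"
      unfolding exp_add mult.assoc[symmetric] by (intro mult_right_mono) auto
    then show "ennreal (exp (- \<epsilon> * \<bar>c + 1 * s\<bar>) * norm (z' (c + 1 * s)))
        \<le> ennreal (exp (\<epsilon> * \<bar>c\<bar>)) * ennreal (exp (- \<epsilon> * \<bar>s\<bar>) * norm (z s))"
      by (simp add: ennreal_mult[symmetric] ennreal_leI add.commute[of c] z')
  qed
  also have "\<dots> = ennreal (exp (\<epsilon> * \<bar>c\<bar>)) * weighted_norm \<epsilon> z"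
    unfolding weighted_norm_def by (rule nn_integral_cmult) measurable
  finally show ?thesis .
qed

lemma weighted_norm_shift_finite:
  assumes z: "z \<in> borel_measurable borel" "z' \<in> borel_measurable borel" and \<epsilon>: "0 < \<epsilon>" and z': "\<And>s. z' (s + c) = z s"
  shows "weighted_norm \<epsilon> z' < \<infinity> \<longleftrightarrow> weighted_norm \<epsilon> z < \<infinity>"
proof -
  have "z (s + (- c)) = z' s" for s using z'[of "s - c"] by simp
  with weighted_norm_shift_le[OF z(1) \<epsilon> z'] weighted_norm_shift_le[OF z(2) \<epsilon>, of z "- c"]
  show ?thesis by (auto simp: ennreal_mult_less_top intro: le_less_trans)
qed

context ou_setting
begin

section \<open>A continuous version of the stochastic convolution\<close>

lemma tau_div_powr: "(\<tau> / 2 ^ n) powr (2 * H) = \<tau> powr (2 * H) * (2 powr (- 2 * H)) ^ n"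
  using tau_pos by (simp add: powr_divide powr_minus field_simps powr_realpow[symmetric] powr_powr mult.commute)

text \<open>Kolmogorov's continuity argument with exponent 2: level \<open>n\<close> has of the
  order of \<open>2 ^ n\<close> increments in a window, each with second moment of order
  \<open>(2 powr (- 2 * H)) ^ n\<close>, and the product decays geometrically because
  \<open>2 * H > 1\<close>.\<close>

lemma AE_conv_raw_regular: "AE \<omega> in P. dyadic_regular \<tau> (\<lambda>t. conv_raw t \<omega>)"
proof -
  define q where "q = 2 * 2 powr (- 2 * H)"
  have "2 powr (1 + - 2 * H) < (1::real)" using H powr_less_mono[of "1 + - 2 * H" 0 2] by simp
  then have q: "0 < q" "q < 1" unfolding powr_add q_def by auto
  have "AE \<omega> in P. summable (\<lambda>n. norm (dyadic_osc \<tau> N n (\<lambda>t. conv_raw t \<omega>)))" for N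
  proof (rule AE_summable_norm_of_L2_geometric[OF _ q])
    let ?C = "(2 * real N + 1) * (increment_const * \<tau> powr (2 * H))"
    show "0 \<le> ?C" using increment_const by simp
    show "(\<lambda>\<omega>. dyadic_osc \<tau> N n (\<lambda>t. conv_raw t \<omega>)) \<in> borel_measurable P" for n
      unfolding dyadic_osc_def by measurable
    fix n
    define I where "I = {- int (N * 2 ^ n)..int (N * 2 ^ n)}"
    have "(\<integral>\<^sup>+\<omega>. ennreal ((norm (dyadic_osc \<tau> N n (\<lambda>t. conv_raw t \<omega>)))\<^sup>2) \<partial>P)
        = (\<integral>\<^sup>+\<omega>. (\<Sum>i\<in>I. ennreal ((norm (conv_raw (of_int (i + 1) * (\<tau> / 2 ^ n)) \<omega> - conv_raw (of_int i * (\<tau> / 2 ^ n)) \<omega>))\<^sup>2)) \<partial>P)"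
      unfolding dyadic_osc_def I_def by (intro nn_integral_cong) (simp add: sum_nonneg sum_ennreal)
    also have "\<dots> = (\<Sum>i\<in>I. L2_dist_sq P (conv_raw (of_int (i + 1) * (\<tau> / 2 ^ n))) (conv_raw (of_int i * (\<tau> / 2 ^ n))))"
      unfolding L2_dist_sq_def by (rule nn_integral_sum) measurable
    also have "\<dots> \<le> (\<Sum>i\<in>I. ennreal (increment_const * (\<tau> / 2 ^ n) powr (2 * H)))"
    proof (intro sum_mono)
      fix i :: int
      have d: "of_int (i + 1) * (\<tau> / 2 ^ n) - of_int i * (\<tau> / 2 ^ n) = \<tau> / 2 ^ n"
        by (simp add: distrib_right add_divide_distrib)
      have "\<tau> / 2 ^ n \<le> \<tau>" using tau_pos by (simp add: divide_le_eq)
      moreover have "of_int i * (\<tau> / 2 ^ n) \<le> of_int (i + 1) * (\<tau> / 2 ^ n)"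
        using tau_pos by (intro mult_right_mono) auto
      ultimately show "L2_dist_sq P (conv_raw (of_int (i + 1) * (\<tau> / 2 ^ n))) (conv_raw (of_int i * (\<tau> / 2 ^ n)))
          \<le> ennreal (increment_const * (\<tau> / 2 ^ n) powr (2 * H))"
        using conv_raw_increment[of "of_int i * (\<tau> / 2 ^ n)" "of_int (i + 1) * (\<tau> / 2 ^ n)"] unfolding d by simp
    qed
    also have "\<dots> = ennreal (real (card I) * (increment_const * (\<tau> / 2 ^ n) powr (2 * H)))"
      using increment_const by (simp add: ennreal_of_nat_eq_real_of_nat ennreal_mult[symmetric] del: sum_ennreal)
    also have "\<dots> \<le> ennreal (?C * q ^ n)"
    proof (rule ennreal_leI)
      have "real (card I) = 2 * real N * 2 ^ n + 1" unfolding I_def by simp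
      also have "\<dots> \<le> (2 * real N + 1) * 2 ^ n" by (simp add: algebra_simps)
      finally have "real (card I) * (increment_const * (\<tau> / 2 ^ n) powr (2 * H)) \<le> (2 * real N + 1) * 2 ^ n * (increment_const * (\<tau> / 2 ^ n) powr (2 * H))"
        using increment_const by (intro mult_right_mono) auto
      also note tau_div_powr
      also have "(2 * real N + 1) * 2 ^ n * (increment_const * (\<tau> powr (2 * H) * (2 powr (- 2 * H)) ^ n)) = ?C * q ^ n"
        by (simp add: q_def power_mult_distrib)
      finally show "real (card I) * (increment_const * (\<tau> / 2 ^ n) powr (2 * H)) \<le> ?C * q ^ n" unfolding tau_div_powr .
    qed
    finally show "(\<integral>\<^sup>+\<omega>. ennreal ((norm (dyadic_osc \<tau> N n (\<lambda>t. conv_raw t \<omega>)))\<^sup>2) \<partial>P) \<le> ennreal (?C * q ^ n)" .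
  qed
  then have "AE \<omega> in P. \<forall>N. summable (\<lambda>n. norm (dyadic_osc \<tau> N n (\<lambda>t. conv_raw t \<omega>)))"
    by (simp add: AE_all_countable)
  then show ?thesis
  proof eventually_elim
    case (elim \<omega>)
    have "(\<Sum>n. ennreal (dyadic_osc \<tau> N n (\<lambda>t. conv_raw t \<omega>))) = ennreal (\<Sum>n. dyadic_osc \<tau> N n (\<lambda>t. conv_raw t \<omega>))" for N
      using elim by (intro suminf_ennreal2) (auto simp: dyadic_osc_nonneg)
    then show ?case by (simp add: dyadic_regular_def)
  qed
qed

text \<open>Paths failing the regularity test get the value 0. By
  \<open>dyadic_regular_shift_iff\<close> a path and its shift pass or fail together, so the shift
  identity survives this correction.\<close>

definition conv_ext :: "real \<Rightarrow> (real \<Rightarrow> real^'d) \<Rightarrow> real^'d" where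
  "conv_ext t \<omega> = (if dyadic_regular \<tau> (\<lambda>t. conv_raw t \<omega>) then dyadic_ext \<tau> (\<lambda>t. conv_raw t \<omega>) t else 0)"

lemma pred_conv_raw_regular[measurable]: "Measurable.pred P (\<lambda>\<omega>. dyadic_regular \<tau> (\<lambda>t. conv_raw t \<omega>))"
  unfolding dyadic_regular_def dyadic_osc_def by measurable

lemma conv_ext_continuous: "continuous_on UNIV (\<lambda>t. conv_ext t \<omega>)"
  using dyadic_ext_continuous[OF tau_pos] by (cases "dyadic_regular \<tau> (\<lambda>t. conv_raw t \<omega>)") (auto simp: conv_ext_def)

lemma measurable_conv_ext[measurable]: "conv_ext t \<in> borel_measurable P"
  unfolding conv_ext_def[abs_def] dyadic_ext_def by measurable

lemma conv_ext_continuous_process: "continuous_process P conv_ext"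
  by (simp add: continuous_process_def conv_ext_continuous)

lemma conv_ext_shift: "conv_ext (t + \<tau>) (wiener_shift (- \<tau>) \<omega>) = conv_ext t \<omega>"
  unfolding conv_ext_def
  using dyadic_regular_shift_iff[OF tau_pos, of "\<lambda>t. conv_raw t (wiener_shift (- \<tau>) \<omega>)" "\<lambda>t. conv_raw t \<omega>"]
    dyadic_ext_shift[OF tau_pos, of "\<lambda>t. conv_raw t (wiener_shift (- \<tau>) \<omega>)" "\<lambda>t. conv_raw t \<omega>"] conv_raw_shift by simp

text \<open>At fixed \<open>t\<close> the values at the grid points converge in mean square to
  \<open>conv_raw t\<close> at a geometric rate, hence almost surely; for regular paths they
  converge to the extension as well.\<close>

lemma AE_conv_ext: "AE \<omega> in P. conv_ext t \<omega> = conv_raw t \<omega>"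
proof -
  have "AE \<omega> in P. (\<lambda>n. conv_raw (dyadic_grid \<tau> n t) \<omega>) \<longlonglongrightarrow> conv_raw t \<omega>"
  proof (rule AE_tendsto_of_L2_summable)
    let ?c = "\<lambda>n. increment_const * \<tau> powr (2 * H) * (2 powr (- 2 * H)) ^ n"
    show "L2_dist_sq P (conv_raw (dyadic_grid \<tau> n t)) (conv_raw t) \<le> ennreal (?c n)" for n
    proof -
      note b = dyadic_grid_bounds[OF tau_pos, where n=n and s=t]
      have "\<tau> / 2 ^ n \<le> \<tau>" using tau_pos by (simp add: divide_le_eq)
      then have "L2_dist_sq P (conv_raw t) (conv_raw (dyadic_grid \<tau> n t)) \<le> ennreal (increment_const * (t - dyadic_grid \<tau> n t) powr (2 * H))"
        using b by (intro conv_raw_increment) auto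
      also have "\<dots> \<le> ennreal (increment_const * (\<tau> / 2 ^ n) powr (2 * H))"
        using b increment_const H by (intro ennreal_leI mult_left_mono powr_mono2) auto
      also note tau_div_powr
      finally show ?thesis by (simp add: L2_dist_sq_commute mult.assoc)
    qed
    show "0 \<le> ?c n" for n using increment_const by simp
    have "2 powr (- 2 * H) < (1::real)" using H powr_less_mono[of "- 2 * H" 0 2] by simp
    then show "summable ?c" by (intro summable_mult summable_geometric) auto
  qed auto
  then show ?thesis using AE_conv_raw_regular
  proof eventually_elim
    case (elim \<omega>)
    obtain N :: nat where "\<bar>t\<bar> / \<tau> \<le> real N" using real_arch_simple by blast
    then have "\<bar>t\<bar> \<le> real N * \<tau>" using tau_pos by (simp add: pos_divide_le_eq)
    from dyadic_ext_approx(1)[OF tau_pos elim(2) this] elim(1)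
    have "dyadic_ext \<tau> (\<lambda>t. conv_raw t \<omega>) t = conv_raw t \<omega>" by (rule LIMSEQ_unique)
    then show ?case using elim(2) by (simp add: conv_ext_def)
  qed
qed

lemma conv_ext_bound: "L2_dist_sq P (conv_ext t) (\<lambda>_. 0) \<le> ennreal (real CARD('d) ^ 3 * tail_const)"
  using conv_raw_bound[of t] AE_conv_ext[of t] L2_dist_sq_cong_AE[of "conv_ext t" "conv_raw t" P "\<lambda>_. 0" "\<lambda>_. 0"] by simp

lemma measurable_weighted_integrand:
  "(\<lambda>p. ennreal (exp (- \<epsilon> * \<bar>snd p\<bar>) * norm (conv_ext (snd p) (fst p)))) \<in> borel_measurable (P \<Otimes>\<^sub>M lborel)"
proof -
  note [measurable] = measurable_swap_lborel[OF continuous_process_jointly_measurable[OF conv_ext_continuous_process]]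
  show ?thesis by measurable
qed

lemma measurable_weighted_norm_conv_ext[measurable]: "(\<lambda>\<omega>. weighted_norm \<epsilon> (\<lambda>s. conv_ext s \<omega>)) \<in> borel_measurable P"
  unfolding weighted_norm_def using measurable_weighted_integrand
  by (intro lborel.borel_measurable_nn_integral) (simp add: case_prod_beta)

text \<open>First moments of the noise are bounded uniformly in time, by
  \<open>x \<le> 1 + x\<^sup>2\<close>, and the weight is integrable; exchanging the integrals shows
  that the expected norm is finite.\<close>

lemma AE_weighted_norm_conv_ext:
  assumes "0 < \<epsilon>"
  shows "AE \<omega> in P. weighted_norm \<epsilon> (\<lambda>s. conv_ext s \<omega>) < \<infinity>"
proof -
  interpret pair_sigma_finite P lborel by unfold_locales
  note m = measurable_weighted_integrand[of \<epsilon>]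
  define B where "B = 1 + real CARD('d) ^ 3 * tail_const"
  have "(\<integral>\<^sup>+\<omega>. ennreal (norm (conv_ext s \<omega>)) \<partial>P) \<le> ennreal B" for s
  proof -
    have "x \<le> 1 + x\<^sup>2" for x :: real using sum_squares_bound[of x 1] by (cases "0 \<le> x") (auto intro: order_trans[of _ 0])
    then have "(\<integral>\<^sup>+\<omega>. ennreal (norm (conv_ext s \<omega>)) \<partial>P) \<le> (\<integral>\<^sup>+\<omega>. 1 + ennreal ((norm (conv_ext s \<omega> - 0))\<^sup>2) \<partial>P)"
      by (intro nn_integral_mono) (simp add: ennreal_1[symmetric] ennreal_plus[symmetric] ennreal_leI del: ennreal_1 ennreal_plus)
    also have "\<dots> = 1 + L2_dist_sq P (conv_ext s) (\<lambda>_. 0)"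
      unfolding L2_dist_sq_def by (subst nn_integral_add) (auto simp: comp.emeasure_space_1)
    also have "\<dots> \<le> 1 + ennreal (real CARD('d) ^ 3 * tail_const)" by (intro add_left_mono conv_ext_bound)
    also have "\<dots> = ennreal B" using tail_const by (simp add: B_def ennreal_1[symmetric] ennreal_plus[symmetric] del: ennreal_1 ennreal_plus)
    finally show ?thesis .
  qed
  note B = this
  have "(\<integral>\<^sup>+\<omega>. weighted_norm \<epsilon> (\<lambda>s. conv_ext s \<omega>) \<partial>P)
      = (\<integral>\<^sup>+s. \<integral>\<^sup>+\<omega>. ennreal (exp (- \<epsilon> * \<bar>s\<bar>) * norm (conv_ext s \<omega>)) \<partial>P \<partial>lborel)"
    unfolding weighted_norm_def using Fubini'[of "\<lambda>\<omega> s. ennreal (exp (- \<epsilon> * \<bar>s\<bar>) * norm (conv_ext s \<omega>))"] m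
    by (simp add: case_prod_beta)
  also have "\<dots> = (\<integral>\<^sup>+s. ennreal (exp (- \<epsilon> * \<bar>s\<bar>)) * (\<integral>\<^sup>+\<omega>. ennreal (norm (conv_ext s \<omega>)) \<partial>P) \<partial>lborel)"
    by (intro nn_integral_cong) (simp add: ennreal_mult nn_integral_cmult)
  also have "\<dots> \<le> (\<integral>\<^sup>+s. ennreal (exp (- \<epsilon> * \<bar>s\<bar>)) * ennreal B \<partial>lborel)"
    by (intro nn_integral_mono mult_left_mono B) auto
  also have "\<dots> = (\<integral>\<^sup>+s. ennreal (exp (- \<epsilon> * \<bar>s\<bar>)) \<partial>lborel) * ennreal B"
    by (rule nn_integral_multc) measurable
  also have "\<dots> < \<infinity>" using nn_integral_exp_abs_finite[OF assms] by (simp add: ennreal_mult_less_top)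
  finally have "(\<integral>\<^sup>+\<omega>. weighted_norm \<epsilon> (\<lambda>s. conv_ext s \<omega>) \<partial>P) \<noteq> \<infinity>" by simp
  then have "AE \<omega> in P. weighted_norm \<epsilon> (\<lambda>s. conv_ext s \<omega>) \<noteq> \<infinity>"
    by (intro nn_integral_noteq_infinite) measurable
  then show ?thesis by (simp add: less_top)
qed

text \<open>A second correction on a shift-invariant set of paths. It makes the weighted norm finite
  for every path, so that the fixed point equation can be solved for all paths and not just almost
  all.\<close>

definition conv :: "real \<Rightarrow> real \<Rightarrow> (real \<Rightarrow> real^'d) \<Rightarrow> real^'d" where
  "conv \<epsilon> t \<omega> = (if weighted_norm \<epsilon> (\<lambda>s. conv_ext s \<omega>) < \<infinity> then conv_ext t \<omega> else 0)"

lemma conv_continuous: "continuous_on UNIV (\<lambda>t. conv \<epsilon> t \<omega>)"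
  using conv_ext_continuous[of \<omega>] by (cases "weighted_norm \<epsilon> (\<lambda>s. conv_ext s \<omega>) < \<infinity>") (auto simp: conv_def)

lemma measurable_conv[measurable]: "conv \<epsilon> t \<in> borel_measurable P"
  unfolding conv_def[abs_def] by measurable

lemma conv_continuous_process: "continuous_process P (conv \<epsilon>)"
  by (simp add: continuous_process_def conv_continuous)

lemma AE_conv: "0 < \<epsilon> \<Longrightarrow> AE \<omega> in P. conv \<epsilon> t \<omega> = conv_version t \<omega>"
  using AE_weighted_norm_conv_ext[of \<epsilon>] AE_conv_ext[of t] AE_conv_raw[of t] by (auto simp: conv_def elim: AE_mp)

lemma conv_bound: "0 < \<epsilon> \<Longrightarrow> L2_dist_sq P (conv \<epsilon> t) (\<lambda>_. 0) \<le> ennreal (real CARD('d) ^ 3 * tail_const)"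
proof -
  assume "0 < \<epsilon>"
  then have "AE \<omega> in P. conv \<epsilon> t \<omega> = conv_raw t \<omega>" using AE_conv[of \<epsilon> t] AE_conv_raw[of t] by auto
  then have "L2_dist_sq P (conv \<epsilon> t) (\<lambda>_. 0) = L2_dist_sq P (conv_raw t) (\<lambda>_. 0)" by (intro L2_dist_sq_cong_AE) auto
  then show ?thesis using conv_raw_bound[of t] by simp
qed

lemma conv_weighted_norm: "weighted_norm \<epsilon> (\<lambda>s. conv \<epsilon> s \<omega>) < \<infinity>"
  by (cases "weighted_norm \<epsilon> (\<lambda>s. conv_ext s \<omega>) < \<infinity>") (auto simp: conv_def weighted_norm_def)

lemma conv_shift:
  assumes "0 < \<epsilon>"
  shows "conv \<epsilon> (t + \<tau>) (wiener_shift (- \<tau>) \<omega>) = conv \<epsilon> t \<omega>"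
proof -
  have "(\<lambda>t. conv_ext t \<omega>) \<in> borel_measurable borel" for \<omega>
    using conv_ext_continuous by (rule borel_measurable_continuous_onI)
  then have "weighted_norm \<epsilon> (\<lambda>s. conv_ext s (wiener_shift (- \<tau>) \<omega>)) < \<infinity> \<longleftrightarrow> weighted_norm \<epsilon> (\<lambda>s. conv_ext s \<omega>) < \<infinity>"
    using assms conv_ext_shift by (intro weighted_norm_shift_finite[where c = \<tau>]) auto
  then show ?thesis by (simp add: conv_def conv_ext_shift)
qed

section \<open>Agreement with the Wiener integral over half-lines\<close>

lemma kernel_abs_H:
  "(\<lambda>u. indicator {..t} u *\<^sub>R kernel t u) \<in> abs_H_mat H"
  "(\<lambda>u. indicator {s..t} u *\<^sub>R kernel t u) \<in> abs_H_mat H"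
proof -
  show *: "(\<lambda>u. indicator {..t} u *\<^sub>R kernel t u) \<in> abs_H_mat H"
    using S_sigma[of t] by (simp add: kernel_def)
  have "(\<lambda>u. indicator {s..t} u * (indicator {..t} u *\<^sub>R kernel t u) $ i $ j) \<in> abs_H H" for i j
    using * by (intro abs_H_indicator) (auto simp: abs_H_mat_def)
  moreover have "(\<lambda>u. indicator {s..t} u * (indicator {..t} u *\<^sub>R kernel t u) $ i $ j)
      = (\<lambda>u. (indicator {s..t} u *\<^sub>R kernel t u) $ i $ j)" for i j
    by (auto simp: indicator_def fun_eq_iff)
  ultimately show "(\<lambda>u. indicator {s..t} u *\<^sub>R kernel t u) \<in> abs_H_mat H" by (simp add: abs_H_mat_def)
qed

text \<open>The explicit rate in \<open>lower_integral\<close> bounds the distance to the truncated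
  integrals and so gives the limit. The truncations are available for \<open>- s \<le> t\<close>,
  which holds eventually in \<open>s\<close>.\<close>

lemma has_lower_integral_conv_version:
  assumes I[measurable]: "I \<in> borel_measurable P" and ae: "AE \<omega> in P. I \<omega> = conv_version t \<omega>"
  shows "has_wiener_integral_lower_infinite P H coordinate_process (kernel t) t I"
proof -
  have "\<exists>J. has_wiener_integral_scalar P (\<lambda>t \<omega>. \<omega> t $ j) (\<lambda>u. kernel t u $ i $ j) (- s) t J" if "- s \<le> t" for i j s
    using comp.wiener_integral_exists[OF that continuous_on_kernel] by blast
  note ex = this
  define J where "J i j s = (SOME J. has_wiener_integral_scalar P (\<lambda>t \<omega>. \<omega> t $ j) (\<lambda>u. kernel t u $ i $ j) (- s) t J)" for i j s
  have J: "has_wiener_integral_scalar P (\<lambda>t \<omega>. \<omega> t $ j) (\<lambda>u. kernel t u $ i $ j) (- s) t (J i j s)" if "- s \<le> t" for i j s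
    unfolding J_def using ex[OF that] by (rule someI_ex)
  define JJ where "JJ s \<omega> = (\<chi> i. \<Sum>j\<in>UNIV. J i j s \<omega>)" for s \<omega>
  have Jm[measurable]: "J i j s \<in> borel_measurable P" if "- s \<le> t" for i j s
    using comp.wiener_integralD(3)[OF J[OF that]] .
  have JJ: "has_wiener_integral P H coordinate_process (kernel t) (- s) t (JJ s)" if "- s \<le> t" for s
    unfolding has_wiener_integral_def
  proof (intro conjI exI[of _ "\<lambda>i j. J i j s"])
    show "JJ s \<in> borel_measurable P" using Jm[OF that] by (intro borel_measurable_vec) (simp add: JJ_def)
  qed (use kernel_abs_H J[OF that] in \<open>auto simp: coordinate_process_def JJ_def\<close>)
  define B where "B = real CARD('d) ^ 3 * tail_const * exp (- (2 * mS) * t)"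
  have le_entry: "L2_dist_sq P (J i j s) (lower_version i j t) \<le> ennreal (tail_const * exp (- (2 * mS) * (t - (- s))))"
    if "- s \<le> t" for i j s
    using lower_version[of j t i] J[OF that] unfolding comp.lower_integral_def by blast
  have le: "L2_dist_sq P (JJ s) I \<le> ennreal (B * exp (- (2 * mS) * s))" if "- s \<le> t" for s
  proof -
    have "L2_dist_sq P (JJ s) I = L2_dist_sq P (JJ s) (conv_version t)"
      using ae by (intro L2_dist_sq_cong_AE) auto
    also have "\<dots> \<le> ennreal (real CARD('d) ^ 3 * (tail_const * exp (- (2 * mS) * (t - (- s)))))"
      unfolding JJ_def[abs_def] conv_version_def[abs_def]
      using Jm[OF that] tail_const by (intro L2_dist_sq_row_sums_le le_entry[OF that]) auto
    also have "real CARD('d) ^ 3 * (tail_const * exp (- (2 * mS) * (t - (- s)))) = B * exp (- (2 * mS) * s)"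
      by (simp add: B_def mult_exp_exp algebra_simps)
    finally show ?thesis .
  qed
  have "((\<lambda>s. L2_dist_sq P (JJ s) I) \<longlongrightarrow> 0) at_top"
  proof (rule tendsto_sandwich[where f = "\<lambda>_. 0" and h = "\<lambda>s. ennreal (B * exp (- (2 * mS) * s))"])
    have "filterlim (\<lambda>s. - (2 * mS) * s) at_bot at_top"
      using S_pos by (intro filterlim_tendsto_neg_mult_at_bot[OF tendsto_const]) (auto intro: filterlim_ident)
    then have "((\<lambda>s. exp (- (2 * mS) * s)) \<longlongrightarrow> 0) at_top"
      by (rule filterlim_compose[OF exp_at_bot])
    then have "((\<lambda>s. ennreal (B * exp (- (2 * mS) * s))) \<longlongrightarrow> ennreal (B * 0)) at_top"
      by (intro tendsto_ennrealI tendsto_intros)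
    then show "((\<lambda>s. ennreal (B * exp (- (2 * mS) * s))) \<longlongrightarrow> 0) at_top" by simp
    show "\<forall>\<^sub>F s in at_top. L2_dist_sq P (JJ s) I \<le> ennreal (B * exp (- (2 * mS) * s))"
      using eventually_ge_at_top[of "- t"] by eventually_elim (intro le, simp)
  qed auto
  moreover have "\<forall>\<^sub>F s in at_top. has_wiener_integral P H coordinate_process (kernel t) (- s) t (JJ s)"
    using eventually_ge_at_top[of "- t"] by eventually_elim (intro JJ, simp)
  ultimately show ?thesis unfolding has_wiener_integral_lower_infinite_def using kernel_abs_H I by blast
qed

lemma has_wiener_integral_unique:
  assumes "has_wiener_integral P H coordinate_process h s t I" "has_wiener_integral P H coordinate_process h s t I'"
  shows "AE \<omega> in P. I \<omega> = I' \<omega>"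
proof -
  obtain J where J: "\<And>i j. has_wiener_integral_scalar P (\<lambda>u \<omega>. \<omega> u $ j) (\<lambda>u. h u $ i $ j) s t (J i j)"
    "AE \<omega> in P. \<forall>i. I \<omega> $ i = (\<Sum>j\<in>UNIV. J i j \<omega>)"
    using assms(1) by (auto simp: has_wiener_integral_def coordinate_process_def)
  obtain J' where J': "\<And>i j. has_wiener_integral_scalar P (\<lambda>u \<omega>. \<omega> u $ j) (\<lambda>u. h u $ i $ j) s t (J' i j)"
    "AE \<omega> in P. \<forall>i. I' \<omega> $ i = (\<Sum>j\<in>UNIV. J' i j \<omega>)"
    using assms(2) by (auto simp: has_wiener_integral_def coordinate_process_def)
  have "AE \<omega> in P. \<forall>i. \<forall>j. J i j \<omega> = J' i j \<omega>"
    using comp.wiener_integral_unique[OF J(1) J'(1)] by (simp add: AE_all_countable)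
  then show ?thesis using J(2) J'(2) by eventually_elim (simp add: vec_eq_iff)
qed

text \<open>Both limits run over truncations at the same points, and these agree almost surely by
  uniqueness on bounded intervals.\<close>

lemma has_lower_integral_unique:
  assumes I: "has_wiener_integral_lower_infinite P H coordinate_process h t I"
    and I': "has_wiener_integral_lower_infinite P H coordinate_process h t I'"
  shows "AE \<omega> in P. I \<omega> = I' \<omega>"
proof -
  have [measurable]: "I \<in> borel_measurable P" "I' \<in> borel_measurable P"
    using I I' by (auto simp: has_wiener_integral_lower_infinite_def)
  obtain J where J: "\<forall>\<^sub>F s in at_top. has_wiener_integral P H coordinate_process h (- s) t (J s)"
    "((\<lambda>s. L2_dist_sq P (J s) I) \<longlongrightarrow> 0) at_top"
    using I by (auto simp: has_wiener_integral_lower_infinite_def)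
  obtain J' where J': "\<forall>\<^sub>F s in at_top. has_wiener_integral P H coordinate_process h (- s) t (J' s)"
    "((\<lambda>s. L2_dist_sq P (J' s) I') \<longlongrightarrow> 0) at_top"
    using I' by (auto simp: has_wiener_integral_lower_infinite_def)
  have "((\<lambda>s. 2 * L2_dist_sq P (J s) I + 2 * L2_dist_sq P (J' s) I') \<longlongrightarrow> 2 * 0 + 2 * 0) at_top"
    using J(2) J'(2) by (intro tendsto_add ennreal_tendsto_cmult) auto
  then have lim: "((\<lambda>s. 2 * L2_dist_sq P (J s) I + 2 * L2_dist_sq P (J' s) I') \<longlongrightarrow> 0) at_top" by simp
  have "\<forall>\<^sub>F s in at_top. L2_dist_sq P I I' \<le> 2 * L2_dist_sq P (J s) I + 2 * L2_dist_sq P (J' s) I'"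
    using J(1) J'(1)
  proof eventually_elim
    case (elim s)
    have [measurable]: "J s \<in> borel_measurable P" using elim(1) by (simp add: has_wiener_integral_def)
    have "L2_dist_sq P I I' \<le> 2 * L2_dist_sq P I (J s) + 2 * L2_dist_sq P (J s) I'"
      by (rule L2_dist_sq_triangle) auto
    also have "L2_dist_sq P (J s) I' = L2_dist_sq P (J' s) I'"
      using has_wiener_integral_unique[OF elim] by (intro L2_dist_sq_cong_AE) auto
    finally show ?case by (simp add: L2_dist_sq_commute)
  qed
  then have "L2_dist_sq P I I' \<le> 0"
    by (rule tendsto_le[OF trivial_limit_at_top_linorder lim tendsto_const])
  then show ?thesis by (simp add: L2_dist_sq_eq_0_iff)
qed

end

section \<open>Fixed points of the drift map\<close>

locale semilinear_setting = ou_setting H cS mS \<tau> A S \<sigma> P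
  for H cS mS \<tau> :: real and A :: "real^'d^'d" and S \<sigma> :: "real \<Rightarrow> real^'d^'d"
    and P :: "(real \<Rightarrow> real^'d) measure" +
  fixes cb mb :: real and b :: "real \<Rightarrow> real^'d \<Rightarrow> real^'d"
  assumes b_cont: "continuous_on UNIV (\<lambda>(t, x). b t x)"
    and b_pos: "cb > 0" "mb > 0"
    and b_lipschitz: "\<And>t x y. norm (b t x - b t y) \<le> cb * norm (x - y)"
    and b_growth: "\<And>t x. norm (b t x) \<le> mb * (1 + norm x)"
    and b_periodic: "\<And>t x. b (t + \<tau>) x = b t x"
    and contraction: "cS * cb / mS < 1"
begin

lemma measurable_b[measurable (raw)]:
  assumes "f \<in> borel_measurable M" "g \<in> borel_measurable M"
  shows "(\<lambda>x. b (f x) (g x)) \<in> borel_measurable M"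
proof -
  have "(\<lambda>p. b (fst p) (snd p)) \<in> borel_measurable borel"
    using b_cont by (intro borel_measurable_continuous_onI) (simp add: case_prod_beta)
  moreover have "(\<lambda>x. (f x, g x)) \<in> borel_measurable M" using assms by (rule borel_measurable_Pair)
  ultimately have "(\<lambda>x. (\<lambda>p. b (fst p) (snd p)) (f x, g x)) \<in> borel_measurable M"
    by (rule measurable_compose[rotated])
  then show ?thesis by simp
qed

lemma measurable_S_mult[measurable (raw)]:
  assumes "f \<in> borel_measurable M" "g \<in> borel_measurable M"
  shows "(\<lambda>x. S (f x) *v g x) \<in> borel_measurable M"
proof (rule borel_measurable_vec)
  fix i
  have "(\<lambda>x. S (f x) $ i $ k) \<in> borel_measurable M" for k
    by (rule measurable_compose[OF assms(1) borel_measurable_continuous_onI])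
      (intro continuous_on_component continuous_on_S)
  moreover have "(\<lambda>x. g x $ k) \<in> borel_measurable M" for k
    by (rule measurable_compose[OF assms(2) borel_measurable_continuous_onI])
      (intro continuous_on_component continuous_on_id)
  ultimately show "(\<lambda>x. (S (f x) *v g x) $ i) \<in> borel_measurable M"
    unfolding matrix_vector_mult_def vec_lambda_beta by measurable
qed

section \<open>The drift integral and its exponential majorant\<close>

lemma norm_S_mult_le: "norm (S t *v x) \<le> cS * exp (- mS * t) * norm x"
proof -
  have "norm (S t *v x) \<le> onorm ((*v) (S t)) * norm x" by (rule norm_matrix_vector_le)
  also have "\<dots> \<le> cS * exp (- mS * t) * norm x" by (intro mult_right_mono S_bound) auto
  finally show ?thesis .
qed

text \<open>Majorizes the drift integral up to the factor \<open>cS\<close>. Its values are extended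
  nonnegative reals, so it can be estimated before any integrability is known.\<close>

definition past :: "real \<Rightarrow> (real \<Rightarrow> real) \<Rightarrow> ennreal" where
  "past t f = (\<integral>\<^sup>+s. ennreal (exp (- mS * (t - s)) * f s) * indicator {..t} s \<partial>lborel)"

definition drift :: "real \<Rightarrow> (real \<Rightarrow> real^'d) \<Rightarrow> real^'d" where
  "drift t f = (LINT s:{..t}|lborel. S (t - s) *v f s)"

lemma past_mono: "(\<And>s. s \<le> t \<Longrightarrow> f s \<le> g s) \<Longrightarrow> past t f \<le> past t g"
  unfolding past_def by (intro nn_integral_mono) (auto simp: indicator_def intro!: ennreal_leI)

lemma past_cmult:
  assumes [measurable]: "f \<in> borel_measurable borel" and "0 \<le> c"
  shows "past t (\<lambda>s. c * f s) = ennreal c * past t f"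
proof -
  have "past t (\<lambda>s. c * f s)
      = (\<integral>\<^sup>+s. ennreal c * (ennreal (exp (- mS * (t - s)) * f s) * indicator {..t} s) \<partial>lborel)"
    unfolding past_def using assms(2)
    by (intro nn_integral_cong) (simp add: ennreal_mult' mult.left_commute mult.assoc[symmetric])
  also have "\<dots> = ennreal c * past t f"
    unfolding past_def by (rule nn_integral_cmult) measurable
  finally show ?thesis .
qed

lemma past_add:
  assumes [measurable]: "f \<in> borel_measurable borel" "g \<in> borel_measurable borel"
    and "\<And>s. 0 \<le> f s" "\<And>s. 0 \<le> g s"
  shows "past t (\<lambda>s. f s + g s) = past t f + past t g"
  unfolding past_def using assms(3,4)
  by (subst nn_integral_add[symmetric])
    (auto intro!: nn_integral_cong simp: distrib_left indicator_def ennreal_plus)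

text \<open>From \<open>|s| \<le> |t| + (t - s)\<close>: the growth of the argument costs
  \<open>\<epsilon>\<close> of the decay rate \<open>mS\<close>.\<close>

lemma past_exp:
  assumes "0 \<le> \<epsilon>" "\<epsilon> < mS"
  shows "past t (\<lambda>s. exp (\<epsilon> * \<bar>s\<bar>)) \<le> ennreal (exp (\<epsilon> * \<bar>t\<bar>) / (mS - \<epsilon>))"
proof -
  have "past t (\<lambda>s. exp (\<epsilon> * \<bar>s\<bar>))
      \<le> (\<integral>\<^sup>+s. ennreal (exp (\<epsilon> * \<bar>t\<bar>)) * (ennreal (exp (- (mS - \<epsilon>) * (t - s))) * indicator {..t} s) \<partial>lborel)"
    unfolding past_def
  proof (intro nn_integral_mono)
    fix s
    have "exp (- mS * (t - s)) * exp (\<epsilon> * \<bar>s\<bar>) \<le> exp (\<epsilon> * \<bar>t\<bar>) * exp (- (mS - \<epsilon>) * (t - s))" if "s \<le> t"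
    proof -
      have "\<epsilon> * \<bar>s\<bar> \<le> \<epsilon> * (\<bar>t\<bar> + (t - s))" using assms that by (intro mult_left_mono) auto
      then show ?thesis unfolding exp_add[symmetric] by (simp add: algebra_simps)
    qed
    then show "ennreal (exp (- mS * (t - s)) * exp (\<epsilon> * \<bar>s\<bar>)) * indicator {..t} s
        \<le> ennreal (exp (\<epsilon> * \<bar>t\<bar>)) * (ennreal (exp (- (mS - \<epsilon>) * (t - s))) * indicator {..t} s)"
      by (auto simp: indicator_def ennreal_mult[symmetric] intro!: ennreal_leI)
  qed
  also have "\<dots> = ennreal (exp (\<epsilon> * \<bar>t\<bar>)) * ennreal (1 / (mS - \<epsilon>))"
    using assms by (subst nn_integral_cmult) (auto simp: nn_integral_exp_past[of "mS - \<epsilon>", simplified])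
  also have "\<dots> = ennreal (exp (\<epsilon> * \<bar>t\<bar>) / (mS - \<epsilon>))" using assms by (simp add: ennreal_mult[symmetric])
  finally show ?thesis .
qed

text \<open>Again by \<open>|s| \<le> |t| + (t - s)\<close>; the weight stays under the integral, so
  the decay rate \<open>mS\<close> only has to dominate \<open>\<epsilon>\<close>.\<close>

lemma past_weighted:
  fixes z :: "real \<Rightarrow> real^'d"
  assumes [measurable]: "z \<in> borel_measurable borel" and "0 \<le> \<epsilon>" "\<epsilon> \<le> mS"
  shows "past t (\<lambda>s. norm (z s)) \<le> ennreal (exp (\<epsilon> * \<bar>t\<bar>)) * weighted_norm \<epsilon> z"
proof -
  have "past t (\<lambda>s. norm (z s)) \<le> (\<integral>\<^sup>+s. ennreal (exp (\<epsilon> * \<bar>t\<bar>)) * ennreal (exp (- \<epsilon> * \<bar>s\<bar>) * norm (z s)) \<partial>lborel)"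
    unfolding past_def
  proof (intro nn_integral_mono)
    fix s
    have "exp (- mS * (t - s)) * norm (z s) \<le> exp (\<epsilon> * \<bar>t\<bar>) * (exp (- \<epsilon> * \<bar>s\<bar>) * norm (z s))" if "s \<le> t"
    proof -
      have "\<epsilon> * \<bar>s\<bar> \<le> \<epsilon> * (\<bar>t\<bar> + (t - s))" using assms that by (intro mult_left_mono) auto
      also have "\<dots> \<le> \<epsilon> * \<bar>t\<bar> + mS * (t - s)" using assms that by (simp add: distrib_left mult_right_mono)
      finally have "exp (- mS * (t - s)) \<le> exp (\<epsilon> * \<bar>t\<bar>) * exp (- \<epsilon> * \<bar>s\<bar>)"
        unfolding exp_add[symmetric] by simp
      then show ?thesis unfolding mult.assoc[symmetric] by (intro mult_right_mono) auto
    qed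
    then show "ennreal (exp (- mS * (t - s)) * norm (z s)) * indicator {..t} s
        \<le> ennreal (exp (\<epsilon> * \<bar>t\<bar>)) * ennreal (exp (- \<epsilon> * \<bar>s\<bar>) * norm (z s))"
      by (auto simp: indicator_def ennreal_mult[symmetric] intro!: ennreal_leI)
  qed
  also have "\<dots> = ennreal (exp (\<epsilon> * \<bar>t\<bar>)) * weighted_norm \<epsilon> z"
    unfolding weighted_norm_def by (rule nn_integral_cmult) measurable
  finally show ?thesis .
qed

lemma integrable_weighted:
  fixes f :: "real \<Rightarrow> real^'d"
  assumes [measurable]: "f \<in> borel_measurable borel" and f: "weighted_norm mS f < \<infinity>"
  shows "integrable lborel (\<lambda>s. K * (exp (- mS * \<bar>s\<bar>) * norm (f s)))"
proof (intro integrable_mult_right)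
  show "integrable lborel (\<lambda>s. exp (- mS * \<bar>s\<bar>) * norm (f s))"
    using f unfolding weighted_norm_def by (intro integrableI_nonneg) auto
qed

text \<open>The bound depends on \<open>t\<close> only through \<open>R\<close>, so it is a common
  majorant for dominated convergence in \<open>t\<close>.\<close>

lemma drift_integrand_le:
  assumes "\<bar>t\<bar> \<le> R"
  shows "norm (indicator {..t} s *\<^sub>R (S (t - s) *v f s)) \<le> cS * exp (mS * R) * (exp (- mS * \<bar>s\<bar>) * norm (f s))"
proof (cases "s \<le> t")
  case True
  have "mS * \<bar>s\<bar> \<le> mS * (R + (t - s))" using assms True S_pos by (intro mult_left_mono) auto
  then have "exp (- mS * (t - s)) \<le> exp (mS * R) * exp (- mS * \<bar>s\<bar>)"
    unfolding exp_add[symmetric] by (simp add: algebra_simps)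
  then have "cS * (exp (- mS * (t - s)) * norm (f s)) \<le> cS * (exp (mS * R) * exp (- mS * \<bar>s\<bar>) * norm (f s))"
    using S_pos by (intro mult_left_mono mult_right_mono) auto
  then show ?thesis using True norm_S_mult_le[of "t - s" "f s"] by (simp add: mult.assoc)
qed (use S_pos in auto)

lemma drift_integrable:
  assumes [measurable]: "f \<in> borel_measurable borel" and f: "weighted_norm mS f < \<infinity>"
  shows "set_integrable lborel {..t} (\<lambda>s. S (t - s) *v f s)"
  unfolding set_integrable_def
  by (rule Bochner_Integration.integrable_bound[OF integrable_weighted[OF assms, of "cS * exp (mS * \<bar>t\<bar>)"]])
    (auto simp del: norm_scaleR intro!: order_trans[OF drift_integrand_le[OF order_refl]])

lemma norm_drift_le:
  assumes i: "set_integrable lborel {..t} (\<lambda>s. S (t - s) *v f s)" and [measurable]: "f \<in> borel_measurable borel"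
  shows "ennreal (norm (drift t f)) \<le> ennreal cS * past t (\<lambda>s. norm (f s))"
proof -
  have "ennreal (norm (drift t f)) \<le> (\<integral>\<^sup>+s. ennreal (norm (indicator {..t} s *\<^sub>R (S (t - s) *v f s))) \<partial>lborel)"
    unfolding drift_def set_lebesgue_integral_def
    using i unfolding set_integrable_def by (rule integral_norm_bound_ennreal)
  also have "\<dots> \<le> past t (\<lambda>s. cS * norm (f s))"
    unfolding past_def
  proof (intro nn_integral_mono)
    fix s
    show "ennreal (norm (indicator {..t} s *\<^sub>R (S (t - s) *v f s)))
        \<le> ennreal (exp (- mS * (t - s)) * (cS * norm (f s))) * indicator {..t} s"
      using norm_S_mult_le[of "t - s" "f s"] by (auto simp: indicator_def ac_simps intro!: ennreal_leI)
  qed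
  also have "\<dots> = ennreal cS * past t (\<lambda>s. norm (f s))" using S_pos by (intro past_cmult) auto
  finally show ?thesis .
qed

lemma drift_diff:
  assumes "set_integrable lborel {..t} (\<lambda>s. S (t - s) *v f s)" "set_integrable lborel {..t} (\<lambda>s. S (t - s) *v g s)"
  shows "drift t f - drift t g = drift t (\<lambda>s. f s - g s)"
    and "set_integrable lborel {..t} (\<lambda>s. S (t - s) *v (f s - g s))"
  using set_integral_diff[OF assms] unfolding drift_def by (simp_all add: matrix_vector_mult_diff_distrib)

lemma drift_continuous:
  assumes [measurable]: "f \<in> borel_measurable borel" and f: "weighted_norm mS f < \<infinity>"
  shows "continuous_on UNIV (\<lambda>t. drift t f)"
proof -
  have "continuous (at t) (\<lambda>t. drift t f)" for t
    unfolding continuous_at_sequentially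
  proof (intro allI impI)
    fix x :: "nat \<Rightarrow> real" assume x: "x \<longlonglongrightarrow> t"
    then have "bounded (range x)" by (intro convergent_imp_bounded)
    then obtain R where R: "\<And>n. \<bar>x n\<bar> \<le> R" by (auto simp: bounded_iff)
    show "((\<lambda>t. drift t f) \<circ> x) \<longlonglongrightarrow> drift t f"
      unfolding comp_def drift_def set_lebesgue_integral_def
    proof (rule integral_dominated_convergence[where w = "\<lambda>s. cS * exp (mS * R) * (exp (- mS * \<bar>s\<bar>) * norm (f s))"])
      show "AE s in lborel. (\<lambda>n. indicator {..x n} s *\<^sub>R (S (x n - s) *v f s)) \<longlonglongrightarrow> indicator {..t} s *\<^sub>R (S (t - s) *v f s)"
        \<comment> \<open>At \<open>s = t\<close> the indicators need not converge.\<close>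
        using AE_lborel_singleton[of t]
      proof eventually_elim
        case (elim s)
        have "(\<lambda>n. S (x n - s)) \<longlonglongrightarrow> S (t - s)"
          by (rule isCont_tendsto_compose[OF _ tendsto_diff[OF x tendsto_const]])
            (use continuous_on_S in \<open>simp add: continuous_on_eq_continuous_at\<close>)
        then have 1: "(\<lambda>n. S (x n - s) *v f s) \<longlonglongrightarrow> S (t - s) *v f s"
          unfolding matrix_vector_mult_def by (intro tendsto_vec_lambda tendsto_sum tendsto_mult tendsto_vec_nth tendsto_const)
        have "\<forall>\<^sub>F n in sequentially. (indicator {..x n} s :: real) = indicator {..t} s"
        proof (cases "s < t")
          case True
          then have "\<forall>\<^sub>F n in sequentially. s < x n" using x by (intro order_tendstoD)
          then show ?thesis by (rule eventually_mono) (use True in \<open>simp add: indicator_def\<close>)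
        next
          case False
          then have "\<forall>\<^sub>F n in sequentially. x n < s" using x elim by (intro order_tendstoD) auto
          then show ?thesis by (rule eventually_mono) (use False elim in \<open>simp add: indicator_def\<close>)
        qed
        then have "(\<lambda>n. indicator {..x n} s :: real) \<longlonglongrightarrow> indicator {..t} s" by (rule tendsto_eventually)
        then show ?case using 1 by (rule tendsto_scaleR)
      qed
      show "AE s in lborel. norm (indicator {..x n} s *\<^sub>R (S (x n - s) *v f s)) \<le> cS * exp (mS * R) * (exp (- mS * \<bar>s\<bar>) * norm (f s))" for n
        by (intro AE_I2 drift_integrand_le R)
    qed (use integrable_weighted[OF assms] in auto)
  qed
  then show ?thesis by (intro continuous_at_imp_continuous_on) auto
qed

lemma drift_shift:
  assumes "\<And>s. g (s + \<tau>) = f s"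
  shows "drift (t + \<tau>) g = drift t f"
proof -
  have "drift (t + \<tau>) g = (LINT s|lborel. indicator {..t + \<tau>} (\<tau> + 1 * s) *\<^sub>R (S (t + \<tau> - (\<tau> + 1 * s)) *v g (\<tau> + 1 * s)))"
    unfolding drift_def set_lebesgue_integral_def
    by (subst lborel_integral_real_affine[where c=1 and t=\<tau>]) auto
  also have "\<dots> = drift t f"
    unfolding drift_def set_lebesgue_integral_def
    by (intro Bochner_Integration.integral_cong) (auto simp: indicator_def assms add.commute[of \<tau>])
  finally show ?thesis .
qed

text \<open>The exponent \<open>rate\<close> is small enough for the drift map to remain a contraction in the weighted
  norm \<open>sup \<bar>Y s\<bar> exp (- rate \<bar>s\<bar>)\<close>; the noise is only integrable against the weight, not bounded in this norm.\<close>

lemma rate_exists: "\<exists>\<epsilon>. 0 < \<epsilon> \<and> \<epsilon> < mS \<and> cS * cb / (mS - \<epsilon>) < 1"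
proof -
  have lt: "cS * cb < mS" using contraction S_pos by (simp add: divide_less_eq)
  have "0 < cS * cb" using S_pos b_pos by simp
  \<comment> \<open>Half of the gap between \<open>mS\<close> and \<open>cS * cb\<close>: then
    \<open>mS - \<epsilon>\<close> is the midpoint of the two, still above
    \<open>cS * cb\<close>.\<close>
  with lt S_pos have "0 < (mS - cS * cb) / 2" "(mS - cS * cb) / 2 < mS" by (simp_all add: field_simps)
  moreover have "cS * cb / (mS - (mS - cS * cb) / 2) < 1" using lt S_pos b_pos by (simp add: divide_less_eq field_simps add_pos_pos)
  ultimately show ?thesis by blast
qed

definition rate :: real where "rate = (SOME \<epsilon>. 0 < \<epsilon> \<and> \<epsilon> < mS \<and> cS * cb / (mS - \<epsilon>) < 1)"

lemma rate: "0 < rate" "rate < mS" "cS * cb / (mS - rate) < 1"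
  using someI_ex[OF rate_exists] by (auto simp: rate_def)

section \<open>Picard iteration for a given noise path\<close>

definition growth :: "real \<Rightarrow> (real \<Rightarrow> real^'d) \<Rightarrow> bool" where
  "growth C Y \<longleftrightarrow> Y \<in> borel_measurable borel \<and> 0 \<le> C \<and> (\<forall>s. norm (Y s) \<le> C * exp (rate * \<bar>s\<bar>))"

definition forcing :: "(real \<Rightarrow> real^'d) \<Rightarrow> bool" where
  "forcing z \<longleftrightarrow> z \<in> borel_measurable borel \<and> weighted_norm rate z < \<infinity>"

lemma b_growth_le:
  assumes "growth C Y"
  shows "norm (b s (Y s + z s)) \<le> mb * (1 + C) * exp (rate * \<bar>s\<bar>) + mb * norm (z s)"
proof -
  have "norm (b s (Y s + z s)) \<le> mb * (1 + norm (Y s + z s))" by (rule b_growth)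
  also have "\<dots> \<le> mb * (exp (rate * \<bar>s\<bar>) + (C * exp (rate * \<bar>s\<bar>) + norm (z s)))"
    using assms rate b_pos norm_triangle_ineq[of "Y s" "z s"]
    by (intro mult_left_mono add_mono order_trans[OF norm_triangle_ineq]) (auto simp: growth_def)
  finally show ?thesis by (simp add: algebra_simps)
qed

text \<open>The weight \<open>exp (- mS * |s|)\<close> beats the growth of \<open>Y\<close> because
  \<open>rate < mS\<close>, and for the same reason it lies below the weight against which the noise
  is integrable.\<close>

lemma weighted_norm_b:
  assumes Y: "growth C Y" and z: "forcing z"
  shows "weighted_norm mS (\<lambda>s. b s (Y s + z s)) < \<infinity>"
proof -
  have [measurable]: "z \<in> borel_measurable borel" "Y \<in> borel_measurable borel" using Y z by (auto simp: growth_def forcing_def)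
  have C: "0 \<le> mb * (1 + C)" using Y b_pos by (simp add: growth_def)
  have "weighted_norm mS (\<lambda>s. b s (Y s + z s))
      \<le> (\<integral>\<^sup>+s. ennreal (mb * (1 + C)) * ennreal (exp (- (mS - rate) * \<bar>s\<bar>)) + ennreal mb * ennreal (exp (- rate * \<bar>s\<bar>) * norm (z s)) \<partial>lborel)"
    unfolding weighted_norm_def
  proof (intro nn_integral_mono)
    fix s
    have "exp (- mS * \<bar>s\<bar>) * norm (b s (Y s + z s))
        \<le> exp (- mS * \<bar>s\<bar>) * (mb * (1 + C) * exp (rate * \<bar>s\<bar>) + mb * norm (z s))"
      by (intro mult_left_mono b_growth_le[OF Y]) auto
    also have "\<dots> = mb * (1 + C) * exp (- (mS - rate) * \<bar>s\<bar>) + exp (- mS * \<bar>s\<bar>) * (mb * norm (z s))"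
      by (simp add: distrib_left mult_exp_exp algebra_simps)
    also have "exp (- mS * \<bar>s\<bar>) * (mb * norm (z s)) \<le> exp (- rate * \<bar>s\<bar>) * (mb * norm (z s))"
      using rate b_pos by (intro mult_right_mono) (auto simp: mult_right_mono)
    finally have "exp (- mS * \<bar>s\<bar>) * norm (b s (Y s + z s))
        \<le> mb * (1 + C) * exp (- (mS - rate) * \<bar>s\<bar>) + mb * (exp (- rate * \<bar>s\<bar>) * norm (z s))"
      by (simp add: ac_simps)
    then show "ennreal (exp (- mS * \<bar>s\<bar>) * norm (b s (Y s + z s)))
        \<le> ennreal (mb * (1 + C)) * ennreal (exp (- (mS - rate) * \<bar>s\<bar>)) + ennreal mb * ennreal (exp (- rate * \<bar>s\<bar>) * norm (z s))"
      using C b_pos by (simp add: ennreal_mult[symmetric] ennreal_plus[symmetric] ennreal_leI del: ennreal_plus)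
  qed
  also have "\<dots> = ennreal (mb * (1 + C)) * (\<integral>\<^sup>+s. ennreal (exp (- (mS - rate) * \<bar>s\<bar>)) \<partial>lborel) + ennreal mb * weighted_norm rate z"
    unfolding weighted_norm_def by (subst nn_integral_add) (auto simp: nn_integral_cmult)
  also have "\<dots> < \<infinity>"
    using nn_integral_exp_abs_finite[of "mS - rate"] rate z by (auto simp: forcing_def ennreal_mult_less_top)
  finally show ?thesis .
qed

lemma measurable_b_growth: "growth C Y \<Longrightarrow> forcing z \<Longrightarrow> (\<lambda>s. b s (Y s + z s)) \<in> borel_measurable borel"
  by (intro measurable_b) (auto simp: growth_def forcing_def)

text \<open>Averaging over the past turns a forcing that is only integrable into a pointwise growth
  bound, so the iterates stay in the class \<open>growth\<close>, to which \<open>z\<close> need not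
  belong.\<close>

lemma drift_b_growth:
  assumes Y: "growth C Y" and z: "forcing z"
  shows "\<exists>C'. growth C' (\<lambda>t. drift t (\<lambda>s. b s (Y s + z s)))"
proof -
  note m[measurable] = measurable_b_growth[OF Y z]
  have [measurable]: "z \<in> borel_measurable borel" using z by (simp add: forcing_def)
  have C: "0 \<le> mb * (1 + C)" using Y b_pos by (simp add: growth_def)
  obtain w where w: "weighted_norm rate z = ennreal w" "0 \<le> w"
    using z by (auto simp: forcing_def less_top_ennreal)
  define K where "K = cS * (mb * (1 + C) / (mS - rate) + mb * w)"
  have le: "norm (drift t (\<lambda>s. b s (Y s + z s))) \<le> K * exp (rate * \<bar>t\<bar>)" for t
  proof -
    have "ennreal (norm (drift t (\<lambda>s. b s (Y s + z s)))) \<le> ennreal cS * past t (\<lambda>s. norm (b s (Y s + z s)))"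
      by (rule norm_drift_le[OF drift_integrable[OF m weighted_norm_b[OF Y z]] m])
    also have "past t (\<lambda>s. norm (b s (Y s + z s))) \<le> past t (\<lambda>s. mb * (1 + C) * exp (rate * \<bar>s\<bar>) + mb * norm (z s))"
      by (intro past_mono b_growth_le[OF Y])
    also have "\<dots> = ennreal (mb * (1 + C)) * past t (\<lambda>s. exp (rate * \<bar>s\<bar>)) + ennreal mb * past t (\<lambda>s. norm (z s))"
      using C b_pos by (subst past_add) (auto simp: past_cmult)
    also have "\<dots> \<le> ennreal (mb * (1 + C)) * ennreal (exp (rate * \<bar>t\<bar>) / (mS - rate)) + ennreal mb * (ennreal (exp (rate * \<bar>t\<bar>)) * ennreal w)"
      using rate past_weighted[of z rate t] by (intro add_mono mult_left_mono past_exp) (auto simp: w)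
    also have "\<dots> = ennreal (mb * (1 + C) * (exp (rate * \<bar>t\<bar>) / (mS - rate)) + mb * (exp (rate * \<bar>t\<bar>) * w))"
      using C rate b_pos w by (simp add: ennreal_mult[symmetric] ennreal_plus[symmetric] del: ennreal_plus)
    finally have "ennreal (norm (drift t (\<lambda>s. b s (Y s + z s))))
        \<le> ennreal cS * ennreal (mb * (1 + C) * (exp (rate * \<bar>t\<bar>) / (mS - rate)) + mb * (exp (rate * \<bar>t\<bar>) * w))"
      by (simp add: mult_left_mono)
    also have "\<dots> = ennreal (K * exp (rate * \<bar>t\<bar>))"
      using S_pos by (simp add: ennreal_mult'[symmetric] K_def algebra_simps add_divide_distrib)
    finally show ?thesis using C rate b_pos w S_pos by (subst (asm) ennreal_le_iff) (auto simp: K_def)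
  qed
  have "(\<lambda>t. drift t (\<lambda>s. b s (Y s + z s))) \<in> borel_measurable borel"
    by (rule borel_measurable_continuous_onI[OF drift_continuous[OF m weighted_norm_b[OF Y z]]])
  moreover have "0 \<le> K" using C rate b_pos w S_pos by (simp add: K_def)
  ultimately show ?thesis using le unfolding growth_def by blast
qed

text \<open>The forcing cancels inside the Lipschitz bound, so the difference is measured in the
  growth norm alone, and \<open>past_exp\<close> supplies the factor
  \<open>1 / (mS - rate)\<close>.\<close>

lemma drift_b_contraction:
  assumes Y: "growth C Y" and Y': "growth C' Y'" and z: "forcing z" and D: "0 \<le> D"
    and le: "\<And>s. norm (Y s - Y' s) \<le> D * exp (rate * \<bar>s\<bar>)"
  shows "norm (drift t (\<lambda>s. b s (Y s + z s)) - drift t (\<lambda>s. b s (Y' s + z s)))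
     \<le> cS * cb / (mS - rate) * D * exp (rate * \<bar>t\<bar>)"
proof -
  note m[measurable] = measurable_b_growth[OF Y z] measurable_b_growth[OF Y' z]
  note i = drift_integrable[OF m(1) weighted_norm_b[OF Y z]] drift_integrable[OF m(2) weighted_norm_b[OF Y' z]]
  have "ennreal (norm (drift t (\<lambda>s. b s (Y s + z s)) - drift t (\<lambda>s. b s (Y' s + z s))))
      \<le> ennreal cS * past t (\<lambda>s. norm (b s (Y s + z s) - b s (Y' s + z s)))"
    unfolding drift_diff(1)[OF i] by (rule norm_drift_le[OF drift_diff(2)[OF i]]) measurable
  also have "\<dots> \<le> ennreal cS * past t (\<lambda>s. cb * D * exp (rate * \<bar>s\<bar>))"
  proof (intro mult_left_mono past_mono)
    fix s
    have "norm (b s (Y s + z s) - b s (Y' s + z s)) \<le> cb * norm (Y s - Y' s)"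
      using b_lipschitz[of s "Y s + z s" "Y' s + z s"] by simp
    also have "\<dots> \<le> cb * (D * exp (rate * \<bar>s\<bar>))" using b_pos by (intro mult_left_mono le) auto
    finally show "norm (b s (Y s + z s) - b s (Y' s + z s)) \<le> cb * D * exp (rate * \<bar>s\<bar>)" by (simp add: mult.assoc)
  qed auto
  also have "\<dots> = ennreal cS * (ennreal (cb * D) * past t (\<lambda>s. exp (rate * \<bar>s\<bar>)))"
    using b_pos D by (subst past_cmult) auto
  also have "\<dots> \<le> ennreal cS * (ennreal (cb * D) * ennreal (exp (rate * \<bar>t\<bar>) / (mS - rate)))"
    using rate by (intro mult_left_mono past_exp) auto
  also have "\<dots> = ennreal (cS * cb / (mS - rate) * D * exp (rate * \<bar>t\<bar>))"
    using b_pos D S_pos rate by (simp add: ennreal_mult[symmetric])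
  finally show ?thesis using b_pos D S_pos rate by (subst (asm) ennreal_le_iff) auto
qed

primrec picard :: "(real \<Rightarrow> real^'d) \<Rightarrow> nat \<Rightarrow> real \<Rightarrow> real^'d" where
  "picard z 0 = (\<lambda>t. 0)"
| "picard z (Suc n) = (\<lambda>t. drift t (\<lambda>s. b s (picard z n s + z s)))"

definition fixpoint :: "(real \<Rightarrow> real^'d) \<Rightarrow> real \<Rightarrow> real^'d" where
  "fixpoint z t = lim (\<lambda>n. picard z n t)"

lemma picard_growth:
  assumes z: "forcing z"
  shows "\<exists>C. growth C (picard z n)"
proof (induction n)
  case 0
  show ?case by (intro exI[of _ 0]) (simp add: growth_def)
next
  case (Suc n)
  then show ?case using drift_b_growth[OF _ z] by auto
qed

lemma picard_continuous:
  assumes z: "forcing z"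
  shows "continuous_on UNIV (picard z n)"
proof (cases n)
  case (Suc k)
  obtain C where "growth C (picard z k)" using picard_growth[OF z] by blast
  then show ?thesis unfolding Suc picard.simps
    using drift_continuous[OF measurable_b_growth[OF _ z] weighted_norm_b[OF _ z]] by blast
qed simp

lemma picard_shift:
  assumes "\<And>s. z' (s + \<tau>) = z s"
  shows "picard z' n (t + \<tau>) = picard z n t"
proof (induction n arbitrary: t)
  case (Suc n)
  show ?case unfolding picard.simps by (rule drift_shift) (simp add: b_periodic assms Suc)
qed simp

lemma fixpoint_shift: "(\<And>s. z' (s + \<tau>) = z s) \<Longrightarrow> fixpoint z' (t + \<tau>) = fixpoint z t"
  by (simp add: fixpoint_def picard_shift)

lemma fixpoint:
  assumes z: "forcing z"
  shows "(\<lambda>n. picard z n t) \<longlonglongrightarrow> fixpoint z t"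
    and "fixpoint z t = drift t (\<lambda>s. b s (fixpoint z s + z s))"
    and "set_integrable lborel {..t} (\<lambda>s. S (t - s) *v b s (fixpoint z s + z s))"
    and "continuous_on UNIV (fixpoint z)"
proof -
  define q where "q = cS * cb / (mS - rate)"
  have q: "0 < q" "q < 1" using rate S_pos b_pos by (auto simp: q_def)
  obtain C1 where "growth C1 (picard z (Suc 0))" using picard_growth[OF z] by blast
  then have C1: "0 \<le> C1" "\<And>s. norm (picard z (Suc 0) s) \<le> C1 * exp (rate * \<bar>s\<bar>)" unfolding growth_def by blast+
  have step: "norm (picard z (Suc n) s - picard z n s) \<le> C1 * q ^ n * exp (rate * \<bar>s\<bar>)" for n s
  proof (induction n arbitrary: s)
    case 0
    show ?case using C1(2)[of s] by simp
  next
    case (Suc n)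
    obtain C C' where "growth C (picard z (Suc n))" "growth C' (picard z n)" using picard_growth[OF z] by blast
    from drift_b_contraction[OF this z _ Suc, of s] C1 q
    show ?case by (simp add: q_def ac_simps)
  qed
  \<comment> \<open>The sum of the geometric step bounds; since the zeroth iterate is 0, it also
    bounds the growth of the limit.\<close>
  define K where "K = C1 / (1 - q)"
  have K: "0 \<le> K" using C1 q by (simp add: K_def)
  have geo: "summable (\<lambda>k. C1 * q ^ (k + n) * exp (rate * \<bar>s\<bar>))" "(\<Sum>k. C1 * q ^ (k + n) * exp (rate * \<bar>s\<bar>)) = K * q ^ n * exp (rate * \<bar>s\<bar>)" for n s
  proof -
    have "(\<lambda>k. (C1 * q ^ n * exp (rate * \<bar>s\<bar>)) * q ^ k) sums ((C1 * q ^ n * exp (rate * \<bar>s\<bar>)) * (1 / (1 - q)))"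
      using q by (intro sums_mult geometric_sums) auto
    then have "(\<lambda>k. C1 * q ^ (k + n) * exp (rate * \<bar>s\<bar>)) sums (K * q ^ n * exp (rate * \<bar>s\<bar>))"
      by (simp add: K_def power_add ac_simps)
    then show "summable (\<lambda>k. C1 * q ^ (k + n) * exp (rate * \<bar>s\<bar>))" "(\<Sum>k. C1 * q ^ (k + n) * exp (rate * \<bar>s\<bar>)) = K * q ^ n * exp (rate * \<bar>s\<bar>)"
      by (auto simp: sums_iff)
  qed
  have sn: "summable (\<lambda>k. norm (picard z (Suc (k + n)) s - picard z (k + n) s))" for n s
    by (rule summable_comparison_test[OF _ geo(1)[of n s]]) (use step in auto)
  have lim: "(\<lambda>n. picard z n s) \<longlonglongrightarrow> fixpoint z s" for s
    unfolding fixpoint_def using sn[of 0 s] by (intro convergent_of_summable_diff) simp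
  then show "(\<lambda>n. picard z n t) \<longlonglongrightarrow> fixpoint z t" .
  have err: "norm (fixpoint z s - picard z n s) \<le> K * q ^ n * exp (rate * \<bar>s\<bar>)" for n s
  proof -
    let ?x = "\<lambda>k. picard z (k + n) s"
    have "(\<lambda>k. ?x (Suc k) - ?x k) sums (fixpoint z s - ?x 0)"
      by (rule telescope_sums[OF LIMSEQ_ignore_initial_segment[OF lim]])
    then have "fixpoint z s - picard z n s = (\<Sum>k. ?x (Suc k) - ?x k)" by (simp add: sums_iff)
    also have "norm \<dots> \<le> (\<Sum>k. norm (?x (Suc k) - ?x k))" using sn[of n s] by (intro summable_norm) simp
    also have "\<dots> \<le> (\<Sum>k. C1 * q ^ (k + n) * exp (rate * \<bar>s\<bar>))"
      using step[of "_ + n" s] sn[of n s] geo(1)[of n s] by (intro suminf_le) auto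
    finally show ?thesis unfolding geo(2) .
  qed
  have "(\<lambda>t. fixpoint z t) \<in> borel_measurable borel"
    by (rule borel_measurable_LIMSEQ_metric[OF _ lim])
      (use picard_growth[OF z] in \<open>auto simp: growth_def\<close>)
  then have gf: "growth K (fixpoint z)" unfolding growth_def using K err[of _ 0] by auto
  show eq: "fixpoint z t = drift t (\<lambda>s. b s (fixpoint z s + z s))" for t
  \<comment> \<open>The limit passes through the drift by the contraction estimate itself, applied
    to an iterate and the limit.\<close>
  proof (rule LIMSEQ_unique)
    show "(\<lambda>n. picard z (Suc n) t) \<longlonglongrightarrow> fixpoint z t" using lim by (rule LIMSEQ_Suc)
    show "(\<lambda>n. picard z (Suc n) t) \<longlonglongrightarrow> drift t (\<lambda>s. b s (fixpoint z s + z s))"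
    proof (rule LIM_zero_cancel, rule Lim_null_comparison)
      show "\<forall>\<^sub>F n in sequentially. norm (picard z (Suc n) t - drift t (\<lambda>s. b s (fixpoint z s + z s)))
          \<le> (q * K * exp (rate * \<bar>t\<bar>)) * q ^ n"
      proof (intro always_eventually allI)
        fix n
        obtain C where C: "growth C (picard z n)" using picard_growth[OF z] by blast
        have "norm (picard z n s - fixpoint z s) \<le> K * q ^ n * exp (rate * \<bar>s\<bar>)" for s
          using err[of s n] by (simp add: norm_minus_commute)
        from drift_b_contraction[OF C gf z _ this, of t] K q
        show "norm (picard z (Suc n) t - drift t (\<lambda>s. b s (fixpoint z s + z s))) \<le> (q * K * exp (rate * \<bar>t\<bar>)) * q ^ n"
          by (simp add: q_def ac_simps)
      qed
      have "(\<lambda>n. (q * K * exp (rate * \<bar>t\<bar>)) * q ^ n) \<longlonglongrightarrow> (q * K * exp (rate * \<bar>t\<bar>)) * 0"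
        using q by (intro tendsto_intros LIMSEQ_power_zero) auto
      then show "(\<lambda>n. (q * K * exp (rate * \<bar>t\<bar>)) * q ^ n) \<longlonglongrightarrow> 0" by simp
    qed
  qed
  note m = measurable_b_growth[OF gf z] weighted_norm_b[OF gf z]
  show "set_integrable lborel {..t} (\<lambda>s. S (t - s) *v b s (fixpoint z s + z s))" by (rule drift_integrable[OF m])
  have "fixpoint z = (\<lambda>t. drift t (\<lambda>s. b s (fixpoint z s + z s)))" using eq by (rule ext)
  then show "continuous_on UNIV (fixpoint z)" using drift_continuous[OF m] by metis
qed

end

section \<open>Second moments and uniqueness\<close>

lemma continuous_process_add:
  fixes X Y :: "real \<Rightarrow> 'w \<Rightarrow> 'b::{real_normed_vector, second_countable_topology}"
  assumes "continuous_process M X" "continuous_process M Y"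
  shows "continuous_process M (\<lambda>t \<omega>. X t \<omega> + Y t \<omega>)"
  using assms unfolding continuous_process_def
  by (intro conjI allI ballI borel_measurable_add continuous_on_add) auto

context semilinear_setting
begin

section \<open>Measurability of iterates and fixed point in the path\<close>

abbreviation noise :: "(real \<Rightarrow> real^'d) \<Rightarrow> real \<Rightarrow> real^'d" where
  "noise \<omega> \<equiv> \<lambda>s. conv rate s \<omega>"

lemma forcing_noise: "forcing (noise \<omega>)"
  using conv_continuous conv_weighted_norm by (simp add: forcing_def borel_measurable_continuous_onI)

lemma measurable_drift_process:
  assumes W: "continuous_process P W"
  shows "(\<lambda>\<omega>. drift t (\<lambda>s. b s (W s \<omega>))) \<in> borel_measurable P"
proof -
  note [measurable] = measurable_swap_lborel[OF continuous_process_jointly_measurable[OF W]]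
  have "(\<lambda>p. indicator {..t} (snd p) *\<^sub>R (S (t - snd p) *v b (snd p) (W (snd p) (fst p)))) \<in> borel_measurable (P \<Otimes>\<^sub>M lborel)"
    by measurable
  then show ?thesis unfolding drift_def set_lebesgue_integral_def
    by (intro lborel.borel_measurable_lebesgue_integral) (simp add: case_prod_beta)
qed

text \<open>The drift of a process is measurable in the path once the process is jointly measurable,
  which path continuity of the previous iterate supplies.\<close>

lemma picard_process: "continuous_process P (\<lambda>t \<omega>. picard (noise \<omega>) n t)"
proof -
  have "(\<lambda>\<omega>. picard (noise \<omega>) n t) \<in> borel_measurable P" for t
  proof (induction n arbitrary: t)
    case (Suc n)
    have "continuous_process P (\<lambda>t \<omega>. picard (noise \<omega>) n t)"
      using Suc picard_continuous[OF forcing_noise] by (simp add: continuous_process_def)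
    from measurable_drift_process[OF continuous_process_add[OF this conv_continuous_process[of rate]], of t]
    show ?case by (simp only: picard.simps)
  qed simp
  then show ?thesis using picard_continuous[OF forcing_noise] by (simp add: continuous_process_def)
qed

lemma fixpoint_process: "continuous_process P (\<lambda>t \<omega>. fixpoint (noise \<omega>) t)"
proof -
  have "(\<lambda>\<omega>. fixpoint (noise \<omega>) t) \<in> borel_measurable P" for t
    by (rule borel_measurable_LIMSEQ_metric[OF _ fixpoint(1)[OF forcing_noise]])
      (use picard_process in \<open>simp add: continuous_process_def\<close>)
  then show ?thesis using fixpoint(4)[OF forcing_noise] by (simp add: continuous_process_def)
qed

text \<open>Cauchy-Schwarz after splitting the exponential into two equal square roots; the factor
  \<open>1 / mS\<close> is the mass of the weight.\<close>

lemma past_square_le: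
  assumes [measurable]: "f \<in> borel_measurable borel" and f: "\<And>s. 0 \<le> f s"
  shows "(past t f)\<^sup>2 \<le> ennreal (1 / mS) * past t (\<lambda>s. (f s)\<^sup>2)"
proof -
  define e where "e s = exp (- mS * (t - s) / 2)" for s
  have e2: "e s * e s = exp (- mS * (t - s))" for s by (simp add: e_def mult_exp_exp field_simps)
  have [measurable]: "e \<in> borel_measurable borel" unfolding e_def[abs_def] by measurable
  define u where "u s = ennreal (e s) * indicator {..t} s" for s
  define v where "v s = ennreal (e s * f s) * indicator {..t} s" for s
  have e0: "0 \<le> e s" for s by (simp add: e_def)
  have uv: "past t f = (\<integral>\<^sup>+s. u s * v s \<partial>lborel)"
    unfolding past_def u_def v_def e2[symmetric]
    by (intro nn_integral_cong) (auto simp: indicator_def ennreal_mult[symmetric] e0 f mult.assoc)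
  have u2: "(\<integral>\<^sup>+s. (u s)\<^sup>2 \<partial>lborel) = ennreal (1 / mS)"
    unfolding nn_integral_exp_past[OF S_pos(2), of t, symmetric] u_def e2[symmetric]
    by (intro nn_integral_cong) (auto simp: indicator_def power2_eq_square ennreal_mult[symmetric] e0)
  have v2: "(\<integral>\<^sup>+s. (v s)\<^sup>2 \<partial>lborel) = past t (\<lambda>s. (f s)\<^sup>2)"
    unfolding past_def v_def e2[symmetric]
    by (intro nn_integral_cong) (auto simp: indicator_def power2_eq_square ennreal_mult[symmetric] e0 f ac_simps)
  show ?thesis
    using Cauchy_Schwarz_nn_integral[of u lborel v] unfolding uv u2 v2
    by (simp add: u_def[abs_def] v_def[abs_def])
qed

lemma measurable_past_process:
  assumes F: "(\<lambda>p. F (fst p) (snd p)) \<in> borel_measurable (borel \<Otimes>\<^sub>M P)"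
  shows "(\<lambda>\<omega>. past t (\<lambda>s. F s \<omega>)) \<in> borel_measurable P"
proof -
  note [measurable] = measurable_swap_lborel[OF F]
  have "(\<lambda>p. ennreal (exp (- mS * (t - snd p)) * (F (snd p) (fst p))) * indicator {..t} (snd p)) \<in> borel_measurable (P \<Otimes>\<^sub>M lborel)"
    by measurable
  then show ?thesis unfolding past_def by (intro lborel.borel_measurable_nn_integral) (simp add: case_prod_beta)
qed

text \<open>One factor \<open>1 / mS\<close> comes from Cauchy-Schwarz, the other from the weight
  after exchanging the integrals. Together with \<open>cS\<close> and \<open>cb\<close> this gives
  exactly the constant of the contraction hypothesis for root mean squares.\<close>

lemma past_second_moment_le:
  assumes F[measurable]: "(\<lambda>p. F (fst p) (snd p)) \<in> borel_measurable (borel \<Otimes>\<^sub>M P)"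
    and F0: "\<And>s \<omega>. 0 \<le> F s \<omega>" and B: "\<And>s. (\<integral>\<^sup>+\<omega>. ennreal ((F s \<omega>)\<^sup>2) \<partial>P) \<le> B"
  shows "(\<integral>\<^sup>+\<omega>. (past t (\<lambda>s. F s \<omega>))\<^sup>2 \<partial>P) \<le> ennreal (1 / mS\<^sup>2) * B"
proof -
  interpret pair_sigma_finite P lborel by unfold_locales
  note Fm[measurable] = measurable_swap_lborel[OF F]
  have Fs[measurable]: "(\<lambda>s. F s \<omega>) \<in> borel_measurable borel" if "\<omega> \<in> space P" for \<omega>
    using measurable_compose[OF measurable_Pair1'[OF that, of lborel] Fm] by simp
  have Fw[measurable]: "F s \<in> borel_measurable P" for s
    using measurable_compose[OF measurable_Pair1'[of s borel P] F] by simp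
  have m: "(\<lambda>p. ennreal (exp (- mS * (t - snd p)) * (F (snd p) (fst p))\<^sup>2) * indicator {..t} (snd p)) \<in> borel_measurable (P \<Otimes>\<^sub>M lborel)"
    by measurable
  have "(\<integral>\<^sup>+\<omega>. (past t (\<lambda>s. F s \<omega>))\<^sup>2 \<partial>P) \<le> (\<integral>\<^sup>+\<omega>. ennreal (1 / mS) * past t (\<lambda>s. (F s \<omega>)\<^sup>2) \<partial>P)"
    using F0 Fs by (intro nn_integral_mono past_square_le) auto
  also have "\<dots> = ennreal (1 / mS) * (\<integral>\<^sup>+\<omega>. past t (\<lambda>s. (F s \<omega>)\<^sup>2) \<partial>P)"
    unfolding past_def using m
    by (intro nn_integral_cmult lborel.borel_measurable_nn_integral) (simp add: case_prod_beta)
  also have "(\<integral>\<^sup>+\<omega>. past t (\<lambda>s. (F s \<omega>)\<^sup>2) \<partial>P)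
      = (\<integral>\<^sup>+s. \<integral>\<^sup>+\<omega>. ennreal (exp (- mS * (t - s)) * (F s \<omega>)\<^sup>2) * indicator {..t} s \<partial>P \<partial>lborel)"
    unfolding past_def
    using Fubini'[of "\<lambda>\<omega> s. ennreal (exp (- mS * (t - s)) * (F s \<omega>)\<^sup>2) * indicator {..t} s"] m
    by (simp add: case_prod_beta)
  also have "\<dots> = (\<integral>\<^sup>+s. (ennreal (exp (- mS * (t - s))) * indicator {..t} s) * (\<integral>\<^sup>+\<omega>. ennreal ((F s \<omega>)\<^sup>2) \<partial>P) \<partial>lborel)"
    by (intro nn_integral_cong) (simp add: ennreal_mult nn_integral_cmult nn_integral_multc ac_simps)
  also have "\<dots> \<le> (\<integral>\<^sup>+s. (ennreal (exp (- mS * (t - s))) * indicator {..t} s) * B \<partial>lborel)"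
    by (intro nn_integral_mono mult_left_mono B) auto
  also have "\<dots> = ennreal (1 / mS) * B"
    using nn_integral_exp_past[OF S_pos(2), of t] by (simp add: nn_integral_multc)
  finally have "(\<integral>\<^sup>+\<omega>. (past t (\<lambda>s. F s \<omega>))\<^sup>2 \<partial>P) \<le> ennreal (1 / mS) * (ennreal (1 / mS) * B)"
    by (simp add: mult_left_mono)
  also have "\<dots> = ennreal (1 / mS\<^sup>2) * B"
    using S_pos by (simp add: mult.assoc[symmetric] ennreal_mult[symmetric] power2_eq_square)
  finally show ?thesis .
qed

definition conv_const :: real where "conv_const = real CARD('d) ^ 3 * tail_const"

lemma conv_const: "0 \<le> conv_const" "L2_dist_sq P (conv rate t) (\<lambda>_. 0) \<le> ennreal conv_const"
  using conv_bound[OF rate(1)] tail_const by (simp_all add: conv_const_def)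

definition contr :: real where "contr = (cS * cb / mS)\<^sup>2"

lemma contr: "0 < contr" "contr < 1"
proof -
  have pos: "0 < cS * cb / mS" using S_pos b_pos by simp
  show "0 < contr" unfolding contr_def by (rule zero_less_power[OF pos])
  show "contr < 1" unfolding contr_def using pos contraction by (intro power_less_one_iff[THEN iffD2]) auto
qed

text \<open>An affine recursion for the moment bound: the part linear in the iterate gets the
  coefficient \<open>contr\<close> up to \<open>1 + r\<close>, while noise and inhomogeneity go into
  the additive term, which may be large.\<close>

lemma picard_second_moment_step:
  assumes r: "0 < r" and M: "0 \<le> M" and IH: "\<And>s. L2_dist_sq P (\<lambda>\<omega>. picard (noise \<omega>) n s) (\<lambda>_. 0) \<le> ennreal M"
  shows "L2_dist_sq P (\<lambda>\<omega>. picard (noise \<omega>) (Suc n) t) (\<lambda>_. 0)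
    \<le> ennreal ((1 + r) * contr * M + (cS / mS)\<^sup>2 * ((1 + 1 / r) * (2 * mb\<^sup>2 + 2 * cb\<^sup>2 * conv_const)))"
proof -
  define F where "F s \<omega> = mb + cb * norm (picard (noise \<omega>) n s + conv rate s \<omega>)" for s \<omega>
  define B where "B = (1 + r) * cb\<^sup>2 * M + (1 + 1 / r) * (2 * mb\<^sup>2 + 2 * cb\<^sup>2 * conv_const)"
  have cp: "continuous_process P (\<lambda>s \<omega>. picard (noise \<omega>) n s + conv rate s \<omega>)"
    by (rule continuous_process_add[OF picard_process conv_continuous_process])
  have [measurable]: "(\<lambda>\<omega>. picard (noise \<omega>) n s) \<in> borel_measurable P" for s
    using picard_process[of n] by (simp add: continuous_process_def)
  have "(\<lambda>x. mb + cb * norm x) \<in> borel_measurable (borel :: (real^'d) measure)" by measurable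
  from measurable_compose[OF continuous_process_jointly_measurable[OF cp] this]
  have F: "(\<lambda>p. F (fst p) (snd p)) \<in> borel_measurable (borel \<Otimes>\<^sub>M P)" unfolding F_def .
  have F0: "0 \<le> F s \<omega>" for s \<omega> using b_pos by (simp add: F_def)
  have FB: "(\<integral>\<^sup>+\<omega>. ennreal ((F s \<omega>)\<^sup>2) \<partial>P) \<le> ennreal B" for s
  proof -
    let ?y = "\<lambda>\<omega>. picard (noise \<omega>) n s" and ?z = "\<lambda>\<omega>. conv rate s \<omega>"
    have pt: "(F s \<omega>)\<^sup>2 \<le> (1 + r) * cb\<^sup>2 * (norm (?y \<omega>))\<^sup>2 + (1 + 1 / r) * (2 * mb\<^sup>2 + 2 * cb\<^sup>2 * (norm (?z \<omega>))\<^sup>2)" for \<omega>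
    proof -
      have "cb * norm (?y \<omega> + ?z \<omega>) \<le> cb * (norm (?y \<omega>) + norm (?z \<omega>))"
        using b_pos by (intro mult_left_mono norm_triangle_ineq) auto
      then have "F s \<omega> \<le> cb * norm (?y \<omega>) + (mb + cb * norm (?z \<omega>))" by (simp add: F_def algebra_simps)
      then have "(F s \<omega>)\<^sup>2 \<le> (cb * norm (?y \<omega>) + (mb + cb * norm (?z \<omega>)))\<^sup>2" using F0 by (rule power_mono)
      also have "\<dots> \<le> (1 + r) * (cb * norm (?y \<omega>))\<^sup>2 + (1 + 1 / r) * (mb + cb * norm (?z \<omega>))\<^sup>2"
        by (rule power2_add_weighted[OF r])
      also have "\<dots> \<le> (1 + r) * (cb * norm (?y \<omega>))\<^sup>2 + (1 + 1 / r) * ((1 + 1) * mb\<^sup>2 + (1 + 1 / 1) * (cb * norm (?z \<omega>))\<^sup>2)"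
        using r by (intro add_left_mono mult_left_mono power2_add_weighted) auto
      finally show ?thesis by (simp add: power_mult_distrib mult.assoc)
    qed
    have "(\<integral>\<^sup>+\<omega>. ennreal ((F s \<omega>)\<^sup>2) \<partial>P)
        \<le> (\<integral>\<^sup>+\<omega>. ennreal ((1 + r) * cb\<^sup>2) * ennreal ((norm (?y \<omega> - 0))\<^sup>2)
            + (ennreal ((1 + 1 / r) * (2 * mb\<^sup>2)) + ennreal ((1 + 1 / r) * (2 * cb\<^sup>2)) * ennreal ((norm (?z \<omega> - 0))\<^sup>2)) \<partial>P)"
    proof (intro nn_integral_mono)
      fix \<omega>
      have "(F s \<omega>)\<^sup>2 \<le> (1 + r) * cb\<^sup>2 * (norm (?y \<omega>))\<^sup>2 + ((1 + 1 / r) * (2 * mb\<^sup>2) + (1 + 1 / r) * (2 * cb\<^sup>2) * (norm (?z \<omega>))\<^sup>2)"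
        using pt[of \<omega>] by (simp add: distrib_left mult.assoc)
      then show "ennreal ((F s \<omega>)\<^sup>2) \<le> ennreal ((1 + r) * cb\<^sup>2) * ennreal ((norm (?y \<omega> - 0))\<^sup>2)
            + (ennreal ((1 + 1 / r) * (2 * mb\<^sup>2)) + ennreal ((1 + 1 / r) * (2 * cb\<^sup>2)) * ennreal ((norm (?z \<omega> - 0))\<^sup>2))"
        using r by (simp add: ennreal_mult[symmetric] ennreal_plus[symmetric] ennreal_leI del: ennreal_plus)
    qed
    also have "\<dots> = ennreal ((1 + r) * cb\<^sup>2) * L2_dist_sq P ?y (\<lambda>_. 0)
        + (ennreal ((1 + 1 / r) * (2 * mb\<^sup>2)) + ennreal ((1 + 1 / r) * (2 * cb\<^sup>2)) * L2_dist_sq P ?z (\<lambda>_. 0))"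
      unfolding L2_dist_sq_def by (simp add: nn_integral_add nn_integral_cmult comp.emeasure_space_1)
    also have "\<dots> \<le> ennreal ((1 + r) * cb\<^sup>2) * ennreal M
        + (ennreal ((1 + 1 / r) * (2 * mb\<^sup>2)) + ennreal ((1 + 1 / r) * (2 * cb\<^sup>2)) * ennreal conv_const)"
      by (intro add_mono mult_left_mono IH conv_const order_refl) auto
    also have "\<dots> = ennreal B"
      using r M conv_const(1) by (simp add: B_def ennreal_mult[symmetric] ennreal_plus[symmetric] algebra_simps del: ennreal_plus)
    finally show ?thesis .
  qed
  have pt: "ennreal ((norm (picard (noise \<omega>) (Suc n) t))\<^sup>2) \<le> ennreal (cS\<^sup>2) * (past t (\<lambda>s. F s \<omega>))\<^sup>2" for \<omega>
  proof -
    obtain C where C: "growth C (picard (noise \<omega>) n)" using picard_growth[OF forcing_noise] by blast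
    note m = measurable_b_growth[OF C forcing_noise]
    have "ennreal (norm (picard (noise \<omega>) (Suc n) t)) \<le> ennreal cS * past t (\<lambda>s. norm (b s (picard (noise \<omega>) n s + conv rate s \<omega>)))"
      unfolding picard.simps by (rule norm_drift_le[OF drift_integrable[OF m weighted_norm_b[OF C forcing_noise]] m])
    also have "\<dots> \<le> ennreal cS * past t (\<lambda>s. F s \<omega>)"
    proof (intro mult_left_mono past_mono)
      fix s
      let ?x = "picard (noise \<omega>) n s + conv rate s \<omega>"
      \<comment> \<open>The Lipschitz bound started at 0 gives the slope \<open>cb\<close>, which
        the contraction hypothesis controls; the slope \<open>mb\<close> of the growth bound need
        not be small.\<close>
      have "norm (b s ?x) \<le> norm (b s 0) + norm (b s ?x - b s 0)" by (metis add.commute diff_add_cancel norm_triangle_ineq)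
      then show "norm (b s ?x) \<le> F s \<omega>"
        using b_growth[of s 0] b_lipschitz[of s ?x 0] by (simp add: F_def)
    qed auto
    finally have "(ennreal (norm (picard (noise \<omega>) (Suc n) t)))\<^sup>2 \<le> (ennreal cS * past t (\<lambda>s. F s \<omega>))\<^sup>2"
      by (rule power_mono) auto
    then show ?thesis using S_pos by (simp add: power_mult_distrib ennreal_power)
  qed
  have "L2_dist_sq P (\<lambda>\<omega>. picard (noise \<omega>) (Suc n) t) (\<lambda>_. 0) \<le> (\<integral>\<^sup>+\<omega>. ennreal (cS\<^sup>2) * (past t (\<lambda>s. F s \<omega>))\<^sup>2 \<partial>P)"
    unfolding L2_dist_sq_def diff_zero by (intro nn_integral_mono pt)
  also have "\<dots> \<le> ennreal (cS\<^sup>2) * (ennreal (1 / mS\<^sup>2) * ennreal B)"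
  proof -
    note [measurable] = measurable_past_process[OF F, of t]
    show ?thesis using past_second_moment_le[OF F F0 FB, of t] by (simp add: nn_integral_cmult mult_left_mono)
  qed
  also have "\<dots> = ennreal ((1 + r) * contr * M + (cS / mS)\<^sup>2 * ((1 + 1 / r) * (2 * mb\<^sup>2 + 2 * cb\<^sup>2 * conv_const)))"
  proof -
    have "0 \<le> B" using r M conv_const(1) by (simp add: B_def)
    moreover have "cS\<^sup>2 * (1 / mS\<^sup>2 * B) = (1 + r) * contr * M + (cS / mS)\<^sup>2 * ((1 + 1 / r) * (2 * mb\<^sup>2 + 2 * cb\<^sup>2 * conv_const))"
      by (simp add: B_def contr_def power_divide power_mult_distrib distrib_left add_divide_distrib mult.assoc mult.left_commute[of "1 + r"])
    ultimately show ?thesis by (simp add: ennreal_mult[symmetric])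
  qed
  finally show ?thesis .
qed

lemma picard_second_moment: "\<exists>M\<ge>0. \<forall>n t. L2_dist_sq P (\<lambda>\<omega>. picard (noise \<omega>) n t) (\<lambda>_. 0) \<le> ennreal M"
proof -
  \<comment> \<open>Places \<open>(1 + r) * contr\<close> halfway between \<open>contr\<close> and
    1.\<close>
  define r where "r = (1 + contr) / (2 * contr) - 1"
  have r: "0 < r" "(1 + r) * contr = (1 + contr) / 2" using contr by (auto simp: r_def field_simps)
  define K where "K = (cS / mS)\<^sup>2 * ((1 + 1 / r) * (2 * mb\<^sup>2 + 2 * cb\<^sup>2 * conv_const))"
  have K: "0 \<le> K" using r conv_const(1) by (simp add: K_def)
  \<comment> \<open>The fixed point of the affine recursion, so the bound reproduces itself; it
    holds trivially for the zeroth iterate, which is 0.\<close>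
  define M where "M = K / (1 - (1 + contr) / 2)"
  have "0 < 1 - (1 + contr) / 2" using contr by simp
  then have M: "0 \<le> M" "(1 + r) * contr * M + K = M" using K unfolding r(2) M_def by (auto simp: field_simps)
  have "L2_dist_sq P (\<lambda>\<omega>. picard (noise \<omega>) n t) (\<lambda>_. 0) \<le> ennreal M" for n t
  proof (induction n arbitrary: t)
    case (Suc n)
    show ?case using picard_second_moment_step[OF r(1) M(1) Suc, of t] M(2) by (simp add: K_def)
  qed (simp add: L2_dist_sq_def)
  with M show ?thesis by blast
qed

section \<open>The solution and its properties\<close>

definition solution :: "real \<Rightarrow> (real \<Rightarrow> real^'d) \<Rightarrow> real^'d" where
  "solution t \<omega> = fixpoint (noise \<omega>) t + conv rate t \<omega>"

lemma solution_continuous_process: "continuous_process P solution"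
  unfolding solution_def[abs_def] by (rule continuous_process_add[OF fixpoint_process conv_continuous_process])

lemma solution_uniformly_bounded: "uniformly_bounded P solution"
proof -
  obtain M where M: "0 \<le> M" "\<And>n t. L2_dist_sq P (\<lambda>\<omega>. picard (noise \<omega>) n t) (\<lambda>_. 0) \<le> ennreal M"
    using picard_second_moment by blast
  have [measurable]: "(\<lambda>\<omega>. fixpoint (noise \<omega>) t) \<in> borel_measurable P" "(\<lambda>\<omega>. picard (noise \<omega>) n t) \<in> borel_measurable P" for t n
    using fixpoint_process picard_process by (auto simp: continuous_process_def)
  \<comment> \<open>Fatou's lemma transfers the uniform bound of the iterates to their pathwise
    limit.\<close>
  have fp: "L2_dist_sq P (\<lambda>\<omega>. fixpoint (noise \<omega>) t) (\<lambda>_. 0) \<le> ennreal M" for t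
  proof -
    have "L2_dist_sq P (\<lambda>\<omega>. fixpoint (noise \<omega>) t) (\<lambda>_. 0)
        = (\<integral>\<^sup>+\<omega>. liminf (\<lambda>n. ennreal ((norm (picard (noise \<omega>) n t))\<^sup>2)) \<partial>P)"
      unfolding L2_dist_sq_def diff_zero
    proof (rule nn_integral_cong)
      fix \<omega>
      have "(\<lambda>n. ennreal ((norm (picard (noise \<omega>) n t))\<^sup>2)) \<longlonglongrightarrow> ennreal ((norm (fixpoint (noise \<omega>) t))\<^sup>2)"
        by (intro tendsto_intros tendsto_ennrealI fixpoint(1)[OF forcing_noise])
      then show "ennreal ((norm (fixpoint (noise \<omega>) t))\<^sup>2) = liminf (\<lambda>n. ennreal ((norm (picard (noise \<omega>) n t))\<^sup>2))"
        by (rule lim_imp_Liminf[OF trivial_limit_sequentially, symmetric])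
    qed
    also have "\<dots> \<le> liminf (\<lambda>n. \<integral>\<^sup>+\<omega>. ennreal ((norm (picard (noise \<omega>) n t))\<^sup>2) \<partial>P)"
      by (rule nn_integral_liminf) auto
    also have "\<dots> \<le> ennreal M"
      using M(2)[of _ t] unfolding L2_dist_sq_def diff_zero by (intro Liminf_le always_eventually) auto
    finally show ?thesis .
  qed
  have "(\<integral>\<^sup>+\<omega>. ennreal ((norm (solution t \<omega>))\<^sup>2) \<partial>P) \<le> ennreal (2 * M + 2 * conv_const)" for t
  proof -
    have "(\<integral>\<^sup>+\<omega>. ennreal ((norm (solution t \<omega>))\<^sup>2) \<partial>P)
        = L2_dist_sq P (\<lambda>\<omega>. fixpoint (noise \<omega>) t + conv rate t \<omega>) (\<lambda>\<omega>. 0 + 0)"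
      by (simp add: L2_dist_sq_def solution_def)
    also have "\<dots> \<le> 2 * L2_dist_sq P (\<lambda>\<omega>. fixpoint (noise \<omega>) t) (\<lambda>_. 0) + 2 * L2_dist_sq P (conv rate t) (\<lambda>_. 0)"
      by (rule L2_dist_sq_add) auto
    also have "\<dots> \<le> 2 * ennreal M + 2 * ennreal conv_const" by (intro add_mono mult_left_mono fp conv_const) auto
    also have "\<dots> = ennreal (2 * M + 2 * conv_const)"
      using M conv_const(1) by (simp add: ennreal_collect del: ennreal_numeral ennreal_plus)
    finally show ?thesis .
  qed
  then have "(SUP t. \<integral>\<^sup>+\<omega>. ennreal ((norm (solution t \<omega>))\<^sup>2) \<partial>P) \<le> ennreal (2 * M + 2 * conv_const)" by (rule SUP_least)
  also have "\<dots> < \<infinity>" by simp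
  finally show ?thesis by (simp add: uniformly_bounded_def)
qed

lemma solution_shift: "shift_process \<tau> solution t \<omega> = solution t \<omega>"
  using fixpoint_shift[of "noise (wiener_shift (- \<tau>) \<omega>)" "noise \<omega>" t] conv_shift[OF rate(1)]
  by (simp add: shift_process_def solution_def)

lemma solution_theta_periodic: "theta_periodic P \<tau> solution"
  by (simp add: theta_periodic_def modification_of_def solution_shift)

lemma kernel_eq: "(\<lambda>s. matrix_exp ((t - s) *\<^sub>R A) ** \<sigma> s) = kernel t"
  by (simp add: kernel_def fun_eq_iff S)

text \<open>With \<open>conv rate t\<close> as version of the Wiener integral the equation holds for
  every path: it is the fixed point equation with the noise added on both sides.\<close>

lemma solution_mild: "mild_solution P H A b \<sigma> solution"
  unfolding mild_solution_def
proof (intro conjI allI solution_continuous_process)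
  fix t
  show "\<exists>I. has_wiener_integral_lower_infinite P H coordinate_process (\<lambda>s. matrix_exp ((t - s) *\<^sub>R A) ** \<sigma> s) t I \<and>
      (AE \<omega> in P. set_integrable lborel {..t} (\<lambda>s. matrix_exp ((t - s) *\<^sub>R A) *v b s (solution s \<omega>)) \<and>
        solution t \<omega> = (LINT s:{..t}|lborel. matrix_exp ((t - s) *\<^sub>R A) *v b s (solution s \<omega>)) + I \<omega>)"
  proof (intro exI[of _ "conv rate t"] conjI AE_I2)
    show "has_wiener_integral_lower_infinite P H coordinate_process (\<lambda>s. matrix_exp ((t - s) *\<^sub>R A) ** \<sigma> s) t (conv rate t)"
      unfolding kernel_eq by (rule has_lower_integral_conv_version[OF measurable_conv AE_conv[OF rate(1)]])
    fix \<omega>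
    show "set_integrable lborel {..t} (\<lambda>s. matrix_exp ((t - s) *\<^sub>R A) *v b s (solution s \<omega>))"
      using fixpoint(3)[OF forcing_noise, of t \<omega>] by (simp add: solution_def S)
    show "solution t \<omega> = (LINT s:{..t}|lborel. matrix_exp ((t - s) *\<^sub>R A) *v b s (solution s \<omega>)) + conv rate t \<omega>"
      using fixpoint(2)[OF forcing_noise, of \<omega> t] by (simp add: solution_def drift_def S)
  qed
qed

text \<open>The Wiener integrals of the two solutions agree almost surely and cancel, so the
  difference is a difference of drifts, and the Lipschitz bound gives
  \<open>B \<le> ennreal contr * B\<close> for the supremum \<open>B\<close> of the mean square
  distances.\<close>

lemma bounded_solution_unique:
  assumes X: "mild_solution P H A b \<sigma> X" "uniformly_bounded P X"
    and Y: "mild_solution P H A b \<sigma> Y" "uniformly_bounded P Y"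
  shows "modification_of P Y X"
proof -
  have cX: "continuous_process P X" and cY: "continuous_process P Y"
    using X Y by (auto simp: mild_solution_def)
  then have [measurable]: "X t \<in> borel_measurable P" "Y t \<in> borel_measurable P" for t
    by (auto simp: continuous_process_def)
  define F where "F s \<omega> = norm (X s \<omega> - Y s \<omega>)" for s \<omega>
  note [measurable] = continuous_process_jointly_measurable[OF cX] continuous_process_jointly_measurable[OF cY]
  have F: "(\<lambda>p. cb * F (fst p) (snd p)) \<in> borel_measurable (borel \<Otimes>\<^sub>M P)" unfolding F_def by measurable
  define B where "B = (SUP t. L2_dist_sq P (X t) (Y t))"
  have "L2_dist_sq P (X t) (Y t) \<le> 2 * (SUP t. \<integral>\<^sup>+\<omega>. ennreal ((norm (X t \<omega>))\<^sup>2) \<partial>P) + 2 * (SUP t. \<integral>\<^sup>+\<omega>. ennreal ((norm (Y t \<omega>))\<^sup>2) \<partial>P)" for t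
  proof -
    have "L2_dist_sq P (X t) (Y t) \<le> 2 * L2_dist_sq P (X t) (\<lambda>_. 0) + 2 * L2_dist_sq P (\<lambda>_. 0) (Y t)"
      by (rule L2_dist_sq_triangle) auto
    also have "\<dots> \<le> 2 * (SUP t. \<integral>\<^sup>+\<omega>. ennreal ((norm (X t \<omega>))\<^sup>2) \<partial>P) + 2 * (SUP t. \<integral>\<^sup>+\<omega>. ennreal ((norm (Y t \<omega>))\<^sup>2) \<partial>P)"
      unfolding L2_dist_sq_def by (intro add_mono mult_left_mono) (auto intro!: SUP_upper2[of t])
    finally show ?thesis .
  qed
  then have "B \<le> 2 * (SUP t. \<integral>\<^sup>+\<omega>. ennreal ((norm (X t \<omega>))\<^sup>2) \<partial>P) + 2 * (SUP t. \<integral>\<^sup>+\<omega>. ennreal ((norm (Y t \<omega>))\<^sup>2) \<partial>P)"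
    unfolding B_def by (rule SUP_least)
  also have "\<dots> < \<infinity>" using X(2) Y(2) by (simp add: uniformly_bounded_def ennreal_mult_less_top)
  finally have B: "B < \<infinity>" .
  have le: "L2_dist_sq P (X t) (Y t) \<le> ennreal contr * B" for t
  proof -
    obtain I where I: "has_wiener_integral_lower_infinite P H coordinate_process (\<lambda>s. matrix_exp ((t - s) *\<^sub>R A) ** \<sigma> s) t I"
      "AE \<omega> in P. set_integrable lborel {..t} (\<lambda>s. matrix_exp ((t - s) *\<^sub>R A) *v b s (X s \<omega>)) \<and>
        X t \<omega> = (LINT s:{..t}|lborel. matrix_exp ((t - s) *\<^sub>R A) *v b s (X s \<omega>)) + I \<omega>"
      using X(1) by (auto simp: mild_solution_def)
    obtain I' where I': "has_wiener_integral_lower_infinite P H coordinate_process (\<lambda>s. matrix_exp ((t - s) *\<^sub>R A) ** \<sigma> s) t I'"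
      "AE \<omega> in P. set_integrable lborel {..t} (\<lambda>s. matrix_exp ((t - s) *\<^sub>R A) *v b s (Y s \<omega>)) \<and>
        Y t \<omega> = (LINT s:{..t}|lborel. matrix_exp ((t - s) *\<^sub>R A) *v b s (Y s \<omega>)) + I' \<omega>"
      using Y(1) by (auto simp: mild_solution_def)
    have ae: "AE \<omega> in P. ennreal ((norm (X t \<omega> - Y t \<omega>))\<^sup>2) \<le> ennreal (cS\<^sup>2) * (past t (\<lambda>s. cb * F s \<omega>))\<^sup>2"
      using I(2) I'(2) has_lower_integral_unique[OF I(1) I'(1)] AE_space
    proof eventually_elim
      case (elim \<omega>)
      have "continuous_on UNIV (\<lambda>s. X s \<omega>)" "continuous_on UNIV (\<lambda>s. Y s \<omega>)"
        using cX cY elim(4) by (auto simp: continuous_process_def)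
      then have [measurable]: "(\<lambda>s. X s \<omega>) \<in> borel_measurable borel" "(\<lambda>s. Y s \<omega>) \<in> borel_measurable borel"
        by (auto intro: borel_measurable_continuous_onI)
      have i: "set_integrable lborel {..t} (\<lambda>s. S (t - s) *v b s (X s \<omega>))" "set_integrable lborel {..t} (\<lambda>s. S (t - s) *v b s (Y s \<omega>))"
        using elim by (simp_all add: S)
      have "X t \<omega> - Y t \<omega> = drift t (\<lambda>s. b s (X s \<omega>)) - drift t (\<lambda>s. b s (Y s \<omega>))"
        using elim by (simp add: drift_def S)
      also have "\<dots> = drift t (\<lambda>s. b s (X s \<omega>) - b s (Y s \<omega>))" by (rule drift_diff(1)[OF i])
      finally have "ennreal (norm (X t \<omega> - Y t \<omega>)) \<le> ennreal cS * past t (\<lambda>s. norm (b s (X s \<omega>) - b s (Y s \<omega>)))"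
        using norm_drift_le[OF drift_diff(2)[OF i]] by simp
      also have "\<dots> \<le> ennreal cS * past t (\<lambda>s. cb * F s \<omega>)"
        by (intro mult_left_mono past_mono) (auto simp: F_def b_lipschitz)
      finally have "(ennreal (norm (X t \<omega> - Y t \<omega>)))\<^sup>2 \<le> (ennreal cS * past t (\<lambda>s. cb * F s \<omega>))\<^sup>2"
        by (rule power_mono) auto
      then show ?case using S_pos by (simp add: power_mult_distrib ennreal_power)
    qed
    have FB: "(\<integral>\<^sup>+\<omega>. ennreal ((cb * F s \<omega>)\<^sup>2) \<partial>P) \<le> ennreal (cb\<^sup>2) * B" for s
    proof -
      have "(\<integral>\<^sup>+\<omega>. ennreal ((cb * F s \<omega>)\<^sup>2) \<partial>P) = ennreal (cb\<^sup>2) * L2_dist_sq P (X s) (Y s)"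
        unfolding L2_dist_sq_def F_def by (simp add: power_mult_distrib ennreal_mult nn_integral_cmult)
      also have "\<dots> \<le> ennreal (cb\<^sup>2) * B" unfolding B_def by (intro mult_left_mono SUP_upper) auto
      finally show ?thesis .
    qed
    have "L2_dist_sq P (X t) (Y t) \<le> (\<integral>\<^sup>+\<omega>. ennreal (cS\<^sup>2) * (past t (\<lambda>s. cb * F s \<omega>))\<^sup>2 \<partial>P)"
      unfolding L2_dist_sq_def by (rule nn_integral_mono_AE[OF ae])
    also have "\<dots> = ennreal (cS\<^sup>2) * (\<integral>\<^sup>+\<omega>. (past t (\<lambda>s. cb * F s \<omega>))\<^sup>2 \<partial>P)"
      using measurable_past_process[OF F, of t] by (intro nn_integral_cmult) measurable
    also have "\<dots> \<le> ennreal (cS\<^sup>2) * (ennreal (1 / mS\<^sup>2) * (ennreal (cb\<^sup>2) * B))"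
      using b_pos by (intro mult_left_mono past_second_moment_le[OF F _ FB]) (auto simp: F_def)
    also have "\<dots> = ennreal contr * B"
      by (simp add: contr_def mult.assoc[symmetric] ennreal_mult[symmetric] power_divide power_mult_distrib)
    finally show ?thesis .
  qed
  have "B \<le> ennreal contr * B" unfolding B_def[symmetric] by (subst (1) B_def) (rule SUP_least, rule le)
  \<comment> \<open>Finiteness of \<open>B\<close>, which uniform boundedness provides, is
    essential: an infinite \<open>B\<close> would satisfy the inequality as well.\<close>
  then have "B = 0"
  proof -
    obtain x where x: "B = ennreal x" "0 \<le> x" using B by (auto simp: less_top_ennreal)
    then have "ennreal x \<le> ennreal (contr * x)" using \<open>B \<le> ennreal contr * B\<close> contr by (simp add: ennreal_mult)
    then have "x \<le> contr * x" using x contr by (subst (asm) ennreal_le_iff) auto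
    then have "(1 - contr) * x \<le> 0" by (simp add: algebra_simps)
    then have "x \<le> 0" using contr by (simp add: mult_le_0_iff)
    then show ?thesis using x by simp
  qed
  then have "L2_dist_sq P (Y t) (X t) = 0" for t using le[of t] by (simp add: L2_dist_sq_commute)
  then show ?thesis unfolding modification_of_def by (simp add: L2_dist_sq_eq_0_iff)
qed

end

theorem proposition3p6:
  fixes H cS mS cb mb \<tau> :: real
    and A :: "real^'d^'d"
    and S :: "real \<Rightarrow> real^'d^'d"
    and b :: "real \<Rightarrow> real^'d \<Rightarrow> real^'d"
    and \<sigma> :: "real \<Rightarrow> real^'d^'d"
    and P :: "(real \<Rightarrow> real^'d) measure"
  assumes H: "1/2 < H" "H < 1"
    and S: "\<And>t. S t = matrix_exp (t *\<^sub>R A)"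
    and b_cont: "continuous_on UNIV (\<lambda>(t, x). b t x)"
    and sigma_cont: "continuous_on UNIV \<sigma>"
    and P: "canonical_fbm_law H P"
    and S_pos: "cS > 0" "mS > 0"
    and S_bound: "\<And>t. onorm ((*v) (S t)) \<le> cS * exp (- mS * t)"
    and b_pos: "cb > 0" "mb > 0"
    and b_lipschitz: "\<And>t x y. norm (b t x - b t y) \<le> cb * norm (x - y)"
    and b_growth: "\<And>t x. norm (b t x) \<le> mb * (1 + norm x)"
    and S_sigma: "\<And>t. (\<lambda>s. indicator {..t} s *\<^sub>R (S (t - s) ** \<sigma> s)) \<in> abs_H_mat H"
    and tau_pos: "\<tau> > 0"
    and sigma_periodic: "\<And>t. \<sigma> (t + \<tau>) = \<sigma> t"
    and b_periodic: "\<And>t x. b (t + \<tau>) x = b t x"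
    and contraction: "cS * cb / mS < 1"
  shows "\<exists>X. (mild_solution P H A b \<sigma> X \<and> uniformly_bounded P X \<and> theta_periodic P \<tau> X) \<and>
    (\<forall>Y. mild_solution P H A b \<sigma> Y \<and> uniformly_bounded P Y \<and> theta_periodic P \<tau> Y \<longrightarrow>
       modification_of P Y X)"
proof -
  interpret semilinear_setting H cS mS \<tau> A S \<sigma> P cb mb b
    by unfold_locales (use assms in auto)
  show ?thesis
    using solution_mild solution_uniformly_bounded solution_theta_periodic bounded_solution_unique by blast
qed

end
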